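(* Let $\Omega\subseteq\mathbb{R}^N$ be an open subset, $\theta\in[-\frac{\pi}{2},\frac{\pi}{2}]$, $0<m\le 1$, $a,\gamma\in\mathbb{C}$ (and $b=0$), and $f\in L^1_{\mathrm{loc}}([0,\infty);L^2(\Omega))$. Let $u$ be a weak solution of the equation $$e^{-\mathrm{i}\theta}\frac{\partial u}{\partial t}-\Delta u+a|u|^{-(1-m)}u+\gamma u=f \quad\text{in }(0,\infty)\times\Omega,\qquad u=0\ \text{on }(0,\infty)\times\partial\Omega .$$ Let $(u_n,f_n)_{n\in\mathbb{N}}\subset C([0,\infty);L^2(\Omega))\times L^1_{\mathrm{loc}}([0,\infty);L^2(\Omega))$ be any sequence such that each $u_n$ is an $H^2$-solution of this problem with right-hand side $f_n$ and such that, for every $T>0$, $u_n\to u$ in $C([0,T];L^2(\Omega))$ and $f_n\to f$ in $L^1((0,T);L^2(\Omega))$. Then $$u\in W^{1,1}_{\mathrm{loc}}\big([0,\infty);H^{-2}(\Omega)+L^{\frac{2}{m}}(\Omega)\big),$$ and $u$ solves the equation in $L^1_{\mathrm{loc}}\big([0,\infty);H^{-2}(\Omega)+L^{\frac{2}{m}}(\Omega)\big)$, and so in $\mathscr{D}'((0,\infty)\times\Omega)$. In addition, for any $T>0$, $$u_n\xrightarrow[n\to\infty]{}u\quad\text{in } W^{1,1}\big((0,T);H^{-2}(\Omega)+L^{\frac{2}{m}}(\Omega)\big).$$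
   Context: Functions are complex-valued, vector spaces are real, and $L^2(\Omega)$ (with scalar product $\mathrm{Re}\int_\Omega u\overline v\,dx$) is identified with its dual. For a Banach space $E$ and $r\in[1,\infty]$, $L^r_{\mathrm{loc}}([0,\infty);E)$ (resp. $W^{1,r}_{\mathrm{loc}}([0,\infty);E)$) is the set of functions whose restriction to $(0,T)$ belongs to $L^r((0,T);E)$ (resp. $W^{1,r}((0,T);E)$) for every $T>0$. $H^{-2}(\Omega)$ is the dual of $H^2_0(\Omega)$. The function $|u|^{-(1-m)}u$ is taken to be $0$ where $u=0$ ($m>0$). $H^2$-solution (case $b=0$, $m>0$): for a right-hand side $g\in L^1_{\mathrm{loc}}([0,\infty);L^2(\Omega))$, a function $u$ is an $H^2$-solution if (i) $u\in L^{m+1}_{\mathrm{loc}}\big([0,\infty);H^1_0(\Omega)\cap L^{m+1}(\Omega)\big)\cap W^{1,\frac{m+1}{m}}_{\mathrm{loc}}\big([0,\infty);L^2(\Omega)+L^{\frac{m+1}{m}}(\Omega)\big)$; (ii) $\Delta u(t)\in L^2(\Omega)$ for almost every $t>0$; (iii) $e^{-\mathrm{i}\theta}\partial_t u-\Delta u+a|u|^{-(1-m)}u+\gamma u=g$ in $\mathscr{D}'((0,\infty)\times\Omega)$. Such a $u$ belongs to $C([0,\infty);L^2(\Omega))$. Weak solution: $u$ is a weak solution with right-hand side $f$ if there exists a sequence $(u_n,f_n)_{n\in\mathbb{N}}\subset C([0,\infty);L^2(\Omega))\times L^1_{\mathrm{loc}}([0,\infty);L^2(\Omega))$ such that each $u_n$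 is an $H^2$-solution with right-hand side $f_n$ and, for every $T>0$, $u_n\to u$ in $C([0,T];L^2(\Omega))$ and $f_n\to f$ in $L^1((0,T);L^2(\Omega))$. *)

theory Defs
  imports "HOL-Analysis.Analysis" "HOL-Library.Function_Algebras"
begin

text \<open>
  Function spaces are encoded by extended (semi)norms: a normed space consists of the elements
  \<open>x\<close> of an ambient real vector space with \<open>N x < \<infinity>\<close>, two of them being identified when
  \<open>N (x - y) = 0\<close>.  Two ambient spaces occur.  Spaces of functions on \<open>\<Omega>\<close> live in
  \<open>'a \<Rightarrow> complex\<close>.  Spaces of distributions on \<open>\<Omega>\<close> live in \<open>('a \<Rightarrow> complex) \<Rightarrow> real\<close>: vector
  spaces are real, \<open>L\<^sup>2(\<Omega>)\<close> is identified with its dual through \<open>Re \<integral> u \<cdot> cnj v\<close>, and a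
  distribution is a real-linear functional on complex-valued test functions, of which
  only the values on test functions supported in \<open>\<Omega>\<close> matter.
\<close>

instantiation "fun" :: (type, real_vector) real_vector
begin

definition scaleR_fun :: "real \<Rightarrow> ('a \<Rightarrow> 'b) \<Rightarrow> 'a \<Rightarrow> 'b"
  where "scaleR_fun c f = (\<lambda>x. c *\<^sub>R f x)"

instance
  by standard (auto simp: scaleR_fun_def plus_fun_def scaleR_add_right scaleR_add_left)

end

definition epowr :: "ennreal \<Rightarrow> real \<Rightarrow> ennreal"
  where "epowr x p = (if x = \<infinity> then \<infinity> else ennreal (enn2real x powr p))"


subsection \<open>Test functions and distributions\<close>

definition dir_deriv :: "'a \<Rightarrow> ('a::euclidean_space \<Rightarrow> 'b::real_normed_vector) \<Rightarrow> 'a \<Rightarrow> 'b"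
  where "dir_deriv b \<phi> = (\<lambda>x. frechet_derivative \<phi> (at x) b)"

definition smooth :: "('a::euclidean_space \<Rightarrow> 'b::real_normed_vector) \<Rightarrow> bool"
  where "smooth \<phi> \<longleftrightarrow>
    (\<forall>bs. set bs \<subseteq> Basis \<longrightarrow> foldr dir_deriv bs \<phi> differentiable_on UNIV)"

definition test_functions :: "'a set \<Rightarrow> ('a::euclidean_space \<Rightarrow> 'b::real_normed_vector) set"
  where "test_functions U =
    {\<phi>. smooth \<phi> \<and> compact (closure {x. \<phi> x \<noteq> 0}) \<and> closure {x. \<phi> x \<noteq> 0} \<subseteq> U}"

definition fun_distr :: "'a set \<Rightarrow> ('a::euclidean_space \<Rightarrow> complex) \<Rightarrow> ('a \<Rightarrow> complex) \<Rightarrow> real"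
  where "fun_distr \<Omega> u \<phi> = Re (\<integral>x. u x * cnj (\<phi> x) \<partial>lebesgue_on \<Omega>)"

text \<open>
  The iterated integral, rather than one over \<open>(0,\<infinity>) \<times> \<Omega>\<close>, because \<open>u t\<close> is only determined up to
  a null set depending on \<open>t\<close>, so that the chosen representatives need not be jointly measurable.
\<close>
definition spacetime_distr ::
    "'a set \<Rightarrow> (real \<Rightarrow> 'a::euclidean_space \<Rightarrow> complex) \<Rightarrow> (real \<times> 'a \<Rightarrow> complex) \<Rightarrow> real"
  where "spacetime_distr \<Omega> u \<phi> =
    (\<integral>t. fun_distr \<Omega> (u t) (\<lambda>x. \<phi> (t, x)) \<partial>lebesgue_on {0<..})"

definition distr_deriv ::
    "'a \<Rightarrow> (('a::euclidean_space \<Rightarrow> complex) \<Rightarrow> real) \<Rightarrow> ('a \<Rightarrow> complex) \<Rightarrow> real"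
  where "distr_deriv b T = (\<lambda>\<phi>. - T (dir_deriv b \<phi>))"

text \<open>Multiplication by \<open>c\<close>, consistent with \<open>Re \<integral> c \<cdot> u \<cdot> cnj \<phi> = Re \<integral> u \<cdot> cnj (cnj c \<cdot> \<phi>)\<close>.\<close>
definition distr_cmul :: "complex \<Rightarrow> (('a \<Rightarrow> complex) \<Rightarrow> real) \<Rightarrow> ('a \<Rightarrow> complex) \<Rightarrow> real"
  where "distr_cmul c T = (\<lambda>\<phi>. T (\<lambda>x. cnj c * \<phi> x))"

definition laplacian :: "(('a::euclidean_space \<Rightarrow> complex) \<Rightarrow> real) \<Rightarrow> ('a \<Rightarrow> complex) \<Rightarrow> real"
  where "laplacian T = (\<Sum>b\<in>Basis. distr_deriv b (distr_deriv b T))"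

definition spacetime_dt ::
    "((real \<times> 'a::euclidean_space \<Rightarrow> complex) \<Rightarrow> real) \<Rightarrow> (real \<times> 'a \<Rightarrow> complex) \<Rightarrow> real"
  where "spacetime_dt T = distr_deriv (1, 0) T"

definition spacetime_laplacian ::
    "((real \<times> 'a::euclidean_space \<Rightarrow> complex) \<Rightarrow> real) \<Rightarrow> (real \<times> 'a \<Rightarrow> complex) \<Rightarrow> real"
  where "spacetime_laplacian T = (\<Sum>b\<in>Basis. distr_deriv (0, b) (distr_deriv (0, b) T))"


subsection \<open>Spaces over \<open>\<Omega>\<close>\<close>

definition Lp_norm :: "real \<Rightarrow> 'a set \<Rightarrow> ('a::euclidean_space \<Rightarrow> complex) \<Rightarrow> ennreal"
  where "Lp_norm p \<Omega> u =
    (if u \<in> borel_measurable (lebesgue_on \<Omega>)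
     then epowr (\<integral>\<^sup>+x. ennreal (cmod (u x) powr p) \<partial>lebesgue_on \<Omega>) (1 / p) else \<infinity>)"

text \<open>The space \<open>L\<^sup>p(\<Omega>)\<close> seen inside the distributions on \<open>\<Omega>\<close>; the infimum is over the (a.e. unique)
  representatives and is \<open>\<infinity>\<close> if there is none.\<close>
definition Lp_distr_norm ::
    "real \<Rightarrow> 'a set \<Rightarrow> (('a::euclidean_space \<Rightarrow> complex) \<Rightarrow> real) \<Rightarrow> ennreal"
  where "Lp_distr_norm p \<Omega> T =
    (INF g\<in>{g. \<forall>\<phi>\<in>test_functions \<Omega>. fun_distr \<Omega> g \<phi> = T \<phi>}. Lp_norm p \<Omega> g)"

definition Hk_norm :: "nat \<Rightarrow> 'a set \<Rightarrow> ('a::euclidean_space \<Rightarrow> complex) \<Rightarrow> ennreal"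
  where "Hk_norm k \<Omega> u =
    epowr ((Lp_norm 2 \<Omega> u)\<^sup>2 +
      (\<Sum>bs\<in>{bs. set bs \<subseteq> Basis \<and> 1 \<le> length bs \<and> length bs \<le> k}.
         (Lp_distr_norm 2 \<Omega> (foldr distr_deriv bs (fun_distr \<Omega> u)))\<^sup>2)) (1 / 2)"

definition Hk0_norm :: "nat \<Rightarrow> 'a set \<Rightarrow> ('a::euclidean_space \<Rightarrow> complex) \<Rightarrow> ennreal"
  where "Hk0_norm k \<Omega> u =
    (if \<exists>\<phi>. (\<forall>n. \<phi> n \<in> test_functions \<Omega>) \<and> (\<lambda>n::nat. Hk_norm k \<Omega> (u - \<phi> n)) \<longlonglongrightarrow> 0
     then Hk_norm k \<Omega> u else \<infinity>)"

definition dual_norm :: "('v::real_vector \<Rightarrow> ennreal) \<Rightarrow> ('v \<Rightarrow> real) \<Rightarrow> ennreal"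
  where "dual_norm N \<Lambda> =
    (if (\<forall>x y. N x < \<infinity> \<longrightarrow> N y < \<infinity> \<longrightarrow> \<Lambda> (x + y) = \<Lambda> x + \<Lambda> y) \<and>
        (\<forall>c x. N x < \<infinity> \<longrightarrow> \<Lambda> (c *\<^sub>R x) = c * \<Lambda> x)
     then (SUP x\<in>{x. N x \<le> 1}. ennreal \<bar>\<Lambda> x\<bar>) else \<infinity>)"

text \<open>The dual of \<open>H\<^sup>2\<^sub>0(\<Omega>)\<close>, embedded into the distributions by restriction to test functions.  The
  extending functional \<open>\<Lambda>\<close> is unique on \<open>H\<^sup>2\<^sub>0(\<Omega>)\<close> by density.\<close>
definition H_minus2_norm :: "'a set \<Rightarrow> (('a::euclidean_space \<Rightarrow> complex) \<Rightarrow> real) \<Rightarrow> ennreal"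
  where "H_minus2_norm \<Omega> T =
    (INF \<Lambda>\<in>{\<Lambda>. \<forall>\<phi>\<in>test_functions \<Omega>. \<Lambda> \<phi> = T \<phi>}. dual_norm (Hk0_norm 2 \<Omega>) \<Lambda>)"

definition inter_norm :: "('v \<Rightarrow> ennreal) \<Rightarrow> ('v \<Rightarrow> ennreal) \<Rightarrow> 'v \<Rightarrow> ennreal"
  where "inter_norm N M x = N x + M x"

definition sum_norm :: "('v::ab_group_add \<Rightarrow> ennreal) \<Rightarrow> ('v \<Rightarrow> ennreal) \<Rightarrow> 'v \<Rightarrow> ennreal"
  where "sum_norm N M x = (INF (y, z)\<in>{(y, z). y + z = x}. N y + M z)"


definition H_minus2_plus_Lp_norm ::
    "real \<Rightarrow> 'a set \<Rightarrow> (('a::euclidean_space \<Rightarrow> complex) \<Rightarrow> real) \<Rightarrow> ennreal"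
  where "H_minus2_plus_Lp_norm p \<Omega> = sum_norm (H_minus2_norm \<Omega>) (Lp_distr_norm p \<Omega>)"


subsection \<open>Vector-valued functions of time\<close>

definition strongly_measurable ::
    "'t measure \<Rightarrow> ('v::real_vector \<Rightarrow> ennreal) \<Rightarrow> ('t \<Rightarrow> 'v) \<Rightarrow> bool"
  where "strongly_measurable M N f \<longleftrightarrow>
    (\<exists>s. (\<forall>n::nat. simple_function M (s n) \<and> (\<forall>t\<in>space M. N (s n t) < \<infinity>)) \<and>
         (AE t in M. (\<lambda>n. N (f t - s n t)) \<longlonglongrightarrow> 0))"

text \<open>The analogue of \<^const>\<open>has_bochner_integral\<close> for the space given by the extended norm \<open>N\<close>.\<close>
definition has_bochner_integral_in ::
    "'t measure \<Rightarrow> ('v::real_vector \<Rightarrow> ennreal) \<Rightarrow> ('t \<Rightarrow> 'v) \<Rightarrow> 'v \<Rightarrow> bool"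
  where "has_bochner_integral_in M N f x \<longleftrightarrow>
    strongly_measurable M N f \<and> N x < \<infinity> \<and>
    (\<exists>s. (\<forall>n::nat. Bochner_Integration.simple_bochner_integrable M (s n) \<and> (\<forall>t\<in>space M. N (s n t) < \<infinity>)) \<and>
         (\<lambda>n. \<integral>\<^sup>+t. N (f t - s n t) \<partial>M) \<longlonglongrightarrow> 0 \<and>
         (\<lambda>n. N (Bochner_Integration.simple_bochner_integral M (s n) - x)) \<longlonglongrightarrow> 0)"

definition Lr_norm ::
    "real \<Rightarrow> real set \<Rightarrow> ('v::real_vector \<Rightarrow> ennreal) \<Rightarrow> (real \<Rightarrow> 'v) \<Rightarrow> ennreal"
  where "Lr_norm r I N f =
    (if strongly_measurable (lebesgue_on I) N f
     then epowr (\<integral>\<^sup>+t. epowr (N (f t)) r \<partial>lebesgue_on I) (1 / r) else \<infinity>)"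

definition has_weak_deriv ::
    "real set \<Rightarrow> ('v::real_vector \<Rightarrow> ennreal) \<Rightarrow> (real \<Rightarrow> 'v) \<Rightarrow> (real \<Rightarrow> 'v) \<Rightarrow> bool"
  where "has_weak_deriv I N u v \<longleftrightarrow>
    (\<forall>\<psi>::real \<Rightarrow> real. \<psi> \<in> test_functions I \<longrightarrow>
      (\<exists>z. has_bochner_integral_in (lebesgue_on I) N (\<lambda>t. deriv \<psi> t *\<^sub>R u t) z \<and>
           has_bochner_integral_in (lebesgue_on I) N (\<lambda>t. \<psi> t *\<^sub>R v t) (- z)))"

text \<open>The weak derivative is unique up to equality a.e., and the infimum is \<open>\<infinity>\<close> if there is none.\<close>
definition W1r_norm ::
    "real \<Rightarrow> real set \<Rightarrow> ('v::real_vector \<Rightarrow> ennreal) \<Rightarrow> (real \<Rightarrow> 'v) \<Rightarrow> ennreal"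
  where "W1r_norm r I N u =
    (INF v\<in>{v. has_weak_deriv I N u v}. Lr_norm r I N u + Lr_norm r I N v)"

definition Lr_loc :: "real \<Rightarrow> ('v::real_vector \<Rightarrow> ennreal) \<Rightarrow> (real \<Rightarrow> 'v) set"
  where "Lr_loc r N = {u. \<forall>T>0. Lr_norm r {0<..<T} N u < \<infinity>}"

definition W1r_loc :: "real \<Rightarrow> ('v::real_vector \<Rightarrow> ennreal) \<Rightarrow> (real \<Rightarrow> 'v) set"
  where "W1r_loc r N = {u. \<forall>T>0. W1r_norm r {0<..<T} N u < \<infinity>}"

definition C_halfline :: "('v::real_vector \<Rightarrow> ennreal) \<Rightarrow> (real \<Rightarrow> 'v) set"
  where "C_halfline N =
    {u. \<forall>t\<ge>0. N (u t) < \<infinity> \<and> ((\<lambda>s. N (u s - u t)) \<longlongrightarrow> 0) (at t within {0..})}"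


subsection \<open>The equation\<close>

definition power_nonlinearity :: "real \<Rightarrow> complex \<Rightarrow> complex"
  where "power_nonlinearity m z =
    (if z = 0 then 0 else of_real (cmod z powr (- (1 - m))) * z)"

definition solves_in_distributions ::
    "'a set \<Rightarrow> real \<Rightarrow> real \<Rightarrow> complex \<Rightarrow> complex \<Rightarrow>
     (real \<Rightarrow> 'a::euclidean_space \<Rightarrow> complex) \<Rightarrow> (real \<Rightarrow> 'a \<Rightarrow> complex) \<Rightarrow> bool"
  where "solves_in_distributions \<Omega> \<theta> m a \<gamma> g u \<longleftrightarrow>
    (\<forall>\<phi>\<in>test_functions ({0<..} \<times> \<Omega>).
      (distr_cmul (exp (- \<i> * of_real \<theta>)) (spacetime_dt (spacetime_distr \<Omega> u))
       - spacetime_laplacian (spacetime_distr \<Omega> u)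
       + distr_cmul a (spacetime_distr \<Omega> (\<lambda>t x. power_nonlinearity m (u t x)))
       + distr_cmul \<gamma> (spacetime_distr \<Omega> u)) \<phi>
      = spacetime_distr \<Omega> g \<phi>)"

text \<open>The equation holds in \<open>L\<^sup>1\<^sub>l\<^sub>o\<^sub>c([0,\<infinity>); E)\<close>, where \<open>E\<close> is a space of distributions on \<open>\<Omega>\<close>: every term
  belongs to that space, and for almost every \<open>t\<close> the two sides are the same distribution.\<close>
definition solves_in_L1_loc ::
    "((('a \<Rightarrow> complex) \<Rightarrow> real) \<Rightarrow> ennreal) \<Rightarrow>
     'a set \<Rightarrow> real \<Rightarrow> real \<Rightarrow> complex \<Rightarrow> complex \<Rightarrow>
     (real \<Rightarrow> 'a::euclidean_space \<Rightarrow> complex) \<Rightarrow> (real \<Rightarrow> 'a \<Rightarrow> complex) \<Rightarrow> bool"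
  where "solves_in_L1_loc E \<Omega> \<theta> m a \<gamma> g u \<longleftrightarrow>
    (\<exists>u'. has_weak_deriv {0<..} E (\<lambda>t. fun_distr \<Omega> (u t)) u' \<and>
      (\<lambda>t. distr_cmul (exp (- \<i> * of_real \<theta>)) (u' t)) \<in> Lr_loc 1 E \<and>
      (\<lambda>t. laplacian (fun_distr \<Omega> (u t))) \<in> Lr_loc 1 E \<and>
      (\<lambda>t. distr_cmul a (fun_distr \<Omega> (\<lambda>x. power_nonlinearity m (u t x)))) \<in> Lr_loc 1 E \<and>
      (\<lambda>t. distr_cmul \<gamma> (fun_distr \<Omega> (u t))) \<in> Lr_loc 1 E \<and>
      (\<lambda>t. fun_distr \<Omega> (g t)) \<in> Lr_loc 1 E \<and>
      (AE t in lebesgue_on {0<..}. \<forall>\<phi>\<in>test_functions \<Omega>.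
        (distr_cmul (exp (- \<i> * of_real \<theta>)) (u' t)
         - laplacian (fun_distr \<Omega> (u t))
         + distr_cmul a (fun_distr \<Omega> (\<lambda>x. power_nonlinearity m (u t x)))
         + distr_cmul \<gamma> (fun_distr \<Omega> (u t))) \<phi>
        = fun_distr \<Omega> (g t) \<phi>))"

definition H2_solution ::
    "'a set \<Rightarrow> real \<Rightarrow> real \<Rightarrow> complex \<Rightarrow> complex \<Rightarrow>
     (real \<Rightarrow> 'a::euclidean_space \<Rightarrow> complex) \<Rightarrow> (real \<Rightarrow> 'a \<Rightarrow> complex) \<Rightarrow> bool"
  where "H2_solution \<Omega> \<theta> m a \<gamma> g u \<longleftrightarrow>
    g \<in> Lr_loc 1 (Lp_norm 2 \<Omega>) \<and>
    u \<in> Lr_loc (m + 1) (inter_norm (Hk0_norm 1 \<Omega>) (Lp_norm (m + 1) \<Omega>)) \<and>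
    u \<in> W1r_loc ((m + 1) / m) (sum_norm (Lp_norm 2 \<Omega>) (Lp_norm ((m + 1) / m) \<Omega>)) \<and>
    (AE t in lebesgue_on {0<..}. Lp_distr_norm 2 \<Omega> (laplacian (fun_distr \<Omega> (u t))) < \<infinity>) \<and>
    solves_in_distributions \<Omega> \<theta> m a \<gamma> g u"

definition approximating_sequence ::
    "'a set \<Rightarrow> real \<Rightarrow> real \<Rightarrow> complex \<Rightarrow> complex \<Rightarrow>
     (real \<Rightarrow> 'a::euclidean_space \<Rightarrow> complex) \<Rightarrow> (real \<Rightarrow> 'a \<Rightarrow> complex) \<Rightarrow>
     (nat \<Rightarrow> real \<Rightarrow> 'a \<Rightarrow> complex) \<Rightarrow> (nat \<Rightarrow> real \<Rightarrow> 'a \<Rightarrow> complex) \<Rightarrow> bool"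
  where "approximating_sequence \<Omega> \<theta> m a \<gamma> f u f\<^sub>n u\<^sub>n \<longleftrightarrow>
    (\<forall>n. u\<^sub>n n \<in> C_halfline (Lp_norm 2 \<Omega>) \<and> f\<^sub>n n \<in> Lr_loc 1 (Lp_norm 2 \<Omega>) \<and>
         H2_solution \<Omega> \<theta> m a \<gamma> (f\<^sub>n n) (u\<^sub>n n)) \<and>
    (\<forall>T>0. (\<lambda>n. SUP t\<in>{0..T}. Lp_norm 2 \<Omega> (u\<^sub>n n t - u t)) \<longlonglongrightarrow> 0) \<and>
    (\<forall>T>0. (\<lambda>n. Lr_norm 1 {0<..<T} (Lp_norm 2 \<Omega>) (\<lambda>t. f\<^sub>n n t - f t)) \<longlonglongrightarrow> 0)"

text \<open>Continuity of \<open>u\<close> is listed for definiteness only; it follows from the locally uniform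
  convergence.\<close>
definition weak_solution ::
    "'a set \<Rightarrow> real \<Rightarrow> real \<Rightarrow> complex \<Rightarrow> complex \<Rightarrow>
     (real \<Rightarrow> 'a::euclidean_space \<Rightarrow> complex) \<Rightarrow> (real \<Rightarrow> 'a \<Rightarrow> complex) \<Rightarrow> bool"
  where "weak_solution \<Omega> \<theta> m a \<gamma> f u \<longleftrightarrow>
    u \<in> C_halfline (Lp_norm 2 \<Omega>) \<and>
    (\<exists>f\<^sub>n u\<^sub>n. approximating_sequence \<Omega> \<theta> m a \<gamma> f u f\<^sub>n u\<^sub>n)"

end

theory Submission
  imports Defs
begin

text \<open>
  The equation determines the time derivative of a solution as
  \<open>u' = exp (i \<theta>) (\<Delta>u - a |u|^(m-1) u - \<gamma> u + f)\<close>, and every term on the right is controlled by \<open>u\<close> in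
  \<open>C([0,\<infinity>); L\<^sup>2)\<close> and \<open>f\<close> in \<open>L\<^sup>1\<^sub>l\<^sub>o\<^sub>c([0,\<infinity>); L\<^sup>2)\<close> alone: \<open>L\<^sup>2\<close> embeds into \<open>H\<^sup>-\<^sup>2\<close>, the Laplacian maps \<open>L\<^sup>2\<close>
  boundedly into \<open>H\<^sup>-\<^sup>2\<close>, and the power nonlinearity is Hoelder continuous of exponent \<open>m\<close>, so that it maps
  \<open>L\<^sup>2\<close> to \<open>L\<^sup>2\<^sup>/\<^sup>m\<close> with \<open>\<parallel>g(u) - g(v)\<parallel> \<le> 2 \<parallel>u - v\<parallel>^m\<close>.  Hence the convergence of \<open>u\<^sub>n\<close> and \<open>f\<^sub>n\<close> makes the
  right-hand sides converge, both in \<open>L\<^sup>1((0,T); H\<^sup>-\<^sup>2 + L\<^sup>2\<^sup>/\<^sup>m)\<close> and after testing with a space-time test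
  function.  The second convergence shows that \<open>u\<close> solves the equation in the sense of distributions; the first one
  then gives all the remaining claims, because the right-hand side is the weak derivative.

  Three points carry the weight of the proof.

  \<^item> To see that the right-hand side is the weak derivative, the equation is tested with products
  \<open>\<psi>(t) \<phi>(x)\<close>.  This compares \<open>\<integral>\<psi>' u\<close> with the integral of \<open>\<psi>\<close> times the right-hand side once these Bochner
  integrals exist.  They are formed separately in \<open>L\<^sup>2\<close> and \<open>L\<^sup>2\<^sup>/\<^sup>m\<close>, which are complete
  (\<open>complete_norm_Lp_norm\<close>, \<open>ex_has_bochner_integral_in\<close>), and are then transported into \<open>H\<^sup>-\<^sup>2 + L\<^sup>2\<^sup>/\<^sup>m\<close> by bounded
  linear maps (\<open>has_bochner_integral_in_image_scaleR\<close>).  The result is \<open>has_weak_deriv_equation_velocity\<close>.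

  \<^item> A bound in \<open>H\<^sup>-\<^sup>2\<close> asks for a functional on all of \<open>H\<^sup>2\<^sub>0\<close>.  A functional on test functions that is bounded by
  the \<open>H\<^sup>2\<close> norm extends by density (\<open>H_minus2_norm_le_of_test_bound\<close>).  That norm is an infimum over representatives
  of weak derivatives; for a test function it dominates the \<open>L\<^sup>2\<close> norm of a classical second derivative, because a
  representative can be paired with that derivative itself (\<open>Lp_norm_le_Lp_distr_norm_test\<close>).

  \<^item> For a space-time test function \<open>\<Phi>\<close> the slice pairing \<open>t \<mapsto> \<langle>w(t), \<Phi>(t, \<cdot>)\<rangle>\<close> is measurable although
  \<open>w\<close> need not be jointly measurable (\<open>borel_measurable_fun_distr_slice\<close>), and so the space-time pairing is Lipschitz
  continuous in the \<open>L\<^sup>1(L\<^sup>p)\<close> norm (\<open>spacetime_distr_diff_le\<close>).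
\<close>

section \<open>Extended seminorms\<close>

text \<open>
  The spaces of the problem are described by \<open>[0,\<infinity>]\<close>-valued functions on an ambient vector space.  Homogeneity is
  required for all scalars, with \<open>0 \<cdot> \<infinity> = 0\<close>.
\<close>
locale ext_seminorm =
  fixes N :: "'v::real_vector \<Rightarrow> ennreal"
  assumes triangle: "N (x + y) \<le> N x + N y"
    and scaleR: "N (c *\<^sub>R x) = ennreal \<bar>c\<bar> * N x"
begin

lemma zero [simp]: "N 0 = 0"
  using scaleR[of 0 0] by simp

lemma minus [simp]: "N (- x) = N x"
  using scaleR[of "-1" x] by simp

lemma minus_commute: "N (x - y) = N (y - x)"
  using minus[of "x - y"] by simp

lemma le_add_diff: "N x \<le> N y + N (x - y)"
  using triangle[of y "x - y"] by simp

lemma diff_le: "N (x - y) \<le> N x + N y"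
  using triangle[of x "- y"] by simp

lemma diff_triangle: "N (x - z) \<le> N (x - y) + N (y - z)"
  using triangle[of "x - y" "y - z"] by simp

lemma eq_of_diff_zero: "N (x - y) = 0 \<Longrightarrow> N x = N y"
  using le_add_diff[of x y] le_add_diff[of y x] by (simp add: minus_commute[of y x] antisym)

lemma add_finite: "N x < top \<Longrightarrow> N y < top \<Longrightarrow> N (x + y) < top"
  using triangle[of x y] by (metis ennreal_add_eq_top order_le_less_trans less_top)

lemma diff_finite: "N x < top \<Longrightarrow> N y < top \<Longrightarrow> N (x - y) < top"
  using add_finite[of x "- y"] by simp

lemma scaleR_finite: "N x < top \<Longrightarrow> N (c *\<^sub>R x) < top"
  by (simp add: scaleR ennreal_mult_less_top)

lemma sum_finite: "(\<And>i. i \<in> A \<Longrightarrow> N (g i) < top) \<Longrightarrow> N (\<Sum>i\<in>A. g i) < top"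
  by (induction A rule: infinite_finite_induct) (auto intro!: add_finite simp del: less_top[symmetric])

lemma tendsto:
  assumes "((\<lambda>i. N (f i - y)) \<longlongrightarrow> 0) F"
  shows "((\<lambda>i. N (f i)) \<longlongrightarrow> N y) F"
proof (cases "N y = \<infinity>")
  case True
  have "\<forall>\<^sub>F i in F. N (f i - y) < 1"
    using assms by (rule order_tendstoD) simp
  then have "\<forall>\<^sub>F i in F. N (f i) = \<infinity>"
  proof eventually_elim
    case (elim i)
    have "\<infinity> \<le> N (f i) + N (f i - y)"
      using le_add_diff[of y "f i"] unfolding True minus_commute[of y "f i"] by simp
    moreover have "N (f i - y) \<noteq> \<infinity>"
      using elim by auto
    ultimately show ?case
      by (metis ennreal_add_eq_top infinity_ennreal_def top_unique)
  qed
  then show ?thesis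
    using True by (simp add: tendsto_eventually)
next
  case False
  have 1: "((\<lambda>i. N y - N (f i - y)) \<longlongrightarrow> N y) F"
    using tendsto_diff_ennreal[OF tendsto_const assms, of "N y"] False by simp
  have 2: "((\<lambda>i. N y + N (f i - y)) \<longlongrightarrow> N y) F"
    using tendsto_add[OF tendsto_const assms, of "N y"] by simp
  have 3: "N y - N (f i - y) \<le> N (f i)" for i
  proof -
    have "N y \<le> N (f i - y) + N (f i)"
      using le_add_diff[of y "f i"] by (subst add.commute) (simp only: minus_commute[of "f i" y])
    moreover have "N (f i) = top" if "N y = top"
      using False that by simp
    ultimately show ?thesis
      unfolding ennreal_minus_le_iff by blast
  qed
  show ?thesis
    by (rule tendsto_sandwich[OF always_eventually always_eventually 1 2]) (intro allI 3 le_add_diff)+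
qed

lemma tendsto_commute:
  "((\<lambda>i. N (y - f i)) \<longlongrightarrow> 0) F \<longleftrightarrow> ((\<lambda>i. N (f i - y)) \<longlongrightarrow> 0) F"
proof -
  have "N (y - f i) = N (f i - y)" for i
    by (rule minus_commute)
  then show ?thesis
    by presburger
qed

end

section \<open>Strong measurability and Bochner integrals\<close>

lemma (in complete_measure) borel_measurable_AE_eq:
  assumes g: "g \<in> borel_measurable M" and eq: "AE x in M. f x = g x"
  shows "f \<in> borel_measurable M"
proof (rule measurableI)
  fix A :: "'b::topological_space set" assume A: "A \<in> sets borel"
  have "AE x in M. x \<in> g -` A \<inter> space M \<longleftrightarrow> x \<in> f -` A \<inter> space M"
    using eq by eventually_elim auto
  then show "f -` A \<inter> space M \<in> sets M"
    by (rule in_sets_AE) (use measurable_sets[OF g A] in auto)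
qed simp

lemma complete_measure_lebesgue_on:
  assumes "S \<in> sets lebesgue"
  shows "complete_measure (lebesgue_on S)"
proof
  fix A B assume "B \<subseteq> A" "A \<in> null_sets (lebesgue_on S)"
  then have "B \<subseteq> S" "B \<in> null_sets lebesgue"
    using assms by (auto simp: null_sets_restrict_space intro: null_sets_completion_subset)
  then have "B \<in> null_sets (lebesgue_on S)"
    using assms by (simp add: null_sets_restrict_space)
  then show "B \<in> sets (lebesgue_on S)"
    by auto
qed

lemma tendsto_zero_le_ennreal:
  fixes f g :: "'a \<Rightarrow> ennreal"
  assumes "(g \<longlongrightarrow> 0) F" "\<And>x. f x \<le> g x"
  shows "(f \<longlongrightarrow> 0) F"
  using tendsto_sandwich[of "\<lambda>_. 0" f F g 0] assms by (simp add: always_eventually)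

lemma tendsto_cmult_zero_ennreal:
  fixes g :: "'a \<Rightarrow> ennreal"
  assumes "(g \<longlongrightarrow> 0) F" "c < \<infinity>"
  shows "((\<lambda>x. c * g x) \<longlongrightarrow> 0) F"
  using ennreal_tendsto_cmult[OF _ assms(1), of c] assms(2) by simp

abbreviation step_integrable :: "'t measure \<Rightarrow> ('t \<Rightarrow> 'v::real_vector) \<Rightarrow> bool"
  where "step_integrable \<equiv> Bochner_Integration.simple_bochner_integrable"

abbreviation step_integral :: "'t measure \<Rightarrow> ('t \<Rightarrow> 'v::real_vector) \<Rightarrow> 'v"
  where "step_integral \<equiv> Bochner_Integration.simple_bochner_integral"

context ext_seminorm
begin

lemma strongly_measurable_AE_finite:
  assumes "strongly_measurable M N f"
  shows "AE t in M. N (f t) < \<infinity>"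
proof -
  obtain s where s: "\<And>n::nat. simple_function M (s n)" "\<And>n t. t \<in> space M \<Longrightarrow> N (s n t) < \<infinity>"
    and lim: "AE t in M. (\<lambda>n. N (f t - s n t)) \<longlonglongrightarrow> 0"
    using assms unfolding strongly_measurable_def by blast
  from lim AE_space show ?thesis
  proof eventually_elim
    case (elim t)
    have "\<forall>\<^sub>F n in sequentially. N (f t - s n t) < 1"
      using elim(1) by (rule order_tendstoD(2)) simp
    then obtain n where "N (f t - s n t) < 1"
      by (auto simp: eventually_sequentially)
    then have "N (f t - s n t) < top"
      by (rule order_less_trans) simp
    with add_finite[of "s n t" "f t - s n t"] s(2)[OF elim(2), of n] show ?case
      by simp
  qed
qed

lemma borel_measurable_norm_simple:
  "simple_function M s \<Longrightarrow> (\<lambda>t. N (s t)) \<in> borel_measurable M"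
  by (rule borel_measurable_simple_function[OF simple_function_compose1[where g=N]])

text \<open>
  The norm of a strongly measurable function is an almost everywhere limit of step functions, hence measurable when
  the measure is complete.  This makes \<open>\<integral> N (f t)\<close> additive below.
\<close>
lemma borel_measurable_norm:
  assumes "complete_measure M" "strongly_measurable M N f"
  shows "(\<lambda>t. N (f t)) \<in> borel_measurable M"
proof -
  obtain s where s: "\<And>n::nat. simple_function M (s n)"
    and lim: "AE t in M. (\<lambda>n. N (f t - s n t)) \<longlonglongrightarrow> 0"
    using assms unfolding strongly_measurable_def by blast
  show ?thesis
  proof (rule complete_measure.borel_measurable_AE_eq[OF assms(1)])
    show "(\<lambda>t. liminf (\<lambda>n. N (s n t))) \<in> borel_measurable M"
      by (intro borel_measurable_liminf borel_measurable_norm_simple s)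
    show "AE t in M. N (f t) = liminf (\<lambda>n. N (s n t))"
      using lim
    proof eventually_elim
      case (elim t)
      then have "(\<lambda>n. N (s n t)) \<longlonglongrightarrow> N (f t)"
        by (rule tendsto[OF tendsto_commute[THEN iffD1]])
      from lim_imp_Liminf[OF _ this] show ?case
        by simp
    qed
  qed
qed

lemma strongly_measurable_simple:
  "simple_function M s \<Longrightarrow> (\<And>t. t \<in> space M \<Longrightarrow> N (s t) < \<infinity>) \<Longrightarrow> strongly_measurable M N s"
  unfolding strongly_measurable_def
  by (rule exI[of _ "\<lambda>_. s"], intro conjI allI ballI) (simp_all only: diff_self zero tendsto_const AE_I2)

lemma strongly_measurable_cong:
  assumes f: "strongly_measurable M N f" and fg: "AE t in M. N (f t - g t) = 0"
  shows "strongly_measurable M N g"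
proof -
  obtain s where s: "\<And>n::nat. simple_function M (s n) \<and> (\<forall>t\<in>space M. N (s n t) < \<infinity>)"
    and lim: "AE t in M. (\<lambda>n. N (f t - s n t)) \<longlonglongrightarrow> 0"
    using f unfolding strongly_measurable_def by blast
  have "AE t in M. (\<lambda>n. N (g t - s n t)) \<longlonglongrightarrow> 0"
    using lim fg
  proof eventually_elim
    case (elim t)
    have "N (f t - s n t) = N (g t - s n t)" for n
      using elim by (intro eq_of_diff_zero) simp
    then show ?case
      using elim by simp
  qed
  with s show ?thesis
    unfolding strongly_measurable_def by blast
qed

lemma strongly_measurable_add:
  assumes f: "strongly_measurable M N f" and g: "strongly_measurable M N g"
  shows "strongly_measurable M N (\<lambda>t. f t + g t)"
proof -
  obtain s where s: "\<And>n::nat. simple_function M (s n)" "\<And>n t. t \<in> space M \<Longrightarrow> N (s n t) < \<infinity>"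
    and lims: "AE t in M. (\<lambda>n. N (f t - s n t)) \<longlonglongrightarrow> 0"
    using f unfolding strongly_measurable_def by blast
  obtain r where r: "\<And>n::nat. simple_function M (r n)" "\<And>n t. t \<in> space M \<Longrightarrow> N (r n t) < \<infinity>"
    and limr: "AE t in M. (\<lambda>n. N (g t - r n t)) \<longlonglongrightarrow> 0"
    using g unfolding strongly_measurable_def by blast
  have "AE t in M. (\<lambda>n. N (f t + g t - (s n t + r n t))) \<longlonglongrightarrow> 0"
    using lims limr
  proof eventually_elim
    case (elim t)
    have "(\<lambda>n. N (f t - s n t) + N (g t - r n t)) \<longlonglongrightarrow> 0"
      using tendsto_add[OF elim] by simp
    then show ?case
      by (rule tendsto_zero_le_ennreal) (unfold add_diff_add, rule triangle)
  qed
  moreover have "simple_function M (\<lambda>t. s n t + r n t)" for n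
    by (rule simple_function_compose2[OF s(1) r(1)])
  ultimately show ?thesis
    unfolding strongly_measurable_def using s r
    by (intro exI[of _ "\<lambda>n t. s n t + r n t"]) (simp add: add_finite)
qed

lemma strongly_measurable_minus: "strongly_measurable M N f \<Longrightarrow> strongly_measurable M N (\<lambda>t. - f t)"
proof -
  assume "strongly_measurable M N f"
  then obtain s where s: "\<And>n::nat. simple_function M (s n)" "\<And>n t. t \<in> space M \<Longrightarrow> N (s n t) < \<infinity>"
    and lim: "AE t in M. (\<lambda>n. N (f t - s n t)) \<longlonglongrightarrow> 0"
    unfolding strongly_measurable_def by blast
  have "N (- f t - - s n t) = N (f t - s n t)" for t n
    by (subst minus_commute) simp
  moreover have "simple_function M (\<lambda>t. - s n t)" for n
    using s(1) by (rule simple_function_compose1[where g=uminus])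
  ultimately show ?thesis
    unfolding strongly_measurable_def using s(2) lim
    by (intro exI[of _ "\<lambda>n t. - s n t"]) (simp only: minus simp_thms, simp)
qed

lemma strongly_measurable_diff:
  "strongly_measurable M N f \<Longrightarrow> strongly_measurable M N g \<Longrightarrow> strongly_measurable M N (\<lambda>t. f t - g t)"
  using strongly_measurable_add[OF _ strongly_measurable_minus, of M f g] by simp

lemma strongly_measurable_diff_step:
  assumes "strongly_measurable M N f" "step_integrable M s" "\<And>t. t \<in> space M \<Longrightarrow> N (s t) < \<infinity>"
  shows "strongly_measurable M N (\<lambda>t. f t - s t)"
proof (rule strongly_measurable_diff[OF assms(1) strongly_measurable_simple[OF _ assms(3)]])
  show "simple_function M s"
    using assms(2) by (rule simple_bochner_integrable.cases)
qed

lemma has_bochner_integral_in_cong: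
  assumes f: "has_bochner_integral_in M N f x" and fg: "AE t in M. N (f t - g t) = 0"
    and xy: "N (x - y) = 0"
  shows "has_bochner_integral_in M N g y"
proof -
  obtain s where s: "\<forall>n::nat. step_integrable M (s n) \<and> (\<forall>t\<in>space M. N (s n t) < \<infinity>)"
    and int: "(\<lambda>n. \<integral>\<^sup>+t. N (f t - s n t) \<partial>M) \<longlonglongrightarrow> 0"
    and lim: "(\<lambda>n. N (step_integral M (s n) - x)) \<longlonglongrightarrow> 0"
    and smf: "strongly_measurable M N f" "N x < \<infinity>"
    using f unfolding has_bochner_integral_in_def by blast
  have "(\<integral>\<^sup>+t. N (f t - s n t) \<partial>M) = (\<integral>\<^sup>+t. N (g t - s n t) \<partial>M)" for n
  proof (rule nn_integral_cong_AE)
    show "AE t in M. N (f t - s n t) = N (g t - s n t)"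
      using fg by eventually_elim (rule eq_of_diff_zero, simp)
  qed
  moreover have "N (z - x) = N (z - y)" for z
    using xy by (intro eq_of_diff_zero) (simp add: minus_commute)
  moreover have "N x = N y"
    by (rule eq_of_diff_zero) fact
  ultimately show ?thesis
    unfolding has_bochner_integral_in_def
    using s int lim smf strongly_measurable_cong[OF smf(1) fg] by auto
qed

lemma has_bochner_integral_in_add:
  assumes M: "complete_measure M" and f: "has_bochner_integral_in M N f x" and g: "has_bochner_integral_in M N g y"
  shows "has_bochner_integral_in M N (\<lambda>t. f t + g t) (x + y)"
proof -
  obtain s where s: "\<And>n::nat. step_integrable M (s n)" "\<And>n t. t \<in> space M \<Longrightarrow> N (s n t) < \<infinity>"
    and ints: "(\<lambda>n. \<integral>\<^sup>+t. N (f t - s n t) \<partial>M) \<longlonglongrightarrow> 0"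
    and lims: "(\<lambda>n. N (step_integral M (s n) - x)) \<longlonglongrightarrow> 0"
    and smf: "strongly_measurable M N f" "N x < \<infinity>"
    using f unfolding has_bochner_integral_in_def by blast
  obtain r where r: "\<And>n::nat. step_integrable M (r n)" "\<And>n t. t \<in> space M \<Longrightarrow> N (r n t) < \<infinity>"
    and intr: "(\<lambda>n. \<integral>\<^sup>+t. N (g t - r n t) \<partial>M) \<longlonglongrightarrow> 0"
    and limr: "(\<lambda>n. N (step_integral M (r n) - y)) \<longlonglongrightarrow> 0"
    and smg: "strongly_measurable M N g" "N y < \<infinity>"
    using g unfolding has_bochner_integral_in_def by blast
  have [measurable]: "(\<lambda>t. N (f t - s n t)) \<in> borel_measurable M" "(\<lambda>t. N (g t - r n t)) \<in> borel_measurable M" for n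
    using borel_measurable_norm[OF M strongly_measurable_diff_step[OF smf(1) s]]
      borel_measurable_norm[OF M strongly_measurable_diff_step[OF smg(1) r]]
    by simp_all
  have sr: "step_integrable M (\<lambda>t. s n t + r n t)" for n
    by (rule simple_bochner_integrable_compose2[OF _ s(1) r(1)]) simp
  have "(\<lambda>n. (\<integral>\<^sup>+t. N (f t - s n t) \<partial>M) + (\<integral>\<^sup>+t. N (g t - r n t) \<partial>M)) \<longlonglongrightarrow> 0"
    using tendsto_add[OF ints intr] by simp
  then have 1: "(\<lambda>n. \<integral>\<^sup>+t. N (f t + g t - (s n t + r n t)) \<partial>M) \<longlonglongrightarrow> 0"
  proof (rule tendsto_zero_le_ennreal)
    fix n
    have "(\<integral>\<^sup>+t. N (f t + g t - (s n t + r n t)) \<partial>M) \<le> (\<integral>\<^sup>+t. N (f t - s n t) + N (g t - r n t) \<partial>M)"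
      by (intro nn_integral_mono) (unfold add_diff_add, rule triangle)
    then show "(\<integral>\<^sup>+t. N (f t + g t - (s n t + r n t)) \<partial>M) \<le> (\<integral>\<^sup>+t. N (f t - s n t) \<partial>M) + (\<integral>\<^sup>+t. N (g t - r n t) \<partial>M)"
      by (simp add: nn_integral_add)
  qed
  have "(\<lambda>n. N (step_integral M (s n) - x) + N (step_integral M (r n) - y)) \<longlonglongrightarrow> 0"
    using tendsto_add[OF lims limr] by simp
  then have 2: "(\<lambda>n. N (step_integral M (\<lambda>t. s n t + r n t) - (x + y))) \<longlonglongrightarrow> 0"
    by (rule tendsto_zero_le_ennreal)
      (unfold simple_bochner_integral_add[OF s(1) r(1)] add_diff_add, rule triangle)
  show ?thesis
    unfolding has_bochner_integral_in_def
  proof (intro conjI)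
    show "strongly_measurable M N (\<lambda>t. f t + g t)"
      by (rule strongly_measurable_add[OF smf(1) smg(1)])
    show "N (x + y) < \<infinity>"
      using smf(2) smg(2) by (simp add: add_finite)
    show "\<exists>s. (\<forall>n. step_integrable M (s n) \<and> (\<forall>t\<in>space M. N (s n t) < \<infinity>)) \<and>
        (\<lambda>n. \<integral>\<^sup>+t. N (f t + g t - s n t) \<partial>M) \<longlonglongrightarrow> 0 \<and>
        (\<lambda>n. N (step_integral M (s n) - (x + y))) \<longlonglongrightarrow> 0"
    proof (intro exI conjI allI ballI)
      show "N (s n t + r n t) < \<infinity>" if "t \<in> space M" for n t
        using s(2)[OF that] r(2)[OF that] by (simp add: add_finite)
    qed (rule sr 1 2)+
  qed
qed

end

section \<open>Bounded linear maps and Bochner integrals\<close>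

text \<open>
  Maps such as \<open>u \<mapsto> fun_distr \<Omega> u\<close> are linear only on integrable functions and only up to the values at
  functions that are not test functions on \<open>\<Omega>\<close>; both defects are invisible to the seminorm \<open>N'\<close> when the arguments have finite
  seminorm.  The condition \<open>L 0 = 0\<close> is exact because a step function composed with \<open>L\<close> must vanish wherever the
  step function does, in order to keep a support of finite measure.
\<close>
definition bounded_linear_upto ::
    "('v::real_vector \<Rightarrow> ennreal) \<Rightarrow> ('w::real_vector \<Rightarrow> ennreal) \<Rightarrow> real \<Rightarrow> ('v \<Rightarrow> 'w) \<Rightarrow> bool"
  where "bounded_linear_upto N N' C L \<longleftrightarrow>
    L 0 = 0 \<and>
    (\<forall>x y. N x < \<infinity> \<longrightarrow> N y < \<infinity> \<longrightarrow> N' (L (x + y) - (L x + L y)) = 0) \<and>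
    (\<forall>c x. N x < \<infinity> \<longrightarrow> N' (L (c *\<^sub>R x) - c *\<^sub>R L x) = 0) \<and>
    (\<forall>x. N x < \<infinity> \<longrightarrow> N' (L x) \<le> ennreal C * N x)"

locale bounded_map = N: ext_seminorm N + N': ext_seminorm N'
  for N :: "'v::real_vector \<Rightarrow> ennreal" and N' :: "'w::real_vector \<Rightarrow> ennreal" +
  fixes C :: real and L :: "'v \<Rightarrow> 'w"
  assumes bl: "bounded_linear_upto N N' C L"
begin

lemma zero [simp]: "L 0 = 0"
  and add: "N x < top \<Longrightarrow> N y < top \<Longrightarrow> N' (L (x + y) - (L x + L y)) = 0"
  and scale: "N x < top \<Longrightarrow> N' (L (c *\<^sub>R x) - c *\<^sub>R L x) = 0"
  and bound: "N x < top \<Longrightarrow> N' (L x) \<le> ennreal C * N x"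
  using bl unfolding bounded_linear_upto_def by simp_all

lemma finite: "N x < top \<Longrightarrow> N' (L x) < top"
  using bound[of x] by (metis ennreal_less_top ennreal_mult_less_top le_less_trans)

lemma diff:
  assumes "N x < top" "N y < top"
  shows "N' (L (x - y) - (L x - L y)) = 0"
proof -
  have d: "N (x - y) < top"
    by (rule N.diff_finite[OF assms])
  have "N' (L x - (L (x - y) + L y)) = 0"
    using add[OF d assms(2)] by simp
  moreover have "L (x - y) - (L x - L y) = - (L x - (L (x - y) + L y))"
    by simp
  ultimately show ?thesis
    by (simp only: N'.minus)
qed

lemma bound_diff:
  assumes "N x < top" "N y < top"
  shows "N' (L x - L y) \<le> ennreal C * N (x - y)"
proof -
  have "N' (L x - L y) = N' (L (x - y))"
    using diff[OF assms] by (metis N'.eq_of_diff_zero)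
  also have "\<dots> \<le> ennreal C * N (x - y)"
    by (intro bound N.diff_finite assms)
  finally show ?thesis .
qed

lemma sum:
  assumes "finite A" "\<And>y. y \<in> A \<Longrightarrow> N y < top"
  shows "N' (L (\<Sum>y\<in>A. c y *\<^sub>R y) - (\<Sum>y\<in>A. c y *\<^sub>R L y)) = 0"
  using assms
proof (induction A)
  case (insert y A)
  let ?S = "\<Sum>y\<in>A. c y *\<^sub>R y" and ?T = "\<Sum>y\<in>A. c y *\<^sub>R L y"
  have fin: "N y < top" "N (c y *\<^sub>R y) < top" "N ?S < top"
    using insert.prems by (auto intro!: N.sum_finite N.scaleR_finite)
  have "L (c y *\<^sub>R y + ?S) - (c y *\<^sub>R L y + ?T)
      = (L (c y *\<^sub>R y + ?S) - (L (c y *\<^sub>R y) + L ?S)) + ((L (c y *\<^sub>R y) - c y *\<^sub>R L y) + (L ?S - ?T))"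
    by simp
  also have "N' \<dots> \<le> 0 + (0 + 0)"
    using add[OF fin(2,3)] scale[OF fin(1)] insert.IH insert.prems
    by (intro order_trans[OF N'.triangle] add_mono) auto
  finally show ?case
    using insert.hyps by simp
qed simp

lemma strongly_measurable_image:
  assumes "strongly_measurable M N f"
  shows "strongly_measurable M N' (\<lambda>t. L (f t))"
proof -
  obtain s where s: "\<And>n::nat. simple_function M (s n)" "\<And>n t. t \<in> space M \<Longrightarrow> N (s n t) < \<infinity>"
    and lim: "AE t in M. (\<lambda>n. N (f t - s n t)) \<longlonglongrightarrow> 0"
    using assms unfolding strongly_measurable_def by blast
  have "AE t in M. (\<lambda>n. N' (L (f t) - L (s n t))) \<longlonglongrightarrow> 0"
    using lim N.strongly_measurable_AE_finite[OF assms] AE_space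
  proof eventually_elim
    case (elim t)
    have "(\<lambda>n. ennreal C * N (f t - s n t)) \<longlonglongrightarrow> 0"
      by (rule tendsto_cmult_zero_ennreal[OF elim(1)]) simp
    then show ?case
      by (rule tendsto_zero_le_ennreal) (use elim s(2)[OF elim(3)] in \<open>auto intro: bound_diff\<close>)
  qed
  moreover have "simple_function M (\<lambda>t. L (s n t))" for n
    by (rule simple_function_compose1[OF s(1)])
  ultimately show ?thesis
    unfolding strongly_measurable_def using s(2) finite
    by (intro exI[of _ "\<lambda>n t. L (s n t)"]) simp
qed

text \<open>
  Approximating step functions are mapped to approximating step functions, and \<open>L\<close> commutes with their integrals up to a
  difference of seminorm zero.
\<close>
lemma has_bochner_integral_in_image:
  assumes M: "complete_measure M" and f: "has_bochner_integral_in M N f x"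
  shows "has_bochner_integral_in M N' (\<lambda>t. L (f t)) (L x)"
proof -
  obtain s where s: "\<And>n::nat. step_integrable M (s n)" "\<And>n t. t \<in> space M \<Longrightarrow> N (s n t) < \<infinity>"
    and int: "(\<lambda>n. \<integral>\<^sup>+t. N (f t - s n t) \<partial>M) \<longlonglongrightarrow> 0"
    and lim: "(\<lambda>n. N (step_integral M (s n) - x)) \<longlonglongrightarrow> 0"
    and f: "strongly_measurable M N f" and x: "N x < \<infinity>"
    using f unfolding has_bochner_integral_in_def by blast
  have simple: "simple_function M (s n)" for n
    using s(1) by (rule simple_bochner_integrable.cases)
  note diff = N.strongly_measurable_diff_step[OF f s]
  have Ls: "step_integrable M (\<lambda>t. L (s n t))" for n
    by (rule simple_bochner_integrable_compose2[where p="\<lambda>x y. L x", OF _ s(1) s(1)]) simp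
  have "(\<lambda>n. ennreal C * (\<integral>\<^sup>+t. N (f t - s n t) \<partial>M)) \<longlonglongrightarrow> 0"
    by (rule tendsto_cmult_zero_ennreal[OF int]) simp
  then have 1: "(\<lambda>n. \<integral>\<^sup>+t. N' (L (f t) - L (s n t)) \<partial>M) \<longlonglongrightarrow> 0"
  proof (rule tendsto_zero_le_ennreal)
    fix n
    have "(\<integral>\<^sup>+t. N' (L (f t) - L (s n t)) \<partial>M) \<le> (\<integral>\<^sup>+t. ennreal C * N (f t - s n t) \<partial>M)"
      using N.strongly_measurable_AE_finite[OF f] AE_space
      by (intro nn_integral_mono_AE, eventually_elim) (use s(2) in \<open>auto intro: bound_diff\<close>)
    also have "\<dots> = ennreal C * (\<integral>\<^sup>+t. N (f t - s n t) \<partial>M)"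
      by (intro nn_integral_cmult N.borel_measurable_norm[OF M diff])
    finally show "(\<integral>\<^sup>+t. N' (L (f t) - L (s n t)) \<partial>M) \<le> ennreal C * (\<integral>\<^sup>+t. N (f t - s n t) \<partial>M)" .
  qed
  have eq: "N' (L (step_integral M (s n)) - step_integral M (\<lambda>t. L (s n t))) = 0"
    and fin: "N (step_integral M (s n)) < top" for n
  proof -
    have finite: "finite (s n ` space M)" "\<And>y. y \<in> s n ` space M \<Longrightarrow> N y < top"
      using simple[of n] s(2) by (auto simp: simple_function_def)
    have "step_integral M (\<lambda>t. L (s n t)) = (\<Sum>y\<in>s n ` space M. measure M {x \<in> space M. s n x = y} *\<^sub>R L y)"
      by (rule simple_bochner_integral_partition[OF Ls simple]) auto
    then show "N' (L (step_integral M (s n)) - step_integral M (\<lambda>t. L (s n t))) = 0"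
      using sum[OF finite] by (simp add: simple_bochner_integral_def)
    show "N (step_integral M (s n)) < top"
      unfolding simple_bochner_integral_def by (intro N.sum_finite N.scaleR_finite finite)
  qed
  have "(\<lambda>n. ennreal C * N (step_integral M (s n) - x)) \<longlonglongrightarrow> 0"
    by (rule tendsto_cmult_zero_ennreal[OF lim]) simp
  then have 2: "(\<lambda>n. N' (step_integral M (\<lambda>t. L (s n t)) - L x)) \<longlonglongrightarrow> 0"
  proof (rule tendsto_zero_le_ennreal)
    fix n
    let ?I = "step_integral M (s n)"
    have "N' (step_integral M (\<lambda>t. L (s n t)) - L x) = N' (L ?I - L x)"
      using eq[of n] by (intro N'.eq_of_diff_zero) (simp add: N'.minus_commute)
    also have "\<dots> \<le> ennreal C * N (?I - x)"
      using x by (intro bound_diff fin) simp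
    finally show "N' (step_integral M (\<lambda>t. L (s n t)) - L x) \<le> ennreal C * N (?I - x)" .
  qed
  show ?thesis
    unfolding has_bochner_integral_in_def
  proof (intro conjI exI[of _ "\<lambda>n t. L (s n t)"] allI ballI)
    show "N' (L (s n t)) < \<infinity>" if "t \<in> space M" for n t
      using finite s(2)[OF that] by simp
    show "N' (L x) < \<infinity>"
      using finite x by simp
  qed (rule strongly_measurable_image f Ls 1 2)+
qed

end

lemma ext_seminorm_abs: "ext_seminorm (\<lambda>r::real. ennreal \<bar>r\<bar>)"
proof
  show "ennreal \<bar>x + y\<bar> \<le> ennreal \<bar>x\<bar> + ennreal \<bar>y\<bar>" for x y :: real
    by (simp flip: ennreal_plus)
  show "ennreal \<bar>c *\<^sub>R x\<bar> = ennreal \<bar>c\<bar> * ennreal \<bar>x\<bar>" for c x :: real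
    by (simp add: abs_mult ennreal_mult)
qed

lemma strongly_measurable_real:
  assumes M: "complete_measure M" and f: "strongly_measurable M (\<lambda>r::real. ennreal \<bar>r\<bar>) f"
  shows "f \<in> borel_measurable M"
proof -
  obtain s where s: "\<And>n::nat. simple_function M (s n)"
    and lim: "AE t in M. (\<lambda>n. ennreal \<bar>f t - s n t\<bar>) \<longlonglongrightarrow> 0"
    using f unfolding strongly_measurable_def by blast
  show ?thesis
  proof (rule complete_measure.borel_measurable_AE_eq[OF M])
    show "(\<lambda>t. lim (\<lambda>n. s n t)) \<in> borel_measurable M"
      by (intro borel_measurable_lim_metric borel_measurable_simple_function s)
    show "AE t in M. f t = lim (\<lambda>n. s n t)"
      using lim
    proof eventually_elim
      case (elim t)
      have "(\<lambda>n. \<bar>f t - s n t\<bar>) \<longlonglongrightarrow> 0"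
        using elim by (subst (asm) ennreal_tendsto_0_iff) simp_all
      then have "(\<lambda>n. s n t) \<longlonglongrightarrow> f t"
        by (subst tendsto_iff) (auto simp: tendsto_rabs_zero_iff LIMSEQ_iff dist_real_def abs_minus_commute eventually_sequentially)
      then show ?case
        by (rule limI[symmetric])
    qed
  qed
qed

text \<open>
  With the absolute value as seminorm on the real line the Bochner integral is the Lebesgue integral.  Together with
  transport under a bounded functional this evaluates vector-valued integrals on test functions.
\<close>
lemma has_bochner_integral_in_real:
  assumes M: "complete_measure M" and f: "has_bochner_integral_in M (\<lambda>r::real. ennreal \<bar>r\<bar>) f x"
  shows "has_bochner_integral M f x"
proof -
  obtain s where s: "\<And>n::nat. step_integrable M (s n)"
    and int: "(\<lambda>n. \<integral>\<^sup>+t. ennreal \<bar>f t - s n t\<bar> \<partial>M) \<longlonglongrightarrow> 0"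
    and lim: "(\<lambda>n. ennreal \<bar>step_integral M (s n) - x\<bar>) \<longlonglongrightarrow> 0"
    and f: "strongly_measurable M (\<lambda>r::real. ennreal \<bar>r\<bar>) f"
    using f unfolding has_bochner_integral_in_def by blast
  show ?thesis
  proof (rule has_bochner_integral.intros[OF strongly_measurable_real[OF M f] s])
    show "(\<lambda>i. \<integral>\<^sup>+ x. ennreal (norm (f x - s i x)) \<partial>M) \<longlonglongrightarrow> 0"
      using int by simp
    have "(\<lambda>n. \<bar>step_integral M (s n) - x\<bar>) \<longlonglongrightarrow> 0"
      using lim by (subst (asm) ennreal_tendsto_0_iff) simp_all
    then show "(\<lambda>i. step_integral M (s i)) \<longlonglongrightarrow> x"
      by (simp add: tendsto_rabs_zero_iff LIM_zero_iff)
  qed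
qed

definition complete_norm :: "('v::real_vector \<Rightarrow> ennreal) \<Rightarrow> bool"
  where "complete_norm N \<longleftrightarrow> (\<forall>y. (\<forall>n::nat. N (y n) < \<infinity>) \<longrightarrow>
    (\<forall>e>0. \<exists>K. \<forall>i\<ge>K. \<forall>j\<ge>K. N (y i - y j) < e) \<longrightarrow>
    (\<exists>x. N x < \<infinity> \<and> (\<lambda>n. N (y n - x)) \<longlonglongrightarrow> 0))"

lemma complete_normE:
  assumes "complete_norm N" "\<And>n::nat. N (y n) < \<infinity>"
    and "\<And>e. 0 < e \<Longrightarrow> \<exists>K. \<forall>i\<ge>K. \<forall>j\<ge>K. N (y i - y j) < e"
  obtains x where "N x < \<infinity>" "(\<lambda>n. N (y n - x)) \<longlonglongrightarrow> 0"
  using assms(1)[unfolded complete_norm_def, rule_format, of y] assms(2,3) by blast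

context ext_seminorm
begin

lemma norm_simple_bochner_integral_le:
  assumes s: "step_integrable M s" "\<And>t. t \<in> space M \<Longrightarrow> N (s t) < top"
  shows "N (step_integral M s) \<le> (\<integral>\<^sup>+t. N (s t) \<partial>M)"
proof -
  let ?g = "\<lambda>t. enn2real (N (s t))"
  have simple: "simple_function M s"
    using s(1) by (rule simple_bochner_integrable.cases)
  have g: "step_integrable M ?g"
    by (rule simple_bochner_integrable_compose2[where p="\<lambda>x y. enn2real (N x)", OF _ s(1) s(1)]) simp
  have "N (step_integral M s)
      \<le> (\<Sum>y\<in>s ` space M. N (measure M {x \<in> space M. s x = y} *\<^sub>R y))"
  proof -
    have "N (\<Sum>y\<in>A. c y *\<^sub>R y) \<le> (\<Sum>y\<in>A. N (c y *\<^sub>R y))" for A and c :: "'v \<Rightarrow> real"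
      by (induction A rule: infinite_finite_induct) (auto intro: order_trans[OF triangle] add_left_mono)
    then show ?thesis
      unfolding simple_bochner_integral_def .
  qed
  also have "\<dots> = (\<Sum>y\<in>s ` space M. ennreal (measure M {x \<in> space M. s x = y} *\<^sub>R enn2real (N y)))"
  proof (rule sum.cong[OF refl])
    fix y assume "y \<in> s ` space M"
    then have "N y = ennreal (enn2real (N y))"
      using s(2) by (auto simp: ennreal_enn2real)
    then show "N (measure M {x \<in> space M. s x = y} *\<^sub>R y) = ennreal (measure M {x \<in> space M. s x = y} *\<^sub>R enn2real (N y))"
      by (simp add: scaleR ennreal_mult)
  qed
  also have "\<dots> = ennreal (\<Sum>y\<in>s ` space M. measure M {x \<in> space M. s x = y} *\<^sub>R enn2real (N y))"
    by (rule sum_ennreal) simp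
  also have "(\<Sum>y\<in>s ` space M. measure M {x \<in> space M. s x = y} *\<^sub>R enn2real (N y)) = step_integral M ?g"
    by (rule simple_bochner_integral_partition[OF g simple, symmetric]) auto
  also have "ennreal \<dots> = (\<integral>\<^sup>+t. ?g t \<partial>M)"
    by (rule simple_bochner_integral_eq_nn_integral[OF g]) simp
  also have "\<dots> = (\<integral>\<^sup>+t. N (s t) \<partial>M)"
    using s(2) by (intro nn_integral_cong) (simp add: ennreal_enn2real)
  finally show ?thesis .
qed

text \<open>
  The approximating step functions \<open>s n\<close> are cut off to zero where their norm exceeds twice the norm of \<open>f\<close>.  The cut-off
  functions are dominated by \<open>2 N (f t)\<close>, so dominated convergence applies, their integrals form a Cauchy sequence, and
  completeness provides the value.
\<close>
theorem ex_has_bochner_integral_in: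
  assumes M: "complete_measure M" and N: "complete_norm N"
    and f: "strongly_measurable M N f" and fin: "(\<integral>\<^sup>+t. N (f t) \<partial>M) < \<infinity>"
  shows "\<exists>x. has_bochner_integral_in M N f x"
proof -
  obtain s where s: "\<And>n::nat. simple_function M (s n)" "\<And>n t. t \<in> space M \<Longrightarrow> N (s n t) < \<infinity>"
    and lim: "AE t in M. (\<lambda>n. N (f t - s n t)) \<longlonglongrightarrow> 0"
    using f unfolding strongly_measurable_def by blast
  note Nf[measurable] = borel_measurable_norm[OF M f]
  note Ns[measurable] = borel_measurable_norm_simple[OF s(1)]
  \<comment> \<open>Requiring \<open>0 < N (s n t)\<close> makes \<open>r n\<close> vanish exactly where its norm does, so its support has finite measure.\<close>
  define A where "A n = {t \<in> space M. N (s n t) \<le> 2 * N (f t) \<and> 0 < N (s n t)}" for n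
  have A[measurable]: "A n \<in> sets M" for n
    unfolding A_def by measurable
  define r where "r n t = (if t \<in> A n then s n t else 0)" for n t
  have r_simple: "simple_function M (r n)" for n
    unfolding r_def using s(1) A by (intro simple_function_If_set) auto
  have r_le: "N (r n t) \<le> 2 * N (f t)" for n t
    by (simp add: r_def A_def)
  have r_fin: "N (r n t) < top" if "t \<in> space M" for n t
    using s(2)[OF that] by (simp add: r_def)
  have r_int: "step_integrable M (r n)" for n
  proof (rule simple_bochner_integrable.intros[OF r_simple])
    have "emeasure M {t \<in> space M. N (r n t) \<noteq> 0} \<noteq> \<infinity>"
    proof (rule simple_function_finite_support)
      show "simple_function M (\<lambda>t. N (r n t))"
        by (rule simple_function_compose1[OF r_simple])
      have "(\<integral>\<^sup>+t. N (r n t) \<partial>M) \<le> (\<integral>\<^sup>+t. 2 * N (f t) \<partial>M)"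
        by (intro nn_integral_mono r_le)
      also have "\<dots> < \<infinity>"
        using fin by (simp add: nn_integral_cmult ennreal_mult_less_top)
      finally show "(\<integral>\<^sup>+t. N (r n t) \<partial>M) < \<infinity>" .
    qed simp
    moreover have "N (r n t) \<noteq> 0 \<longleftrightarrow> r n t \<noteq> 0" for t
      by (auto simp: r_def A_def)
    ultimately show "emeasure M {t \<in> space M. r n t \<noteq> 0} \<noteq> \<infinity>"
      by simp
  qed
  have r_diff: "strongly_measurable M N (\<lambda>t. f t - r n t)" for n
    by (rule strongly_measurable_diff_step[OF f r_int]) (use r_fin in simp)
  have meas[measurable]: "(\<lambda>t. N (f t - r n t)) \<in> borel_measurable M" for n
    by (rule borel_measurable_norm[OF M r_diff])
  have lim_r: "AE t in M. (\<lambda>n. N (f t - r n t)) \<longlonglongrightarrow> 0"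
    using lim strongly_measurable_AE_finite[OF f] AE_space
  proof eventually_elim
    case (elim t)
    show ?case
    proof (cases "N (f t) = 0")
      case True
      have "N (f t - r n t) \<le> 0" for n
        using diff_le[of "f t" "r n t"] r_le[of n t] True by simp
      then show ?thesis
        by simp
    next
      case False
      have ns: "(\<lambda>n. N (s n t)) \<longlonglongrightarrow> N (f t)"
        by (rule tendsto[OF tendsto_commute[THEN iffD1, OF elim(1)]])
      have "1 * N (f t) < 2 * N (f t)"
        using False elim(2) by (intro ennreal_mult_strict_right_mono) (auto simp: zero_less_iff_neq_zero)
      then have "\<forall>\<^sub>F n in sequentially. N (s n t) < 2 * N (f t)"
        by (intro order_tendstoD(2)[OF ns]) simp
      moreover have "\<forall>\<^sub>F n in sequentially. 0 < N (s n t)"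
        using False by (intro order_tendstoD(1)[OF ns]) (simp add: zero_less_iff_neq_zero)
      ultimately have "\<forall>\<^sub>F n in sequentially. N (f t - s n t) = N (f t - r n t)"
        by eventually_elim (use elim(3) in \<open>simp add: r_def A_def less_imp_le\<close>)
      with elim(1) show ?thesis
        by (rule Lim_transform_eventually)
    qed
  qed
  have int: "(\<lambda>n. \<integral>\<^sup>+t. N (f t - r n t) \<partial>M) \<longlonglongrightarrow> 0"
  proof -
    have "(\<lambda>n. \<integral>\<^sup>+t. N (f t - r n t) \<partial>M) \<longlonglongrightarrow> (\<integral>\<^sup>+t. 0 \<partial>M)"
    proof (rule nn_integral_dominated_convergence[where w="\<lambda>t. 3 * N (f t)"])
      show "AE t in M. N (f t - r n t) \<le> 3 * N (f t)" for n
      proof (rule AE_I2)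
        fix t
        have "N (f t - r n t) \<le> N (f t) + 2 * N (f t)"
          using diff_le[of "f t" "r n t"] r_le[of n t] by (meson add_left_mono order_trans)
        also have "\<dots> = (1 + 2) * N (f t)"
          by (subst distrib_right) simp
        finally show "N (f t - r n t) \<le> 3 * N (f t)"
          by simp
      qed
      show "(\<integral>\<^sup>+t. 3 * N (f t) \<partial>M) < \<infinity>"
        using fin by (simp add: nn_integral_cmult ennreal_mult_less_top)
    qed (use lim_r in measurable)
    then show ?thesis by simp
  qed
  let ?I = "\<lambda>n. step_integral M (r n)"
  have I_fin: "N (?I n) < \<infinity>" for n
    using r_fin r_simple[of n] unfolding simple_bochner_integral_def
    by (auto intro!: sum_finite scaleR_finite)
  have I_diff: "N (?I i - ?I j) \<le> (\<integral>\<^sup>+t. N (f t - r i t) \<partial>M) + (\<integral>\<^sup>+t. N (f t - r j t) \<partial>M)" for i j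
  proof -
    have "N (?I i - ?I j) = N (step_integral M (\<lambda>t. r i t - r j t))"
      by (simp add: simple_bochner_integral_diff[OF r_int r_int])
    also have "\<dots> \<le> (\<integral>\<^sup>+t. N (r i t - r j t) \<partial>M)"
      by (intro norm_simple_bochner_integral_le simple_bochner_integrable_compose2[where p="(-)", OF _ r_int r_int] diff_finite r_fin) auto
    also have "\<dots> \<le> (\<integral>\<^sup>+t. N (f t - r i t) + N (f t - r j t) \<partial>M)"
    proof (rule nn_integral_mono)
      show "N (r i t - r j t) \<le> N (f t - r i t) + N (f t - r j t)" for t
        using diff_triangle[of "r i t" "r j t" "f t"] minus_commute[of "r i t" "f t"] by simp
    qed
    also have "\<dots> = (\<integral>\<^sup>+t. N (f t - r i t) \<partial>M) + (\<integral>\<^sup>+t. N (f t - r j t) \<partial>M)"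
      by (intro nn_integral_add meas)
    finally show ?thesis .
  qed
  have "\<exists>K. \<forall>i\<ge>K. \<forall>j\<ge>K. N (?I i - ?I j) < e" if "0 < e" for e
  proof -
    obtain d :: ennreal where d: "0 < d" "d + d \<le> e"
    proof (cases e)
      case top
      then show thesis by (intro that[of 1]) auto
    next
      case (real r)
      with \<open>0 < e\<close> show thesis
        by (intro that[of "ennreal (r / 2)"]) (auto simp flip: ennreal_plus)
    qed
    obtain K where K: "\<And>n. n \<ge> K \<Longrightarrow> (\<integral>\<^sup>+t. N (f t - r n t) \<partial>M) < d"
      using order_tendstoD(2)[OF int d(1)] by (auto simp: eventually_sequentially)
    have "N (?I i - ?I j) < e" if "i \<ge> K" "j \<ge> K" for i j
      using I_diff[of i j] add_strict_mono[OF K K, OF that] d(2) by simp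
    then show ?thesis by blast
  qed
  then obtain x where x: "N x < \<infinity>" "(\<lambda>n. N (?I n - x)) \<longlonglongrightarrow> 0"
    by (rule complete_normE[OF N I_fin])
  show ?thesis
    unfolding has_bochner_integral_in_def
    using f x int r_int r_fin by (intro exI[of _ x] conjI exI[of _ r]) simp_all
qed

end

section \<open>Lebesgue spaces: Minkowski inequality and completeness\<close>

lemma epowr_le_iff:
  assumes "0 < p" "0 \<le> A"
  shows "epowr x (1 / p) \<le> ennreal A \<longleftrightarrow> x \<le> ennreal (A powr p)"
proof (cases x)
  case (real r)
  have "r powr (1 / p) \<le> A \<longleftrightarrow> r \<le> A powr p"
  proof
    assume "r powr (1 / p) \<le> A"
    then have "(r powr (1 / p)) powr p \<le> A powr p"
      using assms by (intro powr_mono2) auto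
    then show "r \<le> A powr p"
      using assms real by (simp add: powr_powr)
  next
    assume "r \<le> A powr p"
    then have "r powr (1 / p) \<le> (A powr p) powr (1 / p)"
      using assms real by (intro powr_mono2) auto
    then show "r powr (1 / p) \<le> A"
      using assms by (simp add: powr_powr)
  qed
  then show ?thesis
    using real assms by (simp add: epowr_def)
qed (simp add: epowr_def top_unique)

abbreviation Lp_integral :: "real \<Rightarrow> 'a set \<Rightarrow> ('a::euclidean_space \<Rightarrow> complex) \<Rightarrow> ennreal"
  where "Lp_integral p \<Omega> u \<equiv> \<integral>\<^sup>+x. ennreal (cmod (u x) powr p) \<partial>lebesgue_on \<Omega>"

lemma Lp_norm_le_iff:
  assumes "0 < p" "0 \<le> A"
  shows "Lp_norm p \<Omega> u \<le> ennreal A \<longleftrightarrow> u \<in> borel_measurable (lebesgue_on \<Omega>) \<and>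
    Lp_integral p \<Omega> u \<le> ennreal (A powr p)"
  unfolding Lp_norm_def using epowr_le_iff[OF assms] by (simp add: top_unique)

lemma Lp_norm_finite_iff:
  shows "Lp_norm p \<Omega> u < top \<longleftrightarrow> u \<in> borel_measurable (lebesgue_on \<Omega>) \<and>
    Lp_integral p \<Omega> u < top"
  unfolding Lp_norm_def epowr_def by (auto simp: top.not_eq_extremum)

lemma Lp_norm_measurable: "Lp_norm p \<Omega> u < top \<Longrightarrow> u \<in> borel_measurable (lebesgue_on \<Omega>)"
  by (simp add: Lp_norm_finite_iff)

lemma powr_convex_combination:
  fixes x y s t p :: real
  assumes "1 \<le> p" "0 \<le> x" "0 \<le> y" "0 < s" "0 < t" "s + t = 1"
  shows "(s * x + t * y) powr p \<le> s * x powr p + t * y powr p"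
proof -
  have *: "(r * z) powr p \<le> r * z powr p" if "0 < r" "r \<le> 1" "0 \<le> z" for r z :: real
  proof -
    have "r powr p \<le> r powr 1"
      using that assms by (intro powr_mono') auto
    then show ?thesis
      using that by (simp add: powr_mult mult_right_mono)
  qed
  show ?thesis
  proof (cases "x = 0 \<or> y = 0")
    case True
    then show ?thesis
      using *[of s x] *[of t y] assms by auto
  next
    case False
    moreover have s: "s = 1 - t"
      using assms by simp
    ultimately show ?thesis
      using convex_onD[OF powr_convex[OF assms(1)], of t x y] assms(2-5) unfolding s by auto
  qed
qed

text \<open>
  Convexity of the \<open>p\<close>-th power with the weights \<open>A / (A + B)\<close> and \<open>B / (A + B)\<close>.  Integrated with \<open>A\<close>, \<open>B\<close> slightly larger
  than the norms of the two functions, it is the Minkowski inequality.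
\<close>
lemma powr_add_le:
  fixes a b A B p :: real
  assumes "1 \<le> p" "0 \<le> a" "0 \<le> b" "0 < A" "0 < B"
  shows "(a + b) powr p \<le> (A + B) powr p * (A / (A + B) * (a powr p / A powr p) + B / (A + B) * (b powr p / B powr p))"
proof -
  have "(a + b) powr p = ((A + B) * (A / (A + B) * (a / A) + B / (A + B) * (b / B))) powr p"
  proof -
    have "A * (a / A) = a" "B * (b / B) = b"
      using assms(4,5) by simp_all
    then have "A / (A + B) * (a / A) = a / (A + B)" "B / (A + B) * (b / B) = b / (A + B)"
      by (metis times_divide_eq_left)+
    moreover have "A + B \<noteq> 0"
      using assms(4,5) by linarith
    ultimately have "(A + B) * (A / (A + B) * (a / A) + B / (A + B) * (b / B)) = a + b"
      by (simp only: distrib_left) simp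
    then show ?thesis by simp
  qed
  also have "\<dots> = (A + B) powr p * (A / (A + B) * (a / A) + B / (A + B) * (b / B)) powr p"
    by (rule powr_mult)
  also have "\<dots> \<le> (A + B) powr p * (A / (A + B) * (a / A) powr p + B / (A + B) * (b / B) powr p)"
  proof (intro mult_left_mono powr_convex_combination)
    show "A / (A + B) + B / (A + B) = 1"
      using assms(4,5) by (simp flip: add_divide_distrib)
  qed (use assms in simp_all)
  also have "\<dots> = (A + B) powr p * (A / (A + B) * (a powr p / A powr p) + B / (A + B) * (b powr p / B powr p))"
    using assms by (simp add: powr_divide)
  finally show ?thesis .
qed

lemma Lp_norm_triangle:
  assumes p: "1 \<le> p"
  shows "Lp_norm p \<Omega> (u + v) \<le> Lp_norm p \<Omega> u + Lp_norm p \<Omega> v"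
proof (cases "Lp_norm p \<Omega> u = top \<or> Lp_norm p \<Omega> v = top")
  case False
  then obtain A B where A: "0 \<le> A" "Lp_norm p \<Omega> u = ennreal A" and B: "0 \<le> B" "Lp_norm p \<Omega> v = ennreal B"
    by (metis ennreal_cases)
  have [measurable]: "u \<in> borel_measurable (lebesgue_on \<Omega>)" "v \<in> borel_measurable (lebesgue_on \<Omega>)"
    using False by (auto intro!: Lp_norm_measurable[where p=p] simp: top.not_eq_extremum)
  have [measurable]: "(u + v) \<in> borel_measurable (lebesgue_on \<Omega>)"
    unfolding plus_fun_def by measurable
  have "Lp_norm p \<Omega> (u + v) \<le> ennreal (A + B) + ennreal e" if e: "0 < e" for e
  proof -
    define A' B' where "A' = A + e / 2" and "B' = B + e / 2"
    have pos: "0 < A'" "0 < B'"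
      using A B e by (auto simp: A'_def B'_def)
    have iA: "Lp_integral p \<Omega> u \<le> ennreal (A' powr p)"
      using Lp_norm_le_iff[of p A' \<Omega> u] A p pos e by (simp add: A'_def)
    have iB: "Lp_integral p \<Omega> v \<le> ennreal (B' powr p)"
      using Lp_norm_le_iff[of p B' \<Omega> v] B p pos e by (simp add: B'_def)
    define a b where "a = (A' + B') powr p * (A' / (A' + B')) / A' powr p"
      and "b = (A' + B') powr p * (B' / (A' + B')) / B' powr p"
    have ab: "0 \<le> a" "0 \<le> b"
      using pos by (auto simp: a_def b_def)
    have "(\<integral>\<^sup>+x. ennreal (cmod ((u + v) x) powr p) \<partial>lebesgue_on \<Omega>)
        \<le> (\<integral>\<^sup>+x. ennreal a * ennreal (cmod (u x) powr p) + ennreal b * ennreal (cmod (v x) powr p) \<partial>lebesgue_on \<Omega>)"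
    proof (rule nn_integral_mono)
      fix x
      have "cmod ((u + v) x) powr p \<le> (cmod (u x) + cmod (v x)) powr p"
        using p by (intro powr_mono2) (auto intro: norm_triangle_ineq)
      also have "\<dots> \<le> a * cmod (u x) powr p + b * cmod (v x) powr p"
        using powr_add_le[OF p norm_ge_zero norm_ge_zero pos, of "u x" "v x"]
        by (simp add: a_def b_def algebra_simps)
      finally show "ennreal (cmod ((u + v) x) powr p) \<le> ennreal a * ennreal (cmod (u x) powr p) + ennreal b * ennreal (cmod (v x) powr p)"
        using ab by (simp flip: ennreal_mult ennreal_plus)
    qed
    also have "\<dots> = ennreal a * Lp_integral p \<Omega> u + ennreal b * Lp_integral p \<Omega> v"
      by (simp add: nn_integral_add nn_integral_cmult)
    also have "\<dots> \<le> ennreal a * ennreal (A' powr p) + ennreal b * ennreal (B' powr p)"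
      by (intro add_mono mult_left_mono iA iB) auto
    also have "\<dots> = ennreal ((A' + B') powr p * (A' / (A' + B') + B' / (A' + B')))"
      using ab pos by (simp add: a_def b_def distrib_left flip: ennreal_mult ennreal_plus)
    also have "A' / (A' + B') + B' / (A' + B') = 1"
      using pos by (simp flip: add_divide_distrib)
    finally have "Lp_norm p \<Omega> (u + v) \<le> ennreal (A' + B')"
      using pos p by (subst Lp_norm_le_iff) simp_all
    also have "A' + B' = A + B + e"
      by (simp add: A'_def B'_def)
    also have "ennreal (A + B + e) = ennreal (A + B) + ennreal e"
      using A B e by (simp add: ennreal_plus)
    finally show ?thesis .
  qed
  then have "Lp_norm p \<Omega> (u + v) \<le> ennreal (A + B)"
    by (rule ennreal_le_epsilon)
  also have "\<dots> = Lp_norm p \<Omega> u + Lp_norm p \<Omega> v"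
    using A B by (simp add: ennreal_plus)
  finally show ?thesis .
qed auto

lemma epowr_mult:
  assumes "0 < k" "0 < p"
  shows "epowr (ennreal k * x) p = ennreal (k powr p) * epowr x p"
proof (cases x)
  case (real r)
  then have "ennreal k * x = ennreal (k * r)"
    using assms by (simp add: ennreal_mult)
  then have "epowr (ennreal k * x) p = ennreal ((k * r) powr p)"
    using assms real by (simp add: epowr_def del: ennreal_mult)
  also have "\<dots> = ennreal (k powr p) * epowr x p"
    using real by (simp add: epowr_def powr_mult ennreal_mult)
  finally show ?thesis .
qed (use assms in \<open>simp add: epowr_def ennreal_mult_top\<close>)

lemma Lp_norm_cmult:
  assumes p: "0 < p"
  shows "Lp_norm p \<Omega> (\<lambda>x. c * u x) = ennreal (cmod c) * Lp_norm p \<Omega> u"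
proof (cases "c = 0")
  case True
  then show ?thesis
    using p by (simp add: Lp_norm_def epowr_def)
next
  case False
  have meas: "(\<lambda>x. c * u x) \<in> borel_measurable (lebesgue_on \<Omega>) \<longleftrightarrow> u \<in> borel_measurable (lebesgue_on \<Omega>)"
  proof
    assume "(\<lambda>x. c * u x) \<in> borel_measurable (lebesgue_on \<Omega>)"
    then have "(\<lambda>x. inverse c * (c * u x)) \<in> borel_measurable (lebesgue_on \<Omega>)"
      by measurable
    with False show "u \<in> borel_measurable (lebesgue_on \<Omega>)"
      by (simp flip: mult.assoc)
  qed measurable
  show ?thesis
  proof (cases "u \<in> borel_measurable (lebesgue_on \<Omega>)")
    case True
    note [measurable] = this
    have "(\<integral>\<^sup>+x. ennreal (cmod (c * u x) powr p) \<partial>lebesgue_on \<Omega>) = ennreal (cmod c powr p) * Lp_integral p \<Omega> u"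
      by (simp add: norm_mult powr_mult ennreal_mult nn_integral_cmult)
    then show ?thesis
      using False p meas True epowr_mult[of "cmod c powr p" "1 / p"] by (simp add: Lp_norm_def powr_powr)
  next
    case False
    with \<open>c \<noteq> 0\<close> meas show ?thesis
      by (simp add: Lp_norm_def ennreal_mult_top)
  qed
qed

lemma ext_seminorm_Lp_norm:
  assumes "1 \<le> p"
  shows "ext_seminorm (Lp_norm p \<Omega>)"
proof
  show "Lp_norm p \<Omega> (u + v) \<le> Lp_norm p \<Omega> u + Lp_norm p \<Omega> v" for u v
    by (rule Lp_norm_triangle[OF assms])
  show "Lp_norm p \<Omega> (c *\<^sub>R u) = ennreal \<bar>c\<bar> * Lp_norm p \<Omega> u" for c u
    using Lp_norm_cmult[of p \<Omega> "complex_of_real c" u] assms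
    by (simp add: scaleR_fun_def scaleR_conv_of_real)
qed

text \<open>
  Riesz-Fischer.  A subsequence with \<open>\<parallel>d\<^sub>j\<parallel> \<le> 4\<^sup>-\<^sup>j\<close> for its increments \<open>d\<^sub>j\<close> satisfies \<open>\<Sum>\<^sub>j \<integral>(2\<^sup>j |d\<^sub>j|)\<^sup>p < \<infinity>\<close>.  Hence
  \<open>2\<^sup>j |d\<^sub>j|\<close> is bounded in \<open>j\<close> at almost every point, which gives pointwise convergence; the limit is identified by
  Fatou's lemma.
\<close>
lemma complete_norm_Lp_norm:
  assumes p: "1 \<le> p"
  shows "complete_norm (Lp_norm p \<Omega>)"
  unfolding complete_norm_def
proof (intro allI impI)
  interpret ext_seminorm "Lp_norm p \<Omega>" by (rule ext_seminorm_Lp_norm[OF p])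
  let ?N = "Lp_norm p \<Omega>"
  fix y :: "nat \<Rightarrow> 'a \<Rightarrow> complex"
  assume fin: "\<forall>n. ?N (y n) < \<infinity>" and cauchy: "\<forall>e>0. \<exists>K. \<forall>i\<ge>K. \<forall>j\<ge>K. ?N (y i - y j) < e"
  have [measurable]: "y n \<in> borel_measurable (lebesgue_on \<Omega>)" for n
    using fin by (intro Lp_norm_measurable[where p=p]) simp
  obtain K where K: "\<And>e i j. 0 < e \<Longrightarrow> K e \<le> i \<Longrightarrow> K e \<le> j \<Longrightarrow> ?N (y i - y j) < e"
    using cauchy by metis
  \<comment> \<open>A sum, so that \<open>k j\<close> is at least every threshold up to the \<open>j\<close>-th, and the added \<open>j\<close> makes it tend to infinity.\<close>
  define k where "k j = (\<Sum>i\<le>j. K (ennreal ((1/4) ^ i))) + j" for j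
  have kK: "K (ennreal ((1/4) ^ j)) \<le> k j" "K (ennreal ((1/4) ^ j)) \<le> k (Suc j)" for j
    by (auto simp: k_def intro: order_trans[OF member_le_sum[of j "{..j}"]])
  have k_le: "j \<le> k j" for j
    by (simp add: k_def)
  define d where "d j = (\<lambda>x. y (k (Suc j)) x - y (k j) x)" for j
  have [measurable]: "d j \<in> borel_measurable (lebesgue_on \<Omega>)" for j
    unfolding d_def by measurable
  have "?N (d j) \<le> ennreal ((1/4) ^ j)" for j
    using K[OF _ kK(2,1), of j] by (simp add: d_def fun_diff_def less_imp_le)
  then have d: "(\<integral>\<^sup>+x. ennreal (cmod (d j x) powr p) \<partial>lebesgue_on \<Omega>) \<le> ennreal (((1/4) ^ j) powr p)" for j
    using p by (subst (asm) Lp_norm_le_iff) auto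
  have "(\<integral>\<^sup>+x. (\<Sum>j. ennreal ((2 ^ j * cmod (d j x)) powr p)) \<partial>lebesgue_on \<Omega>)
      = (\<Sum>j. \<integral>\<^sup>+x. ennreal ((2 ^ j * cmod (d j x)) powr p) \<partial>lebesgue_on \<Omega>)"
    by (rule nn_integral_suminf) measurable
  also have "\<dots> \<le> (\<Sum>j. ennreal ((1/2) ^ j))"
  proof (rule suminf_le)
    fix j
    have "(\<integral>\<^sup>+x. ennreal ((2 ^ j * cmod (d j x)) powr p) \<partial>lebesgue_on \<Omega>)
        = ennreal ((2 ^ j) powr p) * (\<integral>\<^sup>+x. ennreal (cmod (d j x) powr p) \<partial>lebesgue_on \<Omega>)"
      by (simp add: powr_mult ennreal_mult nn_integral_cmult)
    also have "\<dots> \<le> ennreal ((2 ^ j) powr p) * ennreal (((1/4) ^ j) powr p)"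
      by (intro mult_left_mono d) auto
    also have "\<dots> = ennreal (((1/2) ^ j) powr p)"
      by (simp flip: ennreal_mult powr_mult power_mult_distrib)
    also have "\<dots> \<le> ennreal (((1/2) ^ j) powr 1)"
      using p by (intro ennreal_leI powr_mono') (auto simp: power_le_one)
    finally show "(\<integral>\<^sup>+x. ennreal ((2 ^ j * cmod (d j x)) powr p) \<partial>lebesgue_on \<Omega>) \<le> ennreal ((1/2) ^ j)"
      by simp
  qed auto
  also have "\<dots> = ennreal (\<Sum>j. (1/2) ^ j)"
    by (intro suminf_ennreal2) (auto intro: summable_geometric)
  finally have "(\<integral>\<^sup>+x. (\<Sum>j. ennreal ((2 ^ j * cmod (d j x)) powr p)) \<partial>lebesgue_on \<Omega>) \<noteq> \<infinity>"
    by (auto simp: top_unique)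
  then have "AE x in lebesgue_on \<Omega>. (\<Sum>j. ennreal ((2 ^ j * cmod (d j x)) powr p)) \<noteq> \<infinity>"
    by (intro nn_integral_noteq_infinite) measurable
  then have conv: "AE x in lebesgue_on \<Omega>. convergent (\<lambda>j. y (k j) x)"
  proof eventually_elim
    case (elim x)
    define G where "G = enn2real (\<Sum>j. ennreal ((2 ^ j * cmod (d j x)) powr p))"
    have G: "0 \<le> G" "(\<Sum>j. ennreal ((2 ^ j * cmod (d j x)) powr p)) = ennreal G"
      using elim unfolding G_def infinity_ennreal_def top.not_eq_extremum
      by (simp_all only: ennreal_enn2real enn2real_nonneg)
    have le: "cmod (d j x) \<le> G powr (1 / p) * (1/2) ^ j" for j
    proof -
      have "ennreal ((2 ^ j * cmod (d j x)) powr p) \<le> ennreal G"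
        using sum_le_suminf[of "\<lambda>j. ennreal ((2 ^ j * cmod (d j x)) powr p)" "{j}"] G by simp
      then have "((2 ^ j * cmod (d j x)) powr p) powr (1 / p) \<le> G powr (1 / p)"
        using G p by (intro powr_mono2) auto
      then show ?thesis
        using p by (simp add: powr_powr field_simps power_divide)
    qed
    have "summable (\<lambda>j. d j x)"
      by (rule summable_comparison_test'[OF _ le]) (intro summable_mult summable_geometric, simp)
    then have "convergent (\<lambda>n. \<Sum>j<n. d j x)"
      by (simp add: summable_iff_convergent)
    then have "convergent (\<lambda>n. (\<Sum>j<n. d j x) + y (k 0) x)"
      by (intro convergent_add convergent_const)
    moreover have "(\<Sum>j<n. d j x) + y (k 0) x = y (k n) x" for n
      using sum_lessThan_telescope[of "\<lambda>j. y (k j) x" n] by (simp add: d_def)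
    ultimately show ?case by simp
  qed
  define z where "z = (\<lambda>x. lim (\<lambda>j. y (k j) x))"
  have [measurable]: "z \<in> borel_measurable (lebesgue_on \<Omega>)"
    unfolding z_def by measurable
  have le: "?N (y i - z) \<le> ennreal e" if e: "0 < e" and i: "K (ennreal e) \<le> i" for e i
  proof -
    have "(\<integral>\<^sup>+x. ennreal (cmod ((y i - z) x) powr p) \<partial>lebesgue_on \<Omega>)
        = (\<integral>\<^sup>+x. liminf (\<lambda>j. ennreal (cmod (y i x - y (k j) x) powr p)) \<partial>lebesgue_on \<Omega>)"
    proof (intro nn_integral_cong_AE, use conv in eventually_elim)
      case (elim x)
      have "(\<lambda>j. ennreal (cmod (y i x - y (k j) x) powr p)) \<longlonglongrightarrow> ennreal (cmod (y i x - z x) powr p)"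
        using elim p unfolding z_def convergent_LIMSEQ_iff
        by (intro tendsto_ennrealI tendsto_powr' tendsto_norm tendsto_diff tendsto_const) auto
      from lim_imp_Liminf[OF _ this] show ?case
        by simp
    qed
    also have "\<dots> \<le> liminf (\<lambda>j. \<integral>\<^sup>+x. ennreal (cmod (y i x - y (k j) x) powr p) \<partial>lebesgue_on \<Omega>)"
      by (rule nn_integral_liminf) measurable
    also have "\<dots> \<le> ennreal (e powr p)"
    proof (rule Liminf_le)
      have "?N (y i - y (k j)) \<le> ennreal e" if "K (ennreal e) \<le> j" for j
        using K[OF _ i, of "k j"] e order_trans[OF that k_le] by (simp add: less_imp_le)
      then show "\<forall>\<^sub>F j in sequentially. (\<integral>\<^sup>+x. ennreal (cmod (y i x - y (k j) x) powr p) \<partial>lebesgue_on \<Omega>) \<le> ennreal (e powr p)"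
        using Lp_norm_le_iff[of p e \<Omega>] p e
        by (intro eventually_sequentiallyI[of "K (ennreal e)"]) (auto simp: fun_diff_def)
    qed simp
    finally show ?thesis
      using p e by (subst Lp_norm_le_iff) (auto simp: fun_diff_def)
  qed
  show "\<exists>x. ?N x < \<infinity> \<and> (\<lambda>n. ?N (y n - x)) \<longlonglongrightarrow> 0"
  proof (intro exI conjI)
    have "?N (y (K 1) - z) < top"
      using le[of 1 "K 1"] by (simp add: order_le_less_trans)
    then have "?N (y (K 1) - (y (K 1) - z)) < top"
      using fin by (intro diff_finite[of "y (K 1)" "y (K 1) - z"]) (simp_all only: infinity_ennreal_def)
    moreover have "y (K 1) - (y (K 1) - z) = z"
      by simp
    ultimately show "?N z < \<infinity>"
      by simp
    show "(\<lambda>n. ?N (y n - z)) \<longlonglongrightarrow> 0"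
    proof (rule order_tendstoI)
      fix a :: ennreal assume "0 < a"
      then obtain e where "0 < e" "ennreal e < a"
      proof (cases a)
        case (real r)
        with \<open>0 < a\<close> show thesis
          by (intro that[of "r / 2"]) (auto simp: ennreal_less_iff)
      qed (auto intro: that[of 1])
      then show "\<forall>\<^sub>F n in sequentially. ?N (y n - z) < a"
        using le by (intro eventually_sequentiallyI[of "K (ennreal e)"]) (meson le_less_trans)
    qed auto
  qed
qed

section \<open>Pairings of functions\<close>

text \<open>
  A bound on the unit ball gives a bound everywhere by scaling.  Dividing by a number slightly larger than the seminorm
  avoids a case distinction for elements of seminorm zero.
\<close>
lemma (in ext_seminorm) functional_bound:
  fixes \<Phi> :: "'v \<Rightarrow> real"
  assumes hom: "\<And>c x. 0 \<le> c \<Longrightarrow> \<Phi> (c *\<^sub>R x) = c * \<Phi> x" and unit: "\<And>x. N x \<le> 1 \<Longrightarrow> \<Phi> x \<le> C"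
    and C: "0 \<le> C" and x: "N x < top"
  shows "ennreal (\<Phi> x) \<le> ennreal C * N x"
proof -
  obtain A where A: "0 \<le> A" "N x = ennreal A"
    using x by (cases "N x") auto
  have "\<Phi> x \<le> C * A + e" if e: "0 < e" for e
  proof -
    \<comment> \<open>Dividing by \<open>C + 1\<close> instead of \<open>C\<close> keeps \<open>d\<close> positive for \<open>C = 0\<close>.\<close>
    define d where "d = e / (C + 1)"
    have d: "0 < d" "C * d \<le> e"
      using e C by (auto simp: d_def field_simps)
    have "N ((1 / (A + d)) *\<^sub>R x) \<le> 1"
      using A d by (simp add: scaleR field_simps flip: ennreal_mult)
    then have "1 / (A + d) * \<Phi> x \<le> C"
      using unit[of "(1 / (A + d)) *\<^sub>R x"] hom[of "1 / (A + d)" x] A d by simp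
    then have "\<Phi> x \<le> C * (A + d)"
      using A d by (simp add: field_simps)
    then show ?thesis
      using d by (simp add: distrib_left)
  qed
  then have "\<Phi> x \<le> C * A"
    by (rule field_le_epsilon)
  then show ?thesis
    using A C by (simp add: ennreal_leI flip: ennreal_mult)
qed

lemma fun_distr_scaleR: "fun_distr \<Omega> (c *\<^sub>R u) \<phi> = c * fun_distr \<Omega> u \<phi>"
  by (simp add: fun_distr_def scaleR_fun_def)

lemma fun_distr_scaleR_right: "fun_distr \<Omega> u (c *\<^sub>R \<phi>) = c * fun_distr \<Omega> u \<phi>"
  by (simp add: fun_distr_def scaleR_fun_def)

lemma distr_cmul_fun_distr: "distr_cmul c (fun_distr \<Omega> u) = fun_distr \<Omega> (\<lambda>x. c * u x)"
  by (simp add: distr_cmul_def fun_distr_def fun_eq_iff mult_ac)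

lemma fun_distr_zero [simp]: "fun_distr \<Omega> 0 = 0"
  by (simp add: fun_distr_def fun_eq_iff)

lemma borel_measurable_cnj [measurable]: "cnj \<in> borel_measurable borel"
  by (intro borel_measurable_continuous_onI continuous_intros)

text \<open>
  The bound \<open>B\<close> and the set \<open>K\<close> are explicit because the slices \<open>\<Phi>(t, \<cdot>)\<close> of a space-time test function share
  them, which makes estimates uniform in \<open>t\<close>.
\<close>
definition bounded_supported :: "'a::euclidean_space set \<Rightarrow> real \<Rightarrow> 'a set \<Rightarrow> ('a \<Rightarrow> complex) \<Rightarrow> bool"
  where "bounded_supported \<Omega> B K \<phi> \<longleftrightarrow> \<phi> \<in> borel_measurable (lebesgue_on \<Omega>) \<and> 0 \<le> B \<and> compact K \<and>
    (\<forall>x. cmod (\<phi> x) \<le> B) \<and> (\<forall>x. \<phi> x \<noteq> 0 \<longrightarrow> x \<in> K)"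

text \<open>
  The elementary inequality \<open>|u| \<le> 1 + |u|\<^sup>p\<close> on \<open>K\<close> replaces the Hoelder inequality; after scaling it gives
  \<open>fun_distr_bound\<close> with a constant that depends on the test function only.
\<close>
lemma nn_integral_pairing_le:
  assumes \<Omega>: "\<Omega> \<in> sets lebesgue" and p: "1 \<le> p" and \<phi>: "bounded_supported \<Omega> B K \<phi>"
    and u: "u \<in> borel_measurable (lebesgue_on \<Omega>)"
  shows "(\<integral>\<^sup>+x. ennreal (cmod (u x * cnj (\<phi> x))) \<partial>lebesgue_on \<Omega>)
    \<le> ennreal B * (ennreal (measure lebesgue K) + Lp_integral p \<Omega> u)"
proof -
  note u[measurable]
  have B: "0 \<le> B" and K: "compact K"
    using \<phi> by (auto simp: bounded_supported_def)
  have K': "K \<in> sets lebesgue" "K \<inter> \<Omega> \<in> sets (lebesgue_on \<Omega>)"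
    using fmeasurableD[OF lmeasurable_compact[OF K]] by (auto simp only: sets_restrict_space Int_commute[of K])
  have "(\<integral>\<^sup>+x. ennreal (cmod (u x * cnj (\<phi> x))) \<partial>lebesgue_on \<Omega>)
      \<le> (\<integral>\<^sup>+x. ennreal B * (indicator (K \<inter> \<Omega>) x + ennreal (cmod (u x) powr p)) \<partial>lebesgue_on \<Omega>)"
  proof (rule nn_integral_mono)
    fix x assume x: "x \<in> space (lebesgue_on \<Omega>)"
    have "cmod (u x) \<le> 1 + cmod (u x) powr p"
    proof (cases "cmod (u x) \<le> 1")
      case False
      then have "cmod (u x) powr 1 \<le> cmod (u x) powr p"
        using p by (intro powr_mono) auto
      with False show ?thesis by auto
    qed (use powr_ge_zero[of "cmod (u x)" p] in linarith)
    then have "cmod (u x * cnj (\<phi> x)) \<le> B * (1 + cmod (u x) powr p)"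
      using \<phi> by (simp add: norm_mult bounded_supported_def mult.commute mult_mono)
    then have "ennreal (cmod (u x * cnj (\<phi> x))) \<le> ennreal B * (1 + ennreal (cmod (u x) powr p))"
      using B by (simp add: ennreal_mult[symmetric] ennreal_plus[symmetric] ennreal_1[symmetric] ennreal_leI del: ennreal_1 ennreal_plus)
    moreover have "x \<in> K \<inter> \<Omega> \<or> \<phi> x = 0"
      using \<phi> x by (auto simp: bounded_supported_def)
    ultimately show "ennreal (cmod (u x * cnj (\<phi> x))) \<le> ennreal B * (indicator (K \<inter> \<Omega>) x + ennreal (cmod (u x) powr p))"
      by (auto simp: indicator_def)
  qed
  also have "\<dots> = ennreal B * (emeasure (lebesgue_on \<Omega>) (K \<inter> \<Omega>) + Lp_integral p \<Omega> u)"
    using K' by (simp add: nn_integral_cmult nn_integral_add)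
  also have "emeasure (lebesgue_on \<Omega>) (K \<inter> \<Omega>) \<le> ennreal (measure lebesgue K)"
  proof -
    have "emeasure (lebesgue_on \<Omega>) (K \<inter> \<Omega>) = emeasure lebesgue (K \<inter> \<Omega>)"
      using \<Omega> by (intro emeasure_restrict_space) auto
    also have "\<dots> \<le> emeasure lebesgue K"
      using K' by (intro emeasure_mono) auto
    also have "\<dots> = ennreal (measure lebesgue K)"
      by (rule emeasure_eq_measure2[OF lmeasurable_compact[OF K]])
    finally show ?thesis .
  qed
  finally show ?thesis
    by (meson add_right_mono mult_left_mono zero_le order_trans)
qed

lemma integrable_pairing:
  assumes \<Omega>: "\<Omega> \<in> sets lebesgue" and p: "1 \<le> p" and \<phi>: "bounded_supported \<Omega> B K \<phi>"
    and u: "Lp_norm p \<Omega> u < top"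
  shows "integrable (lebesgue_on \<Omega>) (\<lambda>x. u x * cnj (\<phi> x))"
proof (rule integrableI_bounded)
  have [measurable]: "u \<in> borel_measurable (lebesgue_on \<Omega>)" "\<phi> \<in> borel_measurable (lebesgue_on \<Omega>)"
    using u \<phi> by (auto simp: bounded_supported_def Lp_norm_finite_iff)
  show "(\<lambda>x. u x * cnj (\<phi> x)) \<in> borel_measurable (lebesgue_on \<Omega>)"
    by measurable
  have "ennreal B * (ennreal (measure lebesgue K) + Lp_integral p \<Omega> u) < top"
    using u by (simp add: Lp_norm_finite_iff ennreal_mult_less_top)
  then show "(\<integral>\<^sup>+x. ennreal (cmod (u x * cnj (\<phi> x))) \<partial>lebesgue_on \<Omega>) < \<infinity>"
    unfolding infinity_ennreal_def by (rule le_less_trans[OF nn_integral_pairing_le[OF \<Omega> p \<phi>], rotated]) measurable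
qed

lemma fun_distr_bound:
  assumes \<Omega>: "\<Omega> \<in> sets lebesgue" and p: "1 \<le> p" and \<phi>: "bounded_supported \<Omega> B K \<phi>"
    and u: "Lp_norm p \<Omega> u < top"
  shows "ennreal \<bar>fun_distr \<Omega> u \<phi>\<bar> \<le> ennreal (B * (measure lebesgue K + 1)) * Lp_norm p \<Omega> u"
proof (rule ext_seminorm.functional_bound[where N="Lp_norm p \<Omega>"])
  show "ext_seminorm (Lp_norm p \<Omega>)" "Lp_norm p \<Omega> u < top"
    by (intro ext_seminorm_Lp_norm p u)+
  have B: "0 \<le> B"
    using \<phi> by (auto simp: bounded_supported_def)
  show "\<bar>fun_distr \<Omega> (c *\<^sub>R x) \<phi>\<bar> = c * \<bar>fun_distr \<Omega> x \<phi>\<bar>" if "0 \<le> c" for c x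
    using that by (simp add: fun_distr_scaleR abs_mult)
  show "0 \<le> B * (measure lebesgue K + 1)"
    using B by simp
  fix v assume v: "Lp_norm p \<Omega> v \<le> 1"
  then have "Lp_norm p \<Omega> v \<le> ennreal 1"
    by simp
  then have v1: "Lp_integral p \<Omega> v \<le> 1" and v2: "v \<in> borel_measurable (lebesgue_on \<Omega>)"
    using Lp_norm_le_iff[of p 1 \<Omega> v] p by simp_all
  have "ennreal \<bar>fun_distr \<Omega> v \<phi>\<bar> \<le> ennreal (norm (\<integral>x. v x * cnj (\<phi> x) \<partial>lebesgue_on \<Omega>))"
    unfolding fun_distr_def by (intro ennreal_leI abs_Re_le_cmod)
  also have "\<dots> \<le> (\<integral>\<^sup>+x. ennreal (cmod (v x * cnj (\<phi> x))) \<partial>lebesgue_on \<Omega>)"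
    using v by (intro integral_norm_bound_ennreal integrable_pairing[OF \<Omega> p \<phi>]) (simp add: order_le_less_trans)
  also have "\<dots> \<le> ennreal B * (ennreal (measure lebesgue K) + 1)"
    by (rule order_trans[OF nn_integral_pairing_le[OF \<Omega> p \<phi> v2]]) (intro mult_left_mono add_left_mono v1 zero_le)
  also have "\<dots> = ennreal (B * (measure lebesgue K + 1))"
    using B by (simp add: ennreal_mult ennreal_plus)
  finally show "\<bar>fun_distr \<Omega> v \<phi>\<bar> \<le> B * (measure lebesgue K + 1)"
    using B by (simp add: ennreal_le_iff)
qed

lemma fun_distr_add:
  assumes "\<Omega> \<in> sets lebesgue" "1 \<le> p" "1 \<le> q" "bounded_supported \<Omega> B K \<phi>"
    and "Lp_norm p \<Omega> u < top" "Lp_norm q \<Omega> v < top"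
  shows "fun_distr \<Omega> (u + v) \<phi> = fun_distr \<Omega> u \<phi> + fun_distr \<Omega> v \<phi>"
  using Bochner_Integration.integral_add[OF integrable_pairing[OF assms(1,2,4,5)] integrable_pairing[OF assms(1,3,4,6)]]
  by (simp add: fun_distr_def distrib_right)

lemma bounded_map_fun_distr_apply:
  assumes "\<Omega> \<in> sets lebesgue" "1 \<le> p" "bounded_supported \<Omega> B K \<phi>"
  shows "bounded_map (Lp_norm p \<Omega>) (\<lambda>r::real. ennreal \<bar>r\<bar>) (B * (measure lebesgue K + 1)) (\<lambda>u. fun_distr \<Omega> u \<phi>)"
proof (intro bounded_map.intro bounded_map_axioms.intro ext_seminorm_Lp_norm ext_seminorm_abs)
  show "bounded_linear_upto (Lp_norm p \<Omega>) (\<lambda>r. ennreal \<bar>r\<bar>) (B * (measure lebesgue K + 1)) (\<lambda>u. fun_distr \<Omega> u \<phi>)"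
    unfolding bounded_linear_upto_def
    using fun_distr_add[OF assms(1,2,2,3)] fun_distr_bound[OF assms] by (simp add: fun_distr_scaleR)
qed fact

lemma L2_pairing_integrable:
  assumes "Lp_norm 2 \<Omega> u < top" "Lp_norm 2 \<Omega> v < top"
  shows "integrable (lebesgue_on \<Omega>) (\<lambda>x. u x * cnj (v x))"
proof (rule integrableI_bounded)
  have [measurable]: "u \<in> borel_measurable (lebesgue_on \<Omega>)" "v \<in> borel_measurable (lebesgue_on \<Omega>)"
    using assms by (auto simp: Lp_norm_finite_iff)
  show "(\<lambda>x. u x * cnj (v x)) \<in> borel_measurable (lebesgue_on \<Omega>)"
    by measurable
  have "(\<integral>\<^sup>+x. ennreal (cmod (u x * cnj (v x))) \<partial>lebesgue_on \<Omega>) \<le> (\<integral>\<^sup>+x. ennreal (cmod (u x) powr 2) + ennreal (cmod (v x) powr 2) \<partial>lebesgue_on \<Omega>)"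
  proof (rule nn_integral_mono)
    fix x
    have "2 * (cmod (u x) * cmod (v x)) \<le> cmod (u x) ^ 2 + cmod (v x) ^ 2"
      using sum_squares_bound[of "cmod (u x)" "cmod (v x)"] by simp
    moreover have "0 \<le> cmod (u x) * cmod (v x)"
      by simp
    ultimately have "cmod (u x) * cmod (v x) \<le> cmod (u x) ^ 2 + cmod (v x) ^ 2"
      by linarith
    then show "ennreal (cmod (u x * cnj (v x))) \<le> ennreal (cmod (u x) powr 2) + ennreal (cmod (v x) powr 2)"
      by (simp add: norm_mult ennreal_leI flip: ennreal_plus)
  qed
  also have "\<dots> < \<infinity>"
    using assms by (simp add: nn_integral_add Lp_norm_finite_iff)
  finally show "(\<integral>\<^sup>+x. ennreal (cmod (u x * cnj (v x))) \<partial>lebesgue_on \<Omega>) < \<infinity>" .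
qed

lemma Cauchy_Schwarz_fun_distr:
  assumes u: "Lp_norm 2 \<Omega> u < top" and v: "Lp_norm 2 \<Omega> v < top"
  shows "ennreal \<bar>fun_distr \<Omega> u v\<bar> \<le> Lp_norm 2 \<Omega> u * Lp_norm 2 \<Omega> v"
proof -
  interpret ext_seminorm "Lp_norm 2 \<Omega>" by (rule ext_seminorm_Lp_norm) simp
  have unit: "\<bar>fun_distr \<Omega> u v\<bar> \<le> 1" if u: "Lp_norm 2 \<Omega> u \<le> 1" and v: "Lp_norm 2 \<Omega> v \<le> 1" for u v
  proof -
    have u': "Lp_integral 2 \<Omega> u \<le> 1" and [measurable]: "u \<in> borel_measurable (lebesgue_on \<Omega>)"
      using Lp_norm_le_iff[of 2 1 \<Omega> u] u by simp_all
    have v': "Lp_integral 2 \<Omega> v \<le> 1" and [measurable]: "v \<in> borel_measurable (lebesgue_on \<Omega>)"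
      using Lp_norm_le_iff[of 2 1 \<Omega> v] v by simp_all
    have "ennreal \<bar>fun_distr \<Omega> u v\<bar> \<le> ennreal (norm (\<integral>x. u x * cnj (v x) \<partial>lebesgue_on \<Omega>))"
      unfolding fun_distr_def by (intro ennreal_leI abs_Re_le_cmod)
    also have "\<dots> \<le> (\<integral>\<^sup>+x. ennreal (cmod (u x * cnj (v x))) \<partial>lebesgue_on \<Omega>)"
      using u v by (intro integral_norm_bound_ennreal L2_pairing_integrable) (simp_all add: order_le_less_trans)
    also have "\<dots> \<le> (\<integral>\<^sup>+x. ennreal (1/2) * ennreal (cmod (u x) powr 2) + ennreal (1/2) * ennreal (cmod (v x) powr 2) \<partial>lebesgue_on \<Omega>)"
    proof (rule nn_integral_mono)
      fix x
      have "2 * (cmod (u x) * cmod (v x)) \<le> cmod (u x) ^ 2 + cmod (v x) ^ 2"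
        using sum_squares_bound[of "cmod (u x)" "cmod (v x)"] by simp
      then have "cmod (u x * cnj (v x)) \<le> 1/2 * cmod (u x) powr 2 + 1/2 * cmod (v x) powr 2"
        by (simp add: norm_mult)
      then have "ennreal (cmod (u x * cnj (v x))) \<le> ennreal (1/2 * cmod (u x) powr 2 + 1/2 * cmod (v x) powr 2)"
        by (rule ennreal_leI)
      also have "\<dots> = ennreal (1/2) * ennreal (cmod (u x) powr 2) + ennreal (1/2) * ennreal (cmod (v x) powr 2)"
        by (subst ennreal_plus) (simp_all only: ennreal_mult' zero_le_mult_iff powr_ge_zero, auto)
      finally show "ennreal (cmod (u x * cnj (v x))) \<le> ennreal (1/2) * ennreal (cmod (u x) powr 2) + ennreal (1/2) * ennreal (cmod (v x) powr 2)" .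
    qed
    also have "\<dots> = ennreal (1/2) * Lp_integral 2 \<Omega> u + ennreal (1/2) * Lp_integral 2 \<Omega> v"
      by (simp add: nn_integral_add nn_integral_cmult)
    also have "\<dots> \<le> ennreal (1/2) * 1 + ennreal (1/2) * 1"
      by (intro add_mono mult_left_mono u' v' zero_le)
    also have "\<dots> = ennreal (1/2 + 1/2)"
      unfolding mult_1_right by (rule ennreal_plus[symmetric]) simp_all
    also have "\<dots> = ennreal 1"
      by simp
    finally show ?thesis
      by (subst (asm) ennreal_le_iff) simp_all
  qed
  have half: "ennreal \<bar>fun_distr \<Omega> u v\<bar> \<le> ennreal 1 * Lp_norm 2 \<Omega> u"
    if "Lp_norm 2 \<Omega> u < top" "Lp_norm 2 \<Omega> v \<le> 1" for u v
    by (rule functional_bound) (use that unit in \<open>auto simp: fun_distr_scaleR abs_mult\<close>)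
  obtain A where A: "0 \<le> A" "Lp_norm 2 \<Omega> u = ennreal A"
    using u by (cases "Lp_norm 2 \<Omega> u") auto
  have "ennreal \<bar>fun_distr \<Omega> u v\<bar> \<le> ennreal A * Lp_norm 2 \<Omega> v"
  proof (rule functional_bound[OF _ _ A(1) v])
    show "\<bar>fun_distr \<Omega> u (c *\<^sub>R x)\<bar> = c * \<bar>fun_distr \<Omega> u x\<bar>" if "0 \<le> c" for c x
      using that by (simp add: fun_distr_scaleR_right abs_mult)
    show "\<bar>fun_distr \<Omega> u x\<bar> \<le> A" if "Lp_norm 2 \<Omega> x \<le> 1" for x
      using half[OF u that] A by (simp add: ennreal_le_iff)
  qed
  then show ?thesis
    using A by simp
qed

section \<open>The power nonlinearity\<close>

text \<open>
  Let \<open>|w| \<le> |z|\<close> and \<open>d = |z - w|\<close>.  If \<open>|z| \<le> d\<close>, both values are at most \<open>d\<^sup>m\<close>.  Otherwise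
  \<open>r = |z|\<^sup>m\<^sup>-\<^sup>1\<close> satisfies \<open>r d \<le> d\<^sup>m\<close>, and replacing the factor \<open>|w|\<^sup>m\<^sup>-\<^sup>1\<close> in \<open>g(w)\<close> by \<open>r\<close> costs at most
  \<open>|w|\<^sup>m - r |w| \<le> |z|\<^sup>m - r |w| = r (|z| - |w|) \<le> r d\<close>.
\<close>
lemma power_nonlinearity_hoelder:
  assumes m: "0 < m" "m \<le> 1"
  shows "cmod (power_nonlinearity m z - power_nonlinearity m w) \<le> 2 * cmod (z - w) powr m"
proof -
  have norm: "cmod (power_nonlinearity m z) = cmod z powr m" for z
    using powr_mult_base[of "cmod z" "m - 1"] by (simp add: power_nonlinearity_def norm_mult mult.commute)
  have main: "cmod (power_nonlinearity m z - power_nonlinearity m w) \<le> 2 * cmod (z - w) powr m"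
    if le: "cmod w \<le> cmod z" for z w
  proof (cases "cmod z \<le> cmod (z - w)")
    case True
    have "cmod (power_nonlinearity m z - power_nonlinearity m w) \<le> cmod z powr m + cmod w powr m"
      using norm_triangle_ineq4[of "power_nonlinearity m z" "power_nonlinearity m w"] by (simp add: norm)
    also have "\<dots> \<le> cmod (z - w) powr m + cmod (z - w) powr m"
      using True le m by (intro add_mono powr_mono2) auto
    finally show ?thesis by simp
  next
    case False
    define r where "r = cmod z powr (m - 1)"
    define d where "d = cmod (z - w)"
    have z: "z \<noteq> 0" and r: "0 \<le> r"
      using False by (auto simp: r_def)
    have pz: "power_nonlinearity m z = of_real r * z"
      using z by (simp add: power_nonlinearity_def r_def)
    have rd: "r * d \<le> d powr m"
    proof (cases "d = 0")
      case False
      then have "r \<le> d powr (m - 1)"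
        unfolding r_def using \<open>\<not> cmod z \<le> cmod (z - w)\<close> m by (intro powr_mono2') (auto simp: d_def)
      then have "r * d \<le> d powr (m - 1) * d"
        by (rule mult_right_mono) (simp add: d_def)
      also have "\<dots> = d powr m"
        using powr_mult_base[of d "m - 1"] by (simp add: d_def mult.commute)
      finally show ?thesis .
    qed simp
    have "of_real r * z - power_nonlinearity m w = of_real r * (z - w) + (of_real r * w - power_nonlinearity m w)"
      by (simp add: algebra_simps)
    then have "cmod (power_nonlinearity m z - power_nonlinearity m w) \<le> r * d + cmod (of_real r * w - power_nonlinearity m w)"
      using norm_triangle_ineq[of "of_real r * (z - w)" "of_real r * w - power_nonlinearity m w"] r
      by (simp add: pz norm_mult d_def add_diff_eq)
    also have "cmod (of_real r * w - power_nonlinearity m w) \<le> r * d"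
    proof (cases "w = 0")
      case False
      define q where "q = cmod w powr (m - 1)"
      have rq: "r \<le> q"
        unfolding r_def q_def using le False m by (intro powr_mono2') auto
      have "of_real r * w - power_nonlinearity m w = of_real (r - q) * w"
        using False by (simp add: power_nonlinearity_def q_def algebra_simps)
      then have "cmod (of_real r * w - power_nonlinearity m w) = (q - r) * cmod w"
        using rq by (simp add: norm_mult flip: of_real_diff)
      also have "\<dots> = cmod w powr m - r * cmod w"
        using powr_mult_base[of "cmod w" "m - 1"] by (simp add: q_def algebra_simps)
      also have "\<dots> \<le> cmod z powr m - r * cmod w"
        using le m by (intro diff_right_mono powr_mono2) auto
      also have "\<dots> = r * (cmod z - cmod w)"
        using powr_mult_base[of "cmod z" "m - 1"] by (simp add: r_def algebra_simps)
      also have "\<dots> \<le> r * d"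
        unfolding d_def using r norm_triangle_ineq2[of z w] by (intro mult_left_mono)
      finally show ?thesis .
    qed (use r in \<open>simp add: power_nonlinearity_def d_def\<close>)
    finally show ?thesis
      using rd by (simp add: d_def)
  qed
  show ?thesis
    using main[of w z] main[of z w] by (cases "cmod w \<le> cmod z") (auto simp: norm_minus_commute)
qed

lemma continuous_power_nonlinearity:
  assumes m: "0 < m" "m \<le> 1"
  shows "continuous_on UNIV (power_nonlinearity m)"
  unfolding continuous_on_def
proof
  fix z :: complex
  have "((\<lambda>w. 2 * cmod (w - z) powr m) \<longlongrightarrow> 2 * cmod (z - z) powr m) (at z)"
    using m by (intro tendsto_mult tendsto_const tendsto_powr' tendsto_norm tendsto_diff tendsto_ident_at) auto
  then have "((\<lambda>w. 2 * cmod (w - z) powr m) \<longlongrightarrow> 0) (at z)"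
    by simp
  then have "((\<lambda>w. power_nonlinearity m w - power_nonlinearity m z) \<longlongrightarrow> 0) (at z)"
    by (rule Lim_null_comparison[OF always_eventually[OF allI[OF power_nonlinearity_hoelder[OF m]]]])
  then show "(power_nonlinearity m \<longlongrightarrow> power_nonlinearity m z) (at z)"
    by (simp add: LIM_zero_iff)
qed

lemma measurable_power_nonlinearity:
  assumes "0 < m" "m \<le> 1" "u \<in> borel_measurable M"
  shows "(\<lambda>x. power_nonlinearity m (u x)) \<in> borel_measurable M"
  using borel_measurable_continuous_on[OF continuous_power_nonlinearity[OF assms(1,2)] assms(3)] .

lemma Lp_norm_power_nonlinearity_diff:
  assumes m: "0 < m" "m \<le> 1"
    and u: "u \<in> borel_measurable (lebesgue_on \<Omega>)" and v: "v \<in> borel_measurable (lebesgue_on \<Omega>)"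
    and A: "0 \<le> A" "Lp_norm 2 \<Omega> (u - v) \<le> ennreal A"
  shows "Lp_norm (2 / m) \<Omega> ((\<lambda>x. power_nonlinearity m (u x)) - (\<lambda>x. power_nonlinearity m (v x))) \<le> ennreal (2 * A powr m)"
proof (subst Lp_norm_le_iff)
  note [measurable] = u v measurable_power_nonlinearity[OF m]
  have "(\<integral>\<^sup>+x. ennreal (cmod (power_nonlinearity m (u x) - power_nonlinearity m (v x)) powr (2 / m)) \<partial>lebesgue_on \<Omega>)
      \<le> (\<integral>\<^sup>+x. ennreal (2 powr (2 / m)) * ennreal (cmod (u x - v x) powr 2) \<partial>lebesgue_on \<Omega>)"
  proof (rule nn_integral_mono)
    fix x
    have "cmod (power_nonlinearity m (u x) - power_nonlinearity m (v x)) powr (2 / m) \<le> (2 * cmod (u x - v x) powr m) powr (2 / m)"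
      using m by (intro powr_mono2 power_nonlinearity_hoelder) auto
    also have "\<dots> = 2 powr (2 / m) * cmod (u x - v x) powr 2"
      using m by (simp add: powr_mult powr_powr)
    finally show "ennreal (cmod (power_nonlinearity m (u x) - power_nonlinearity m (v x)) powr (2 / m)) \<le> ennreal (2 powr (2 / m)) * ennreal (cmod (u x - v x) powr 2)"
      by (subst ennreal_mult[symmetric]) (auto intro: ennreal_leI)
  qed
  also have "\<dots> = ennreal (2 powr (2 / m)) * (\<integral>\<^sup>+x. ennreal (cmod (u x - v x) powr 2) \<partial>lebesgue_on \<Omega>)"
    by (intro nn_integral_cmult) measurable
  also have "\<dots> \<le> ennreal (2 powr (2 / m)) * ennreal (A powr 2)"
    using A Lp_norm_le_iff[of 2 A \<Omega> "u - v"] by (intro mult_left_mono) (auto simp: fun_diff_def)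
  also have "\<dots> = ennreal ((2 * A powr m) powr (2 / m))"
    using m by (simp add: powr_mult powr_powr ennreal_mult)
  finally show "(\<lambda>x. power_nonlinearity m (u x)) - (\<lambda>x. power_nonlinearity m (v x)) \<in> borel_measurable (lebesgue_on \<Omega>) \<and>
      (\<integral>\<^sup>+x. ennreal (cmod (((\<lambda>x. power_nonlinearity m (u x)) - (\<lambda>x. power_nonlinearity m (v x))) x) powr (2 / m)) \<partial>lebesgue_on \<Omega>) \<le> ennreal ((2 * A powr m) powr (2 / m))"
    unfolding fun_diff_def by (intro conjI) measurable
qed (use m A in auto)

section \<open>Test functions\<close>

lemma has_derivative_frechet:
  "f differentiable (at x) \<Longrightarrow> (f has_derivative frechet_derivative f (at x)) (at x)"
  using frechet_derivative_works by blast

lemma dir_deriv_eqI: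
  assumes "\<And>x. (f has_derivative f' x) (at x)"
  shows "dir_deriv b f = (\<lambda>x. f' x b)"
  using frechet_derivative_at[OF assms] by (auto simp: dir_deriv_def fun_eq_iff)

lemma smooth_differentiable: "smooth \<phi> \<Longrightarrow> \<phi> differentiable (at x)"
  unfolding smooth_def differentiable_on_def by (metis empty_set empty_subsetI foldr_Nil id_apply UNIV_I)

lemma smooth_has_derivative: "smooth \<phi> \<Longrightarrow> (\<phi> has_derivative frechet_derivative \<phi> (at x)) (at x)"
  by (intro has_derivative_frechet smooth_differentiable)

lemma smooth_dir_deriv:
  assumes "smooth \<phi>" "b \<in> Basis"
  shows "smooth (dir_deriv b \<phi>)"
  unfolding smooth_def
proof (intro allI impI)
  fix bs :: "'a list" assume "set bs \<subseteq> Basis"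
  then have "foldr dir_deriv (bs @ [b]) \<phi> differentiable_on UNIV"
    using assms unfolding smooth_def by (intro assms(1)[unfolded smooth_def, rule_format]) auto
  then show "foldr dir_deriv bs (dir_deriv b \<phi>) differentiable_on UNIV"
    by simp
qed

lemma smooth_continuous_on: "smooth \<phi> \<Longrightarrow> continuous_on S \<phi>"
  by (meson continuous_at_imp_continuous_on differentiable_imp_continuous_within smooth_differentiable)

text \<open>
  Smoothness is the largest property that implies differentiability and is inherited by partial derivatives.
\<close>
lemma smooth_coinduct:
  fixes \<phi> :: "'a::euclidean_space \<Rightarrow> 'b::real_normed_vector"
  assumes "P \<phi>" and diff: "\<And>\<phi>. P \<phi> \<Longrightarrow> \<phi> differentiable_on UNIV"
    and step: "\<And>\<phi> b. P \<phi> \<Longrightarrow> b \<in> Basis \<Longrightarrow> P (dir_deriv b \<phi>)"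
  shows "smooth \<phi>"
  unfolding smooth_def
proof (intro allI impI)
  fix bs :: "'a list" assume "set bs \<subseteq> Basis"
  then have "P (foldr dir_deriv bs \<phi>)"
    by (induction bs) (auto intro: assms(1) step)
  then show "foldr dir_deriv bs \<phi> differentiable_on UNIV"
    by (rule diff)
qed

lemma dir_deriv_bounded_linear:
  assumes "bounded_linear f" "smooth \<phi>"
  shows "dir_deriv b (\<lambda>x. f (\<phi> x)) = (\<lambda>x. f (dir_deriv b \<phi> x))"
  unfolding dir_deriv_eqI[OF bounded_linear.has_derivative[OF assms(1) smooth_has_derivative[OF assms(2)]]]
  by (simp add: dir_deriv_def)

lemma smooth_bounded_linear:
  assumes f: "bounded_linear f" and "smooth \<phi>"
  shows "smooth (\<lambda>x. f (\<phi> x))"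
proof (rule smooth_coinduct[where P="\<lambda>h. \<exists>\<phi>. smooth \<phi> \<and> h = (\<lambda>x. f (\<phi> x))"])
  show "\<exists>\<phi>'. smooth \<phi>' \<and> (\<lambda>x. f (\<phi> x)) = (\<lambda>x. f (\<phi>' x))"
    using assms(2) by blast
next
  fix h assume "\<exists>\<phi>. smooth \<phi> \<and> h = (\<lambda>x. f (\<phi> x))"
  then obtain \<phi> where \<phi>: "smooth \<phi>" "h = (\<lambda>x. f (\<phi> x))"
    by blast
  show "h differentiable_on UNIV"
    using bounded_linear.has_derivative[OF f smooth_has_derivative[OF \<phi>(1)]]
    by (auto simp: \<phi>(2) differentiable_on_def differentiable_def)
  show "\<exists>\<phi>. smooth \<phi> \<and> dir_deriv b h = (\<lambda>x. f (\<phi> x))" if "b \<in> Basis" for b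
    using \<phi> smooth_dir_deriv[OF \<phi>(1) that] dir_deriv_bounded_linear[OF f \<phi>(1)] by auto
qed

lemma dir_deriv_add:
  assumes "smooth \<phi>" "smooth \<psi>"
  shows "dir_deriv b (\<phi> + \<psi>) = dir_deriv b \<phi> + dir_deriv b \<psi>"
  unfolding plus_fun_def dir_deriv_eqI[OF has_derivative_add[OF smooth_has_derivative[OF assms(1)] smooth_has_derivative[OF assms(2)]]]
  by (simp add: dir_deriv_def)

lemma smooth_add:
  assumes "smooth \<phi>" "smooth \<psi>"
  shows "smooth (\<phi> + \<psi>)"
proof (rule smooth_coinduct[where P="\<lambda>h. \<exists>\<phi> \<psi>. smooth \<phi> \<and> smooth \<psi> \<and> h = \<phi> + \<psi>"])
  show "\<exists>\<phi>' \<psi>'. smooth \<phi>' \<and> smooth \<psi>' \<and> \<phi> + \<psi> = \<phi>' + \<psi>'"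
    using assms by blast
next
  fix h :: "'a \<Rightarrow> 'b" assume "\<exists>\<phi> \<psi>. smooth \<phi> \<and> smooth \<psi> \<and> h = \<phi> + \<psi>"
  then obtain \<phi> \<psi> where \<phi>: "smooth \<phi>" "smooth \<psi>" "h = \<phi> + \<psi>"
    by blast
  show "h differentiable_on UNIV"
    using smooth_differentiable[OF \<phi>(1)] smooth_differentiable[OF \<phi>(2)]
    by (auto simp: \<phi>(3) differentiable_on_def plus_fun_def)
  show "\<exists>\<phi> \<psi>. smooth \<phi> \<and> smooth \<psi> \<and> dir_deriv b h = \<phi> + \<psi>" if "b \<in> Basis" for b
    using smooth_dir_deriv[OF \<phi>(1) that] smooth_dir_deriv[OF \<phi>(2) that] dir_deriv_add[OF \<phi>(1,2)] \<phi>(3) by metis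
qed

lemma test_functionsI:
  assumes "smooth \<phi>" "compact K" "K \<subseteq> \<Omega>" "\<And>x. x \<notin> K \<Longrightarrow> \<phi> x = 0"
  shows "\<phi> \<in> test_functions \<Omega>"
proof -
  have "closure {x. \<phi> x \<noteq> 0} \<subseteq> K"
    using assms by (intro closure_minimal compact_imp_closed) auto
  moreover from this have "compact (closure {x. \<phi> x \<noteq> 0})"
    by (metis assms(2) closed_closure compact_Int_closed inf.absorb_iff2)
  ultimately show ?thesis
    using assms by (auto simp: test_functions_def)
qed

lemma test_functionsE:
  assumes "\<phi> \<in> test_functions \<Omega>"
  obtains K where "smooth \<phi>" "compact K" "K \<subseteq> \<Omega>" "\<forall>x. x \<notin> K \<longrightarrow> \<phi> x = 0"
proof -
  have "\<forall>x. x \<notin> closure {x. \<phi> x \<noteq> 0} \<longrightarrow> \<phi> x = 0"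
    using closure_subset[of "{x. \<phi> x \<noteq> 0}"] by blast
  with assms show thesis
    by (intro that[of "closure {x. \<phi> x \<noteq> 0}"]) (simp_all only: test_functions_def mem_Collect_eq)
qed

lemma test_functions_smooth: "\<phi> \<in> test_functions \<Omega> \<Longrightarrow> smooth \<phi>"
  by (simp add: test_functions_def)

lemma dir_deriv_zero_outside:
  assumes "compact K" "\<forall>x. x \<notin> K \<longrightarrow> \<phi> x = 0" "x \<notin> K"
  shows "dir_deriv b \<phi> x = 0"
proof -
  have "((\<lambda>x. 0) has_derivative (\<lambda>_. 0)) (at x)"
    by simp
  then have "(\<phi> has_derivative (\<lambda>_. 0)) (at x)"
    by (rule has_derivative_transform_within_open[where s="- K"])
      (use assms in \<open>auto simp: compact_imp_closed open_Compl\<close>)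
  from frechet_derivative_at[OF this] show ?thesis
    by (metis dir_deriv_def)
qed

lemma test_functions_dir_deriv:
  assumes "\<phi> \<in> test_functions \<Omega>" "b \<in> Basis"
  shows "dir_deriv b \<phi> \<in> test_functions \<Omega>"
proof -
  obtain K where K: "smooth \<phi>" "compact K" "K \<subseteq> \<Omega>" "\<forall>x. x \<notin> K \<longrightarrow> \<phi> x = 0"
    using assms(1) by (rule test_functionsE)
  show ?thesis
    using smooth_dir_deriv[OF K(1) assms(2)] K(2,3) dir_deriv_zero_outside[OF K(2,4)]
    by (rule test_functionsI)
qed

lemma test_functions_bounded_linear:
  assumes f: "bounded_linear f" and "\<phi> \<in> test_functions \<Omega>"
  shows "(\<lambda>x. f (\<phi> x)) \<in> test_functions \<Omega>"
proof -
  obtain K where K: "smooth \<phi>" "compact K" "K \<subseteq> \<Omega>" "\<forall>x. x \<notin> K \<longrightarrow> \<phi> x = 0"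
    using assms(2) by (rule test_functionsE)
  show ?thesis
    using smooth_bounded_linear[OF f K(1)] K(2,3)
    by (rule test_functionsI) (simp add: K(4) bounded_linear.linear[OF f] linear_0)
qed

lemma test_functions_cmult: "\<phi> \<in> test_functions \<Omega> \<Longrightarrow> (\<lambda>x. c * \<phi> x) \<in> test_functions \<Omega>"
  for \<phi> :: "'a::euclidean_space \<Rightarrow> complex"
  by (rule test_functions_bounded_linear[OF bounded_linear_mult_right])

lemma dir_deriv_cmult: "smooth \<phi> \<Longrightarrow> dir_deriv b (\<lambda>x. c * \<phi> x) = (\<lambda>x. c * dir_deriv b \<phi> x)"
  for \<phi> :: "'a::euclidean_space \<Rightarrow> complex"
  by (rule dir_deriv_bounded_linear[OF bounded_linear_mult_right])

lemma test_functions_scaleR: "\<phi> \<in> test_functions \<Omega> \<Longrightarrow> c *\<^sub>R \<phi> \<in> test_functions \<Omega>"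
  unfolding scaleR_fun_def by (rule test_functions_bounded_linear[OF bounded_linear_scaleR_right])

lemma dir_deriv_scaleR: "smooth \<phi> \<Longrightarrow> dir_deriv b (c *\<^sub>R \<phi>) = c *\<^sub>R dir_deriv b \<phi>"
  unfolding scaleR_fun_def by (rule dir_deriv_bounded_linear[OF bounded_linear_scaleR_right])

lemma test_functions_add:
  assumes "\<phi> \<in> test_functions \<Omega>" "\<psi> \<in> test_functions \<Omega>"
  shows "\<phi> + \<psi> \<in> test_functions \<Omega>"
proof -
  obtain K where K: "smooth \<phi>" "compact K" "K \<subseteq> \<Omega>" "\<forall>x. x \<notin> K \<longrightarrow> \<phi> x = 0"
    using assms(1) by (rule test_functionsE)
  obtain L where L: "smooth \<psi>" "compact L" "L \<subseteq> \<Omega>" "\<forall>x. x \<notin> L \<longrightarrow> \<psi> x = 0"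
    using assms(2) by (rule test_functionsE)
  show ?thesis
    using smooth_add[OF K(1) L(1)] compact_Un[OF K(2) L(2)] Un_least[OF K(3) L(3)]
    by (rule test_functionsI) (simp add: K(4) L(4))
qed

lemma test_functions_diff:
  assumes "\<phi> \<in> test_functions \<Omega>" "\<psi> \<in> test_functions \<Omega>"
  shows "\<phi> - \<psi> \<in> test_functions \<Omega>"
  using test_functions_add[OF assms(1) test_functions_scaleR[OF assms(2), of "-1"]] by simp

lemma test_functions_bounded_supported:
  assumes "\<phi> \<in> test_functions \<Omega>" "\<Omega> \<in> sets lebesgue"
  obtains B K where "bounded_supported \<Omega> B K \<phi>"
proof -
  obtain K where K: "smooth \<phi>" "compact K" "K \<subseteq> \<Omega>" "\<forall>x. x \<notin> K \<longrightarrow> \<phi> x = 0"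
    using assms(1) by (rule test_functionsE)
  have "bounded (\<phi> ` K)"
    by (intro compact_imp_bounded compact_continuous_image smooth_continuous_on K)
  then obtain B where B: "0 < B" "\<forall>x\<in>K. cmod (\<phi> x) \<le> B"
    unfolding bounded_pos by auto
  have "cmod (\<phi> x) \<le> B" for x
    using B K(4) by (cases "x \<in> K") auto
  moreover have "\<phi> \<in> borel_measurable (lebesgue_on \<Omega>)"
    using assms(2) by (intro continuous_imp_measurable_on_sets_lebesgue smooth_continuous_on K)
  ultimately have "bounded_supported \<Omega> B K \<phi>"
    unfolding bounded_supported_def using B K by auto
  then show thesis
    by (rule that)
qed

lemma test_functions_Lp_norm_finite:
  assumes \<phi>: "\<phi> \<in> test_functions \<Omega>" and \<Omega>: "\<Omega> \<in> sets lebesgue" and p: "0 \<le> p"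
  shows "Lp_norm p \<Omega> \<phi> < top"
proof -
  obtain B K where BK: "bounded_supported \<Omega> B K \<phi>"
    using \<phi> \<Omega> by (rule test_functions_bounded_supported)
  have K: "compact K"
    using BK by (simp add: bounded_supported_def)
  have "K \<in> sets lebesgue"
    using fmeasurableD[OF lmeasurable_compact[OF K]] .
  then have K': "K \<inter> \<Omega> \<in> sets (lebesgue_on \<Omega>)"
    by (auto simp only: sets_restrict_space Int_commute[of K])
  have "(\<integral>\<^sup>+x. ennreal (cmod (\<phi> x) powr p) \<partial>lebesgue_on \<Omega>) \<le> (\<integral>\<^sup>+x. ennreal (B powr p) * indicator (K \<inter> \<Omega>) x \<partial>lebesgue_on \<Omega>)"
  proof (rule nn_integral_mono)
    fix x assume x: "x \<in> space (lebesgue_on \<Omega>)"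
    have "cmod (\<phi> x) powr p \<le> B powr p"
      using BK p by (intro powr_mono2) (auto simp: bounded_supported_def)
    moreover have "x \<in> K \<inter> \<Omega> \<or> \<phi> x = 0"
      using BK x by (auto simp: bounded_supported_def)
    ultimately show "ennreal (cmod (\<phi> x) powr p) \<le> ennreal (B powr p) * indicator (K \<inter> \<Omega>) x"
      by (auto simp: indicator_def ennreal_leI)
  qed
  also have "\<dots> = ennreal (B powr p) * emeasure lebesgue (K \<inter> \<Omega>)"
    using K' \<Omega> by (simp add: nn_integral_cmult_indicator emeasure_restrict_space)
  also have "\<dots> \<le> ennreal (B powr p) * emeasure lebesgue K"
    using \<open>K \<in> sets lebesgue\<close> by (intro mult_left_mono emeasure_mono) auto
  also have "\<dots> < top"
    using fmeasurableD2[OF lmeasurable_compact[OF K]] by (simp add: ennreal_mult_less_top top.not_eq_extremum)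
  finally show ?thesis
    using BK by (simp add: Lp_norm_finite_iff bounded_supported_def)
qed

lemma vector_derivative_difference_quotient:
  fixes f :: "real \<Rightarrow> 'a::real_normed_vector"
  assumes "(f has_vector_derivative v) (at 0)"
  shows "(\<lambda>n. real (Suc n) *\<^sub>R (f (1 / real (Suc n)) - f 0)) \<longlonglongrightarrow> v"
proof -
  have "((\<lambda>h. norm (f (0 + h) - f 0 - h *\<^sub>R v) / norm h) \<longlongrightarrow> 0) (at 0)"
    using assms unfolding has_vector_derivative_def has_derivative_at by blast
  moreover have "filterlim (\<lambda>n. 1 / real (Suc n)) (at 0) sequentially"
    unfolding filterlim_at using LIMSEQ_inverse_real_of_nat by (simp add: inverse_eq_divide)
  ultimately have "(\<lambda>n. norm (f (0 + 1 / real (Suc n)) - f 0 - (1 / real (Suc n)) *\<^sub>R v) / norm (1 / real (Suc n))) \<longlonglongrightarrow> 0"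
    by (rule filterlim_compose)
  moreover have "norm (f (0 + 1 / real (Suc n)) - f 0 - (1 / real (Suc n)) *\<^sub>R v) / norm (1 / real (Suc n))
      = norm (real (Suc n) *\<^sub>R (f (1 / real (Suc n)) - f 0) - v)" for n
  proof -
    have "real (Suc n) *\<^sub>R (f (1 / real (Suc n)) - f 0) - v = real (Suc n) *\<^sub>R (f (1 / real (Suc n)) - f 0 - (1 / real (Suc n)) *\<^sub>R v)"
      by (simp add: scaleR_diff_right del: of_nat_Suc)
    then show ?thesis
      by (simp del: of_nat_Suc)
  qed
  ultimately show ?thesis
    by (simp only: tendsto_norm_zero_iff LIM_zero_iff)
qed

text \<open>
  The integral of a difference quotient vanishes by translation invariance, and the quotients along \<open>b\<close> converge
  boundedly to the derivative.  The set \<open>K'\<close>, all points at distance at most 1 from \<open>K\<close>, contains the supports of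
  the quotients with step at most 1.
\<close>
lemma integral_dir_deriv_zero:
  fixes F :: "'a::euclidean_space \<Rightarrow> complex"
  assumes F: "\<And>x. F differentiable (at x)" and F': "continuous_on UNIV (dir_deriv b F)"
    and K: "compact K" "\<forall>x. x \<notin> K \<longrightarrow> F x = 0" and b: "b \<in> Basis"
  shows "(\<integral>x. dir_deriv b F x \<partial>lborel) = 0"
proof -
  have cont: "continuous_on UNIV F" "continuous_on UNIV (dir_deriv b F)"
    using F F' by (auto intro: continuous_at_imp_continuous_on differentiable_imp_continuous_within)
  have [measurable]: "F \<in> borel_measurable borel" "dir_deriv b F \<in> borel_measurable borel"
    using cont by (auto intro: borel_measurable_continuous_onI)
  have "bounded (dir_deriv b F ` K)"
    by (intro compact_imp_bounded compact_continuous_image K continuous_on_subset[OF cont(2)]) auto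
  then obtain L where L: "0 < L" "\<forall>x\<in>K. cmod (dir_deriv b F x) \<le> L"
    unfolding bounded_pos by auto
  have L': "cmod (dir_deriv b F x) \<le> L" for x
    using L dir_deriv_zero_outside[OF K, of x b] by (cases "x \<in> K") auto
  have line: "((\<lambda>t. F (x + t *\<^sub>R b)) has_vector_derivative dir_deriv b F (x + t *\<^sub>R b)) (at t within S)" for x t S
  proof -
    have "((\<lambda>t. F (x + t *\<^sub>R b)) has_derivative (\<lambda>h. frechet_derivative F (at (x + t *\<^sub>R b)) (h *\<^sub>R b))) (at t within S)"
      by (rule has_derivative_compose[OF _ has_derivative_frechet[OF F]]) (auto intro!: derivative_eq_intros)
    moreover have "linear (frechet_derivative F (at (x + t *\<^sub>R b)))"
      using has_derivative_frechet[OF F] has_derivative_linear by blast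
    ultimately show ?thesis
      by (simp add: has_vector_derivative_def dir_deriv_def linear_scale)
  qed
  have lip: "cmod (F (x + t *\<^sub>R b) - F x) \<le> L * t" if "0 \<le> t" for x t
    using differentiable_bound[of "{0..t}" "\<lambda>t. F (x + t *\<^sub>R b)" "\<lambda>t h. h *\<^sub>R dir_deriv b F (x + t *\<^sub>R b)" L t 0]
      line[unfolded has_vector_derivative_def] L' that
    by (simp add: onorm_scaleR_left bounded_linear_ident onorm_id)
  define q where "q n x = real (Suc n) *\<^sub>R (F (x + (1 / real (Suc n)) *\<^sub>R b) - F x)" for n x
  define K' where "K' = (\<lambda>(x, y). x + y) ` (K \<times> cball 0 1)"
  have K': "compact K'"
    unfolding K'_def by (intro compact_continuous_image compact_Times K) (auto intro!: continuous_intros simp: split_beta)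
  have int_F: "integrable lborel F"
  proof -
    have "integrable lborel (\<lambda>x. indicator K x *\<^sub>R F x)"
      by (rule borel_integrable_compact[OF K(1) continuous_on_subset[OF cont(1)]]) simp
    also have "(\<lambda>x. indicator K x *\<^sub>R F x) = F"
      using K(2) by (auto simp: fun_eq_iff indicator_def)
    finally show ?thesis .
  qed
  have trans: "integrable lborel (\<lambda>x. F (x + c))" "(\<integral>x. F (x + c) \<partial>lborel) = (\<integral>x. F x \<partial>lborel)" for c
  proof -
    have "integrable (distr lborel borel ((+) c)) F" "(\<integral>x. F x \<partial>distr lborel borel ((+) c)) = (\<integral>x. F x \<partial>lborel)"
      using int_F by (simp_all only: lborel_distr_plus)
    then show "integrable lborel (\<lambda>x. F (x + c))" "(\<integral>x. F (x + c) \<partial>lborel) = (\<integral>x. F x \<partial>lborel)"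
      by (simp_all add: integrable_distr_eq integral_distr add.commute)
  qed
  have int_q: "(\<integral>x. q n x \<partial>lborel) = 0" for n
    unfolding q_def by (simp only: integral_scaleR_right Bochner_Integration.integral_diff[OF trans(1) int_F] trans(2)) simp
  have "(\<lambda>n. \<integral>x. q n x \<partial>lborel) \<longlonglongrightarrow> (\<integral>x. dir_deriv b F x \<partial>lborel)"
  proof (rule integral_dominated_convergence[where w="\<lambda>x. L * indicator K' x"])
    show "AE x in lborel. (\<lambda>n. q n x) \<longlonglongrightarrow> dir_deriv b F x"
      using vector_derivative_difference_quotient[OF line[of _ 0 UNIV, simplified]] by (auto simp: q_def)
    show "integrable lborel (\<lambda>x. L * indicator K' x)"
      using emeasure_compact_finite[OF K'] borel_compact[OF K']
      by (intro integrable_mult_right integrable_real_indicator) simp_all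
    show "AE x in lborel. norm (q n x) \<le> L * indicator K' x" for n
    proof (rule AE_I2)
      fix x
      show "norm (q n x) \<le> L * indicator K' x"
      proof (cases "x \<in> K'")
        case True
        have "norm (q n x) \<le> real (Suc n) * (L * (1 / real (Suc n)))"
          unfolding q_def norm_scaleR by (intro mult_mono lip) simp_all
        with True show ?thesis by simp
      next
        case False
        have "y \<notin> K" if "norm (x - y) \<le> 1" for y
          using False that by (force simp: K'_def image_iff dest: bspec[of _ _ "(y, x - y)"])
        from this[of x] this[of "x + (1 / real (Suc n)) *\<^sub>R b"] show ?thesis
          using K(2) b False by (simp add: q_def)
      qed
    qed
  qed (auto simp: q_def)
  then show ?thesis
    by (simp add: int_q LIMSEQ_const_iff)
qed

lemma fun_distr_integration_by_parts:
  assumes \<Omega>: "\<Omega> \<in> sets lebesgue" and \<phi>: "\<phi> \<in> test_functions \<Omega>" and \<eta>: "\<eta> \<in> test_functions \<Omega>" and b: "b \<in> Basis"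
  shows "fun_distr \<Omega> (dir_deriv b \<phi>) \<eta> = - fun_distr \<Omega> \<phi> (dir_deriv b \<eta>)"
proof -
  obtain K where K: "smooth \<phi>" "compact K" "K \<subseteq> \<Omega>" "\<forall>x. x \<notin> K \<longrightarrow> \<phi> x = 0"
    using \<phi> by (rule test_functionsE)
  have \<eta>s: "smooth \<eta>"
    using \<eta> by (rule test_functions_smooth)
  define F where "F = (\<lambda>x. \<phi> x * cnj (\<eta> x))"
  have F': "(F has_derivative (\<lambda>h. \<phi> x * cnj (frechet_derivative \<eta> (at x) h) + frechet_derivative \<phi> (at x) h * cnj (\<eta> x))) (at x)" for x
    unfolding F_def
    by (intro has_derivative_mult has_derivative_cnj smooth_has_derivative K \<eta>s)
  have dF: "dir_deriv b F = (\<lambda>x. \<phi> x * cnj (dir_deriv b \<eta> x) + dir_deriv b \<phi> x * cnj (\<eta> x))"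
    unfolding dir_deriv_eqI[OF F'] by (simp add: dir_deriv_def)
  have cont: "continuous_on UNIV (dir_deriv b F)"
    unfolding dF using K(1) \<eta>s b by (intro continuous_intros smooth_continuous_on smooth_dir_deriv) auto
  then have [measurable]: "dir_deriv b F \<in> borel_measurable borel"
    by (rule borel_measurable_continuous_onI)
  have FK: "\<forall>x. x \<notin> K \<longrightarrow> F x = 0"
    using K(4) by (simp add: F_def)
  have "(\<integral>x. dir_deriv b F x \<partial>lebesgue_on \<Omega>) = (\<integral>x. indicator \<Omega> x *\<^sub>R dir_deriv b F x \<partial>lebesgue)"
    using \<Omega> by (simp add: integral_restrict_space)
  also have "(\<lambda>x. indicator \<Omega> x *\<^sub>R dir_deriv b F x) = dir_deriv b F"
    using dir_deriv_zero_outside[OF K(2) FK] K(3) by (auto simp: fun_eq_iff indicator_def)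
  also have "(\<integral>x. dir_deriv b F x \<partial>lebesgue) = (\<integral>x. dir_deriv b F x \<partial>lborel)"
    by (rule integral_completion) measurable
  also have "\<dots> = 0"
    using F' by (intro integral_dir_deriv_zero[OF _ cont K(2) FK b]) (auto simp: differentiable_def)
  finally have "(\<integral>x. \<phi> x * cnj (dir_deriv b \<eta> x) + dir_deriv b \<phi> x * cnj (\<eta> x) \<partial>lebesgue_on \<Omega>) = 0"
    by (simp add: dF)
  moreover have "integrable (lebesgue_on \<Omega>) (\<lambda>x. \<phi> x * cnj (dir_deriv b \<eta> x))" "integrable (lebesgue_on \<Omega>) (\<lambda>x. dir_deriv b \<phi> x * cnj (\<eta> x))"
    by (intro L2_pairing_integrable test_functions_Lp_norm_finite test_functions_dir_deriv \<phi> \<eta> b \<Omega>; simp)+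
  ultimately have "(\<integral>x. \<phi> x * cnj (dir_deriv b \<eta> x) \<partial>lebesgue_on \<Omega>) + (\<integral>x. dir_deriv b \<phi> x * cnj (\<eta> x) \<partial>lebesgue_on \<Omega>) = 0"
    by simp
  from arg_cong[OF this, of Re] show ?thesis
    by (simp add: fun_distr_def)
qed

section \<open>Products of test functions in time and space\<close>

definition tensor :: "(real \<Rightarrow> real) \<Rightarrow> ('a \<Rightarrow> complex) \<Rightarrow> real \<times> 'a \<Rightarrow> complex"
  where "tensor \<psi> \<phi> = (\<lambda>z. \<psi> (fst z) *\<^sub>R \<phi> (snd z))"

lemma has_derivative_tensor:
  assumes "smooth \<psi>" "smooth \<phi>"
  shows "(tensor \<psi> \<phi> has_derivative (\<lambda>h. \<psi> (fst z) *\<^sub>R frechet_derivative \<phi> (at (snd z)) (snd h) +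
    frechet_derivative \<psi> (at (fst z)) (fst h) *\<^sub>R \<phi> (snd z))) (at z)"
  unfolding tensor_def
  by (intro has_derivative_scaleR has_derivative_compose[OF has_derivative_fst[OF has_derivative_ident] smooth_has_derivative[OF assms(1)]]
    has_derivative_compose[OF has_derivative_snd[OF has_derivative_ident] smooth_has_derivative[OF assms(2)]])

lemma dir_deriv_tensor_time:
  assumes "smooth \<psi>" "smooth \<phi>"
  shows "dir_deriv (1, 0) (tensor \<psi> \<phi>) = tensor (dir_deriv 1 \<psi>) \<phi>"
proof -
  have "linear (frechet_derivative \<phi> (at x))" for x
    using smooth_has_derivative[OF assms(2)] has_derivative_linear by blast
  then show ?thesis
    unfolding dir_deriv_eqI[OF has_derivative_tensor[OF assms]]
    by (simp add: fun_eq_iff tensor_def dir_deriv_def linear_0)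
qed

lemma dir_deriv_tensor_space:
  assumes "smooth \<psi>" "smooth \<phi>"
  shows "dir_deriv (0, b) (tensor \<psi> \<phi>) = tensor \<psi> (dir_deriv b \<phi>)"
proof -
  have "linear (frechet_derivative \<psi> (at x))" for x
    using smooth_has_derivative[OF assms(1)] has_derivative_linear by blast
  then show ?thesis
    unfolding dir_deriv_eqI[OF has_derivative_tensor[OF assms]]
    by (simp add: fun_eq_iff tensor_def dir_deriv_def linear_0)
qed

lemma smooth_tensor:
  assumes "smooth \<psi>" "smooth \<phi>"
  shows "smooth (tensor \<psi> \<phi>)"
proof (rule smooth_coinduct[where P="\<lambda>h. \<exists>\<psi> \<phi>. smooth \<psi> \<and> smooth \<phi> \<and> h = tensor \<psi> \<phi>"])
  show "\<exists>\<psi>' \<phi>'. smooth \<psi>' \<and> smooth \<phi>' \<and> tensor \<psi> \<phi> = tensor \<psi>' \<phi>'"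
    using assms by blast
next
  fix h :: "real \<times> 'a \<Rightarrow> complex" assume "\<exists>\<psi> \<phi>. smooth \<psi> \<and> smooth \<phi> \<and> h = tensor \<psi> \<phi>"
  then obtain \<psi> \<phi> where h: "smooth \<psi>" "smooth \<phi>" "h = tensor \<psi> \<phi>"
    by blast
  show "h differentiable_on UNIV"
    using has_derivative_tensor[OF h(1,2)] by (auto simp: h(3) differentiable_on_def differentiable_def)
  show "\<exists>\<psi> \<phi>. smooth \<psi> \<and> smooth \<phi> \<and> dir_deriv b h = tensor \<psi> \<phi>" if b: "b \<in> Basis" for b
  proof -
    consider "b = (1, 0)" | c where "b = (0, c)" "c \<in> Basis"
      using b by (auto simp: Basis_prod_def)
    then show ?thesis
    proof cases
      case 1
      then show ?thesis
        using dir_deriv_tensor_time[OF h(1,2)] smooth_dir_deriv[OF h(1), of 1] h by auto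
    next
      case 2
      then show ?thesis
        using dir_deriv_tensor_space[OF h(1,2)] smooth_dir_deriv[OF h(2)] h by auto
    qed
  qed
qed

lemma test_functions_tensor:
  assumes "\<psi> \<in> test_functions I" "\<phi> \<in> test_functions \<Omega>"
  shows "tensor \<psi> \<phi> \<in> test_functions (I \<times> \<Omega>)"
proof -
  obtain K where K: "smooth \<psi>" "compact K" "K \<subseteq> I" "\<forall>x. x \<notin> K \<longrightarrow> \<psi> x = 0"
    using assms(1) by (rule test_functionsE)
  obtain L where L: "smooth \<phi>" "compact L" "L \<subseteq> \<Omega>" "\<forall>x. x \<notin> L \<longrightarrow> \<phi> x = 0"
    using assms(2) by (rule test_functionsE)
  show ?thesis
    using smooth_tensor[OF K(1) L(1)] compact_Times[OF K(2) L(2)] Sigma_mono[OF K(3) L(3)]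
    by (rule test_functionsI) (use K(4) L(4) in \<open>auto simp: tensor_def\<close>)
qed

lemma dir_deriv_real: "smooth \<psi> \<Longrightarrow> dir_deriv 1 \<psi> = deriv \<psi>" for \<psi> :: "real \<Rightarrow> real"
  using smooth_differentiable frechet_derivative_at
  by (metis (no_types, lifting) DERIV_deriv_iff_real_differentiable dir_deriv_def ext has_field_derivative_def mult.right_neutral)

section \<open>The norm of the sum of the dual of \<open>H\<^sup>2\<^sub>0\<close> and a Lebesgue space\<close>

lemma ext_seminormI:
  assumes "\<And>x y. N (x + y) \<le> N x + N y" and "N 0 = 0"
    and scale: "\<And>c x. c \<noteq> 0 \<Longrightarrow> N (c *\<^sub>R x) \<le> ennreal \<bar>c\<bar> * N x"
  shows "ext_seminorm N"
proof
  show "N (c *\<^sub>R x) = ennreal \<bar>c\<bar> * N x" for c x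
  proof (cases "c = 0")
    case False
    have "ennreal \<bar>c\<bar> * N x = ennreal \<bar>c\<bar> * N ((1 / c) *\<^sub>R (c *\<^sub>R x))"
      using False by simp
    also have "\<dots> \<le> ennreal \<bar>c\<bar> * (ennreal \<bar>1 / c\<bar> * N (c *\<^sub>R x))"
      using False by (intro mult_left_mono scale) auto
    also have "\<dots> = N (c *\<^sub>R x)"
      using False by (simp add: mult.assoc[symmetric] ennreal_mult[symmetric] abs_divide)
    finally show ?thesis
      using scale[OF False] by (intro antisym) auto
  qed (use assms in simp)
qed fact

lemma le_INF_add_INF:
  fixes f :: "'a \<Rightarrow> ennreal" and g :: "'b \<Rightarrow> ennreal"
  assumes "\<And>x y. x \<in> A \<Longrightarrow> y \<in> B \<Longrightarrow> c \<le> f x + g y"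
  shows "c \<le> (INF x\<in>A. f x) + (INF y\<in>B. g y)"
proof (cases "(INF x\<in>A. f x) = top \<or> (INF y\<in>B. g y) = top")
  case False
  show ?thesis
  proof (rule ennreal_le_epsilon)
    fix e :: real assume e: "0 < e"
    obtain x where x: "x \<in> A" "f x < (INF x\<in>A. f x) + ennreal (e / 2)"
      using INF_approx_ennreal[of "e / 2" _ f A, OF _ refl] e False by auto
    obtain y where y: "y \<in> B" "g y < (INF y\<in>B. g y) + ennreal (e / 2)"
      using INF_approx_ennreal[of "e / 2" _ g B, OF _ refl] e False by auto
    have "c \<le> f x + g y"
      using assms x y by blast
    also have "\<dots> \<le> ((INF x\<in>A. f x) + ennreal (e / 2)) + ((INF y\<in>B. g y) + ennreal (e / 2))"
      using x y by (intro add_mono) auto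
    also have "\<dots> = (INF x\<in>A. f x) + (INF y\<in>B. g y) + (ennreal (e / 2) + ennreal (e / 2))"
      by (simp add: add_ac)
    also have "ennreal (e / 2) + ennreal (e / 2) = ennreal e"
      using e by (subst ennreal_plus[symmetric]) auto
    finally show "c \<le> (INF x\<in>A. f x) + (INF y\<in>B. g y) + ennreal e" .
  qed
qed auto

text \<open>
  The norms of distributions are quotient norms: the infimum of a seminorm over all \<open>x\<close> that represent \<open>T\<close>.  Any linear
  representation relation \<open>R\<close> yields a seminorm in this way.
\<close>
lemma (in ext_seminorm) ext_seminorm_INF:
  assumes add: "\<And>x y T S. N x < top \<Longrightarrow> N y < top \<Longrightarrow> R x T \<Longrightarrow> R y S \<Longrightarrow> R (x + y) (T + S)"
    and scale: "\<And>c x T. R x T \<Longrightarrow> R (c *\<^sub>R x) (c *\<^sub>R T)"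
    and zero: "R 0 (0 :: 'w::real_vector)"
  shows "ext_seminorm (\<lambda>T. INF x\<in>{x. R x T}. N x)"
proof (rule ext_seminormI)
  show "(INF x\<in>{x. R x (T + S)}. N x) \<le> (INF x\<in>{x. R x T}. N x) + (INF x\<in>{x. R x S}. N x)" for T S
  proof (rule le_INF_add_INF)
    fix x y assume xy: "x \<in> {x. R x T}" "y \<in> {x. R x S}"
    show "(INF x\<in>{x. R x (T + S)}. N x) \<le> N x + N y"
    proof (cases "N x = top \<or> N y = top")
      case False
      then have "R (x + y) (T + S)"
        using xy by (intro add) (auto simp: top.not_eq_extremum)
      then show ?thesis
        by (intro INF_lower2[of "x + y"] triangle) auto
    qed auto
  qed
  show "(INF x\<in>{x. R x 0}. N x) = 0"
    using INF_lower[of 0 "{x. R x 0}" N] zero by simp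
  fix c :: real and T assume c: "c \<noteq> 0"
  have "ennreal \<bar>1 / c\<bar> * (INF x\<in>{x. R x (c *\<^sub>R T)}. N x) \<le> (INF x\<in>{x. R x T}. N x)"
  proof (rule INF_greatest)
    fix x assume "x \<in> {x. R x T}"
    then have "(INF x\<in>{x. R x (c *\<^sub>R T)}. N x) \<le> N (c *\<^sub>R x)"
      by (intro INF_lower) (auto intro: scale)
    then have "ennreal \<bar>1 / c\<bar> * (INF x\<in>{x. R x (c *\<^sub>R T)}. N x) \<le> ennreal \<bar>1 / c\<bar> * N (c *\<^sub>R x)"
      by (rule mult_left_mono) simp
    also have "\<dots> = N ((1 / c) *\<^sub>R (c *\<^sub>R x))"
      by (rule scaleR[symmetric])
    also have "\<dots> = N x"
      using c by simp
    finally show "ennreal \<bar>1 / c\<bar> * (INF x\<in>{x. R x (c *\<^sub>R T)}. N x) \<le> N x" .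
  qed
  then have "ennreal \<bar>c\<bar> * (ennreal \<bar>1 / c\<bar> * (INF x\<in>{x. R x (c *\<^sub>R T)}. N x)) \<le> ennreal \<bar>c\<bar> * (INF x\<in>{x. R x T}. N x)"
    by (rule mult_left_mono) simp
  then show "(INF x\<in>{x. R x (c *\<^sub>R T)}. N x) \<le> ennreal \<bar>c\<bar> * (INF x\<in>{x. R x T}. N x)"
    using c by (simp add: mult.assoc[symmetric] ennreal_mult[symmetric] abs_divide)
qed

lemma ext_seminorm_dual_norm: "ext_seminorm (dual_norm N)"
proof (rule ext_seminormI)
  let ?lin = "\<lambda>\<Lambda>. (\<forall>x y. N x < \<infinity> \<longrightarrow> N y < \<infinity> \<longrightarrow> \<Lambda> (x + y) = \<Lambda> x + \<Lambda> y) \<and>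
        (\<forall>c x. N x < \<infinity> \<longrightarrow> \<Lambda> (c *\<^sub>R x) = c * \<Lambda> x)"
  show "dual_norm N (\<Lambda> + \<Lambda>') \<le> dual_norm N \<Lambda> + dual_norm N \<Lambda>'" for \<Lambda> \<Lambda>'
  proof (cases "?lin \<Lambda> \<and> ?lin \<Lambda>'")
    case True
    then have "?lin (\<Lambda> + \<Lambda>')"
      by (auto simp: plus_fun_def distrib_left)
    then have "dual_norm N (\<Lambda> + \<Lambda>') = (SUP x\<in>{x. N x \<le> 1}. ennreal \<bar>(\<Lambda> + \<Lambda>') x\<bar>)"
      unfolding dual_norm_def by simp
    also have "\<dots> \<le> (SUP x\<in>{x. N x \<le> 1}. ennreal \<bar>\<Lambda> x\<bar>) + (SUP x\<in>{x. N x \<le> 1}. ennreal \<bar>\<Lambda>' x\<bar>)"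
    proof (rule SUP_least)
      fix x assume x: "x \<in> {x. N x \<le> 1}"
      have "ennreal \<bar>(\<Lambda> + \<Lambda>') x\<bar> \<le> ennreal \<bar>\<Lambda> x\<bar> + ennreal \<bar>\<Lambda>' x\<bar>"
        by (simp flip: ennreal_plus)
      also have "\<dots> \<le> (SUP x\<in>{x. N x \<le> 1}. ennreal \<bar>\<Lambda> x\<bar>) + (SUP x\<in>{x. N x \<le> 1}. ennreal \<bar>\<Lambda>' x\<bar>)"
        using x by (intro add_mono SUP_upper) auto
      finally show "ennreal \<bar>(\<Lambda> + \<Lambda>') x\<bar> \<le> (SUP x\<in>{x. N x \<le> 1}. ennreal \<bar>\<Lambda> x\<bar>) + (SUP x\<in>{x. N x \<le> 1}. ennreal \<bar>\<Lambda>' x\<bar>)" .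
    qed
    also have "\<dots> = dual_norm N \<Lambda> + dual_norm N \<Lambda>'"
      using True unfolding dual_norm_def by simp
    finally show ?thesis .
  next
    case False
    then have "dual_norm N \<Lambda> = \<infinity> \<or> dual_norm N \<Lambda>' = \<infinity>"
      unfolding dual_norm_def by meson
    then show ?thesis
      by auto
  qed
  show "dual_norm N 0 = 0"
    unfolding dual_norm_def by (simp add: SUP_constant bot_ennreal)
  show "dual_norm N (c *\<^sub>R \<Lambda>) \<le> ennreal \<bar>c\<bar> * dual_norm N \<Lambda>" if "c \<noteq> 0" for c \<Lambda>
  proof (cases "?lin \<Lambda>")
    case True
    then have "?lin (c *\<^sub>R \<Lambda>)"
      by (auto simp: scaleR_fun_def distrib_left)
    then have "dual_norm N (c *\<^sub>R \<Lambda>) = (SUP x\<in>{x. N x \<le> 1}. ennreal \<bar>(c *\<^sub>R \<Lambda>) x\<bar>)"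
      unfolding dual_norm_def by simp
    also have "\<dots> \<le> ennreal \<bar>c\<bar> * (SUP x\<in>{x. N x \<le> 1}. ennreal \<bar>\<Lambda> x\<bar>)"
    proof (rule SUP_least)
      fix x assume x: "x \<in> {x. N x \<le> 1}"
      have "ennreal \<bar>(c *\<^sub>R \<Lambda>) x\<bar> = ennreal \<bar>c\<bar> * ennreal \<bar>\<Lambda> x\<bar>"
        by (simp add: scaleR_fun_def abs_mult ennreal_mult)
      also have "\<dots> \<le> ennreal \<bar>c\<bar> * (SUP x\<in>{x. N x \<le> 1}. ennreal \<bar>\<Lambda> x\<bar>)"
        using x by (intro mult_left_mono SUP_upper) auto
      finally show "ennreal \<bar>(c *\<^sub>R \<Lambda>) x\<bar> \<le> ennreal \<bar>c\<bar> * (SUP x\<in>{x. N x \<le> 1}. ennreal \<bar>\<Lambda> x\<bar>)" .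
    qed
    also have "\<dots> = ennreal \<bar>c\<bar> * dual_norm N \<Lambda>"
      using True unfolding dual_norm_def by simp
    finally show ?thesis .
  next
    case False
    then have "dual_norm N \<Lambda> = \<infinity>"
      unfolding dual_norm_def by meson
    then show ?thesis
      using that by (simp add: ennreal_mult_top)
  qed
qed

lemma ext_seminorm_H_minus2_norm: "ext_seminorm (H_minus2_norm \<Omega>)"
  unfolding H_minus2_norm_def[abs_def]
  by (rule ext_seminorm.ext_seminorm_INF[OF ext_seminorm_dual_norm]) (auto simp: scaleR_fun_def)

lemma ext_seminorm_Lp_distr_norm:
  fixes \<Omega> :: "'a::euclidean_space set"
  assumes \<Omega>: "\<Omega> \<in> sets lebesgue" and p: "1 \<le> p"
  shows "ext_seminorm (Lp_distr_norm p \<Omega>)"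
  unfolding Lp_distr_norm_def[abs_def]
proof (rule ext_seminorm.ext_seminorm_INF[OF ext_seminorm_Lp_norm[OF p]])
  show "\<forall>\<phi>\<in>test_functions \<Omega>. fun_distr \<Omega> (g + h) \<phi> = (T + S) \<phi>"
    if "Lp_norm p \<Omega> g < top" "Lp_norm p \<Omega> h < top"
      "\<forall>\<phi>\<in>test_functions \<Omega>. fun_distr \<Omega> g \<phi> = T \<phi>" "\<forall>\<phi>\<in>test_functions \<Omega>. fun_distr \<Omega> h \<phi> = S \<phi>" for g h T S
  proof
    fix \<phi> :: "'a \<Rightarrow> complex" assume \<phi>: "\<phi> \<in> test_functions \<Omega>"
    then obtain B K where "bounded_supported \<Omega> B K \<phi>"
      using \<Omega> by (rule test_functions_bounded_supported)
    then show "fun_distr \<Omega> (g + h) \<phi> = (T + S) \<phi>"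
      using that \<phi> by (simp add: fun_distr_add[OF \<Omega> p p])
  qed
qed (unfold fun_distr_scaleR, auto simp: scaleR_fun_def)

lemma ext_seminorm_sum_norm:
  assumes "ext_seminorm N" "ext_seminorm M"
  shows "ext_seminorm (sum_norm N M)"
proof -
  interpret N: ext_seminorm N by fact
  interpret M: ext_seminorm M by fact
  have P: "ext_seminorm (\<lambda>(y, z). N y + M z)"
  proof
    show "(case x + y of (y, z) \<Rightarrow> N y + M z) \<le> (case x of (y, z) \<Rightarrow> N y + M z) + (case y of (y, z) \<Rightarrow> N y + M z)" for x y
      using add_mono[OF N.triangle M.triangle, of "fst x" "fst y" "snd x" "snd y"] by (simp add: split_beta add_ac)
    show "(case c *\<^sub>R x of (y, z) \<Rightarrow> N y + M z) = ennreal \<bar>c\<bar> * (case x of (y, z) \<Rightarrow> N y + M z)" for c x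
      by (simp add: split_beta N.scaleR M.scaleR distrib_left)
  qed
  have "ext_seminorm (\<lambda>x. INF yz\<in>{yz. fst yz + snd yz = x}. (\<lambda>(y, z). N y + M z) yz)"
    by (rule ext_seminorm.ext_seminorm_INF[OF P]) (auto simp: scaleR_add_right)
  moreover have "(\<lambda>x. INF yz\<in>{yz. fst yz + snd yz = x}. (\<lambda>(y, z). N y + M z) yz) = sum_norm N M"
    by (auto simp: sum_norm_def fun_eq_iff split_beta intro!: INF_cong)
  ultimately show ?thesis by simp
qed

lemma ext_seminorm_H_minus2_plus_Lp_norm:
  assumes "\<Omega> \<in> sets lebesgue" "1 \<le> p"
  shows "ext_seminorm (H_minus2_plus_Lp_norm p \<Omega>)"
  unfolding H_minus2_plus_Lp_norm_def
  by (intro ext_seminorm_sum_norm ext_seminorm_H_minus2_norm ext_seminorm_Lp_distr_norm assms)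

lemma H_minus2_plus_Lp_norm_le_H_minus2:
  assumes "\<Omega> \<in> sets lebesgue" "1 \<le> p"
  shows "H_minus2_plus_Lp_norm p \<Omega> T \<le> H_minus2_norm \<Omega> T"
proof -
  interpret ext_seminorm "Lp_distr_norm p \<Omega>" by (rule ext_seminorm_Lp_distr_norm[OF assms])
  show ?thesis
    unfolding H_minus2_plus_Lp_norm_def sum_norm_def by (rule INF_lower2[of "(T, 0)"]) auto
qed

lemma H_minus2_plus_Lp_norm_le_Lp:
  "H_minus2_plus_Lp_norm p \<Omega> T \<le> Lp_distr_norm p \<Omega> T"
proof -
  interpret ext_seminorm "H_minus2_norm \<Omega>" by (rule ext_seminorm_H_minus2_norm)
  show ?thesis
    unfolding H_minus2_plus_Lp_norm_def sum_norm_def by (rule INF_lower2[of "(0, T)"]) auto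
qed

lemma H_minus2_plus_Lp_norm_zero:
  assumes "\<Omega> \<in> sets lebesgue" "1 \<le> p" "\<And>\<phi>. \<phi> \<in> test_functions \<Omega> \<Longrightarrow> T \<phi> = S \<phi>"
  shows "H_minus2_plus_Lp_norm p \<Omega> (T - S) = 0"
proof -
  have "Lp_distr_norm p \<Omega> (T - S) \<le> Lp_norm p \<Omega> 0"
    unfolding Lp_distr_norm_def using assms(3) by (intro INF_lower) auto
  also have "\<dots> = 0"
    by (rule ext_seminorm.zero[OF ext_seminorm_Lp_norm[OF assms(2)]])
  finally show ?thesis
    using H_minus2_plus_Lp_norm_le_Lp[of p \<Omega> "T - S"] by simp
qed

lemma Lp_distr_norm_fun_distr_le: "Lp_distr_norm p \<Omega> (fun_distr \<Omega> u) \<le> Lp_norm p \<Omega> u"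
  unfolding Lp_distr_norm_def by (rule INF_lower) simp

lemma Lp_distr_norm_cong:
  "(\<And>\<phi>. \<phi> \<in> test_functions \<Omega> \<Longrightarrow> T \<phi> = S \<phi>) \<Longrightarrow> Lp_distr_norm p \<Omega> T = Lp_distr_norm p \<Omega> S"
  unfolding Lp_distr_norm_def by simp

lemma epowr_half_le: "epowr x (1 / 2) \<le> y \<longleftrightarrow> x \<le> y\<^sup>2"
proof (cases y)
  case (real A)
  then show ?thesis
    using epowr_le_iff[of 2 A x] by (simp add: ennreal_power)
qed (simp add: power2_eq_square)

lemma le_epowr_half: "y \<le> epowr x (1 / 2) \<longleftrightarrow> y\<^sup>2 \<le> x"
proof (cases x)
  case (real r)
  have e: "epowr x (1 / 2) = ennreal (sqrt r)"
    using real by (simp add: epowr_def powr_half_sqrt)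
  show ?thesis
  proof (cases y)
    case (real B)
    have "B \<le> sqrt r \<longleftrightarrow> B\<^sup>2 \<le> r"
      using \<open>0 \<le> B\<close> \<open>0 \<le> r\<close> by (metis abs_of_nonneg real_sqrt_abs real_sqrt_le_iff)
    then show ?thesis
      unfolding e unfolding real(2) \<open>x = ennreal r\<close> using \<open>0 \<le> B\<close> \<open>0 \<le> r\<close> by (simp add: ennreal_power)
  next
    case top
    then show ?thesis
      unfolding e unfolding real(2) by (simp add: power2_eq_square top_unique)
  qed
qed (simp add: epowr_def)

section \<open>The Sobolev norm on test functions\<close>

definition Hk_multi_indices :: "nat \<Rightarrow> 'a::euclidean_space list set"
  where "Hk_multi_indices k = {bs. set bs \<subseteq> Basis \<and> 1 \<le> length bs \<and> length bs \<le> k}"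

lemma finite_Hk_multi_indices [simp]: "finite (Hk_multi_indices k)"
proof -
  have "finite {bs. set bs \<subseteq> Basis \<and> length bs \<le> k}"
    by (rule finite_lists_length_le[OF finite_Basis])
  then show ?thesis
    by (rule rev_finite_subset) (auto simp: Hk_multi_indices_def)
qed

lemma Lp_norm_le_Hk_norm: "Lp_norm 2 \<Omega> u \<le> Hk_norm k \<Omega> u"
  unfolding Hk_norm_def le_epowr_half by simp

lemma Lp_distr_norm_le_Hk_norm:
  assumes "bs \<in> Hk_multi_indices k"
  shows "Lp_distr_norm 2 \<Omega> (foldr distr_deriv bs (fun_distr \<Omega> u)) \<le> Hk_norm k \<Omega> u"
  unfolding Hk_norm_def le_epowr_half Hk_multi_indices_def[symmetric]
  using member_le_sum[OF assms, of "\<lambda>bs. (Lp_distr_norm 2 \<Omega> (foldr distr_deriv bs (fun_distr \<Omega> u)))\<^sup>2"]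
  by (simp add: add_increasing)

lemma Hk_norm_le_sum:
  "Hk_norm k \<Omega> u \<le> Lp_norm 2 \<Omega> u + (\<Sum>bs\<in>Hk_multi_indices k. Lp_distr_norm 2 \<Omega> (foldr distr_deriv bs (fun_distr \<Omega> u)))"
proof -
  have sq: "a\<^sup>2 + b\<^sup>2 \<le> (a + b)\<^sup>2" for a b :: ennreal
    by (simp add: power2_sum)
  have "(\<Sum>i\<in>A. (f i)\<^sup>2) \<le> (\<Sum>i\<in>A. f i)\<^sup>2" for A and f :: "'b \<Rightarrow> ennreal"
    by (induction A rule: infinite_finite_induct) (auto intro: order_trans[OF add_left_mono sq])
  then show ?thesis
    unfolding Hk_norm_def epowr_half_le Hk_multi_indices_def[symmetric]
    by (rule order_trans[OF add_left_mono sq])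
qed

lemma foldr_distr_deriv_cong:
  assumes "\<And>\<phi>. \<phi> \<in> test_functions \<Omega> \<Longrightarrow> T \<phi> = S \<phi>" "set bs \<subseteq> Basis" "\<phi> \<in> test_functions \<Omega>"
  shows "foldr distr_deriv bs T \<phi> = foldr distr_deriv bs S \<phi>"
  using assms(2,3)
  by (induction bs arbitrary: \<phi>) (auto simp: distr_deriv_def assms(1) test_functions_dir_deriv)

lemma foldr_distr_deriv_add: "foldr distr_deriv bs (T + S) = foldr distr_deriv bs T + foldr distr_deriv bs S"
  by (induction bs) (auto simp: distr_deriv_def fun_eq_iff)

lemma foldr_distr_deriv_scaleR: "foldr distr_deriv bs (c *\<^sub>R T) = c *\<^sub>R foldr distr_deriv bs T"
  by (induction bs) (auto simp: distr_deriv_def fun_eq_iff scaleR_fun_def)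

lemma test_function_fun_distr_add:
  assumes "\<Omega> \<in> sets lebesgue" "1 \<le> p" "1 \<le> q" "\<phi> \<in> test_functions \<Omega>" "Lp_norm p \<Omega> u < top" "Lp_norm q \<Omega> v < top"
  shows "fun_distr \<Omega> (u + v) \<phi> = fun_distr \<Omega> u \<phi> + fun_distr \<Omega> v \<phi>"
  using test_functions_bounded_supported[OF assms(4,1)] fun_distr_add[OF assms(1-3) _ assms(5,6)] by metis

text \<open>
  A constant for which the triangle inequality holds up to a factor.  It comes from
  comparing the euclidean combination of the components of the Sobolev norm with a common bound for all of them; only
  density and continuity are at stake, which a constant factor does not affect.
\<close>
definition Hk_quasi :: "nat \<Rightarrow> 'a::euclidean_space itself \<Rightarrow> real"
  where "Hk_quasi k _ = 1 + real (card (Hk_multi_indices k :: 'a list set))"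

lemma Hk_quasi_ge_1: "1 \<le> Hk_quasi k TYPE('a::euclidean_space)"
  by (simp add: Hk_quasi_def)

lemma Hk_norm_quasi_bound:
  fixes \<Omega> :: "'a::euclidean_space set"
  assumes "Lp_norm 2 \<Omega> w \<le> X" and "\<And>bs. bs \<in> Hk_multi_indices k \<Longrightarrow> Lp_distr_norm 2 \<Omega> (foldr distr_deriv bs (fun_distr \<Omega> w)) \<le> X"
  shows "Hk_norm k \<Omega> w \<le> ennreal (Hk_quasi k TYPE('a)) * X"
proof -
  have "Hk_norm k \<Omega> w \<le> X + (\<Sum>bs\<in>(Hk_multi_indices k :: 'a list set). X)"
    by (rule order_trans[OF Hk_norm_le_sum]) (intro add_mono sum_mono assms)
  also have "\<dots> = (1 + of_nat (card (Hk_multi_indices k :: 'a list set))) * X"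
    by (simp add: distrib_right)
  also have "1 + of_nat (card (Hk_multi_indices k :: 'a list set)) = ennreal (Hk_quasi k TYPE('a))"
    by (simp add: Hk_quasi_def ennreal_plus ennreal_of_nat_eq_real_of_nat)
  finally show ?thesis .
qed

lemma Hk_norm_add:
  fixes \<Omega> :: "'a::euclidean_space set"
  assumes \<Omega>: "\<Omega> \<in> sets lebesgue"
  shows "Hk_norm k \<Omega> (u + v) \<le> ennreal (Hk_quasi k TYPE('a)) * (Hk_norm k \<Omega> u + Hk_norm k \<Omega> v)"
proof (cases "Lp_norm 2 \<Omega> u = top \<or> Lp_norm 2 \<Omega> v = top")
  case True
  then have "Hk_norm k \<Omega> u + Hk_norm k \<Omega> v = top"
    using Lp_norm_le_Hk_norm[of \<Omega> u k] Lp_norm_le_Hk_norm[of \<Omega> v k] by (auto simp: top_unique)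
  moreover have "ennreal (Hk_quasi k TYPE('a)) * top = top"
    using Hk_quasi_ge_1[of k, where 'a='a] by (simp add: ennreal_mult_top)
  ultimately show ?thesis
    by (simp only: top_greatest)
next
  case False
  show ?thesis
  proof (rule Hk_norm_quasi_bound)
    have "Lp_norm 2 \<Omega> (u + v) \<le> Lp_norm 2 \<Omega> u + Lp_norm 2 \<Omega> v"
      by (rule Lp_norm_triangle) simp
    also have "\<dots> \<le> Hk_norm k \<Omega> u + Hk_norm k \<Omega> v"
      by (intro add_mono Lp_norm_le_Hk_norm)
    finally show "Lp_norm 2 \<Omega> (u + v) \<le> Hk_norm k \<Omega> u + Hk_norm k \<Omega> v" .
    fix bs :: "'a list" assume bs: "bs \<in> Hk_multi_indices k"
    interpret ext_seminorm "Lp_distr_norm 2 \<Omega>" by (rule ext_seminorm_Lp_distr_norm[OF \<Omega>]) simp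
    have fd: "fun_distr \<Omega> (u + v) \<phi> = (fun_distr \<Omega> u + fun_distr \<Omega> v) \<phi>" if "\<phi> \<in> test_functions \<Omega>" for \<phi>
      using test_function_fun_distr_add[OF \<Omega> _ _ that, of 2 2 u v] False by (simp add: top.not_eq_extremum)
    have "Lp_distr_norm 2 \<Omega> (foldr distr_deriv bs (fun_distr \<Omega> (u + v)))
        = Lp_distr_norm 2 \<Omega> (foldr distr_deriv bs (fun_distr \<Omega> u + fun_distr \<Omega> v))"
      using bs by (intro Lp_distr_norm_cong foldr_distr_deriv_cong[OF fd]) (auto simp: Hk_multi_indices_def)
    also have "\<dots> \<le> Lp_distr_norm 2 \<Omega> (foldr distr_deriv bs (fun_distr \<Omega> u)) + Lp_distr_norm 2 \<Omega> (foldr distr_deriv bs (fun_distr \<Omega> v))"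
      unfolding foldr_distr_deriv_add by (rule triangle)
    also have "\<dots> \<le> Hk_norm k \<Omega> u + Hk_norm k \<Omega> v"
      by (intro add_mono Lp_distr_norm_le_Hk_norm bs)
    finally show "Lp_distr_norm 2 \<Omega> (foldr distr_deriv bs (fun_distr \<Omega> (u + v))) \<le> Hk_norm k \<Omega> u + Hk_norm k \<Omega> v" .
  qed
qed

lemma Hk_norm_scaleR:
  fixes \<Omega> :: "'a::euclidean_space set"
  assumes \<Omega>: "\<Omega> \<in> sets lebesgue"
  shows "Hk_norm k \<Omega> (c *\<^sub>R u) \<le> ennreal (Hk_quasi k TYPE('a)) * (ennreal \<bar>c\<bar> * Hk_norm k \<Omega> u)"
proof (rule Hk_norm_quasi_bound)
  interpret L: ext_seminorm "Lp_norm 2 \<Omega>" by (rule ext_seminorm_Lp_norm) simp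
  interpret D: ext_seminorm "Lp_distr_norm 2 \<Omega>" by (rule ext_seminorm_Lp_distr_norm[OF \<Omega>]) simp
  show "Lp_norm 2 \<Omega> (c *\<^sub>R u) \<le> ennreal \<bar>c\<bar> * Hk_norm k \<Omega> u"
    unfolding L.scaleR by (intro mult_left_mono Lp_norm_le_Hk_norm) simp
  fix bs :: "'a list" assume bs: "bs \<in> Hk_multi_indices k"
  have "fun_distr \<Omega> (c *\<^sub>R u) = c *\<^sub>R fun_distr \<Omega> u"
    by (simp add: fun_eq_iff fun_distr_scaleR scaleR_fun_def[of c "fun_distr \<Omega> u"])
  then show "Lp_distr_norm 2 \<Omega> (foldr distr_deriv bs (fun_distr \<Omega> (c *\<^sub>R u))) \<le> ennreal \<bar>c\<bar> * Hk_norm k \<Omega> u"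
    unfolding foldr_distr_deriv_scaleR D.scaleR by (simp add: foldr_distr_deriv_scaleR D.scaleR mult_left_mono Lp_distr_norm_le_Hk_norm bs)
qed

lemma Hk_norm_zero: "\<Omega> \<in> sets lebesgue \<Longrightarrow> Hk_norm k \<Omega> 0 = 0"
  using Hk_norm_scaleR[of \<Omega> k 0 0] by simp

section \<open>Extension by density to the dual of \<open>H\<^sup>2\<^sub>0\<close>\<close>

definition H2_approximation :: "'a set \<Rightarrow> ('a::euclidean_space \<Rightarrow> complex) \<Rightarrow> (nat \<Rightarrow> 'a \<Rightarrow> complex) \<Rightarrow> bool"
  where "H2_approximation \<Omega> v \<phi> \<longleftrightarrow> (\<forall>n. \<phi> n \<in> test_functions \<Omega>) \<and> (\<lambda>n. Hk_norm 2 \<Omega> (v - \<phi> n)) \<longlonglongrightarrow> 0"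

lemma real_tendsto_zero_of_ennreal:
  fixes f :: "nat \<Rightarrow> real"
  assumes "\<And>n. ennreal \<bar>f n\<bar> \<le> g n" "g \<longlonglongrightarrow> 0"
  shows "f \<longlonglongrightarrow> 0"
proof -
  have "(\<lambda>n. ennreal \<bar>f n\<bar>) \<longlonglongrightarrow> 0"
    by (rule tendsto_zero_le_ennreal[OF assms(2,1)])
  then have "(\<lambda>n. \<bar>f n\<bar>) \<longlonglongrightarrow> 0"
    by (subst (asm) ennreal_tendsto_0_iff) simp_all
  then show ?thesis
    by (simp only: tendsto_rabs_zero_iff)
qed

text \<open>
  An element \<open>v\<close> of \<open>H\<^sup>2\<^sub>0\<close> is a limit of test functions \<open>\<phi> n\<close>, and the bound makes \<open>T (\<phi> n)\<close> a Cauchy sequence whose limit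
  does not depend on the approximation.  The limit defines the functional on \<open>H\<^sup>2\<^sub>0\<close>.
\<close>
lemma H_minus2_norm_le_of_test_bound:
  fixes \<Omega> :: "'a::euclidean_space set" and T :: "('a \<Rightarrow> complex) \<Rightarrow> real"
  assumes \<Omega>: "\<Omega> \<in> sets lebesgue"
    and add: "\<And>\<phi> \<psi>. \<phi> \<in> test_functions \<Omega> \<Longrightarrow> \<psi> \<in> test_functions \<Omega> \<Longrightarrow> T (\<phi> + \<psi>) = T \<phi> + T \<psi>"
    and scale: "\<And>c \<phi>. \<phi> \<in> test_functions \<Omega> \<Longrightarrow> T (c *\<^sub>R \<phi>) = c * T \<phi>"
    and C: "0 \<le> C"
    and bound: "\<And>\<phi>. \<phi> \<in> test_functions \<Omega> \<Longrightarrow> ennreal \<bar>T \<phi>\<bar> \<le> ennreal C * Hk_norm 2 \<Omega> \<phi>"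
  shows "H_minus2_norm \<Omega> T \<le> ennreal (C * Hk_quasi 2 TYPE('a))"
proof -
  let ?M = "ennreal (Hk_quasi 2 TYPE('a))"
  let ?H = "Hk_norm 2 \<Omega>"
  let ?A = "H2_approximation \<Omega>"
  have M: "?M < top"
    by simp
  have diff: "T (\<phi> - \<psi>) = T \<phi> - T \<psi>" if "\<phi> \<in> test_functions \<Omega>" "\<psi> \<in> test_functions \<Omega>" for \<phi> \<psi>
    using add[OF test_functions_diff[OF that] that(2)] by simp
  have H_rev: "?H (x - y) \<le> ?M * ?H (y - x)" for x y
    using Hk_norm_scaleR[OF \<Omega>, of 2 "-1" "y - x"] by simp
  have gap: "ennreal \<bar>T \<phi> - T \<psi>\<bar> \<le> ennreal C * (?M * (?M * ?H (v - \<phi>) + ?H (v - \<psi>)))"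
    if "\<phi> \<in> test_functions \<Omega>" "\<psi> \<in> test_functions \<Omega>" for \<phi> \<psi> v
  proof -
    have "?H (\<phi> - \<psi>) \<le> ?M * (?H (\<phi> - v) + ?H (v - \<psi>))"
      using Hk_norm_add[OF \<Omega>, of 2 "\<phi> - v" "v - \<psi>"] by simp
    also have "\<dots> \<le> ?M * (?M * ?H (v - \<phi>) + ?H (v - \<psi>))"
      by (intro mult_left_mono add_right_mono H_rev) simp
    finally have "ennreal C * ?H (\<phi> - \<psi>) \<le> ennreal C * (?M * (?M * ?H (v - \<phi>) + ?H (v - \<psi>)))"
      by (rule mult_left_mono) simp
    with bound[OF test_functions_diff[OF that]] show ?thesis
      unfolding diff[OF that] by (rule order_trans)
  qed
  have gap_tendsto: "(\<lambda>n. ennreal C * (?M * (?M * f n + g n))) \<longlonglongrightarrow> 0" if "f \<longlonglongrightarrow> 0" "g \<longlonglongrightarrow> 0" for f g :: "nat \<Rightarrow> ennreal"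
    using tendsto_add[OF tendsto_cmult_zero_ennreal[OF that(1), of ?M] that(2)] M
    by (intro tendsto_cmult_zero_ennreal) simp_all
  have unique: "l = l'" if a: "?A v \<phi>" "(\<lambda>n. T (\<phi> n)) \<longlonglongrightarrow> l" "?A v \<psi>" "(\<lambda>n. T (\<psi> n)) \<longlonglongrightarrow> l'" for v \<phi> \<psi> l l'
  proof -
    have "(\<lambda>n. T (\<phi> n) - T (\<psi> n)) \<longlonglongrightarrow> 0"
      using a(1,3) unfolding H2_approximation_def
      by (intro real_tendsto_zero_of_ennreal[OF gap gap_tendsto]) auto
    moreover have "(\<lambda>n. T (\<phi> n) - T (\<psi> n)) \<longlonglongrightarrow> l - l'"
      by (intro tendsto_diff a)
    ultimately show ?thesis
      using LIMSEQ_unique by fastforce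
  qed
  have exist: "\<exists>l. (\<lambda>n. T (\<phi> n)) \<longlonglongrightarrow> l" if a: "?A v \<phi>" for v \<phi>
  proof -
    have test: "\<phi> n \<in> test_functions \<Omega>" for n
      using a by (simp add: H2_approximation_def)
    have lim: "(\<lambda>n. ?H (v - \<phi> n)) \<longlonglongrightarrow> 0"
      using a by (simp add: H2_approximation_def)
    have "Cauchy (\<lambda>n. T (\<phi> n))"
    proof (rule metric_CauchyI)
      fix e :: real assume e: "0 < e"
      have 1: "(\<lambda>n. ennreal C * (?M * (?M * ?H (v - \<phi> n)))) \<longlonglongrightarrow> 0"
        using gap_tendsto[OF lim tendsto_const[of 0]] by simp
      have 2: "(\<lambda>n. ennreal C * (?M * ?H (v - \<phi> n))) \<longlonglongrightarrow> 0"
        using gap_tendsto[OF tendsto_const[of 0] lim] by simp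
      have "\<forall>\<^sub>F n in sequentially. ennreal C * (?M * (?M * ?H (v - \<phi> n))) < ennreal (e / 2) \<and> ennreal C * (?M * ?H (v - \<phi> n)) < ennreal (e / 2)"
        using order_tendstoD(2)[OF 1, of "ennreal (e / 2)"] order_tendstoD(2)[OF 2, of "ennreal (e / 2)"] e
        by (simp add: eventually_conj_iff)
      then obtain K where K: "\<And>n. n \<ge> K \<Longrightarrow> ennreal C * (?M * (?M * ?H (v - \<phi> n))) < ennreal (e / 2)"
        "\<And>n. n \<ge> K \<Longrightarrow> ennreal C * (?M * ?H (v - \<phi> n)) < ennreal (e / 2)"
        unfolding eventually_sequentially by blast
      have "dist (T (\<phi> i)) (T (\<phi> j)) < e" if "i \<ge> K" "j \<ge> K" for i j
      proof -
        have "ennreal \<bar>T (\<phi> i) - T (\<phi> j)\<bar> \<le> ennreal C * (?M * (?M * ?H (v - \<phi> i))) + ennreal C * (?M * ?H (v - \<phi> j))"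
          using gap[OF test test, of i j v] by (simp add: distrib_left)
        also have "\<dots> < ennreal (e / 2) + ennreal (e / 2)"
          by (intro add_strict_mono K that)
        also have "\<dots> = ennreal e"
          using e by (subst ennreal_plus[symmetric]) auto
        finally show ?thesis
          by (subst (asm) ennreal_less_iff) (simp_all add: dist_real_def)
      qed
      then show "\<exists>K. \<forall>i\<ge>K. \<forall>j\<ge>K. dist (T (\<phi> i)) (T (\<phi> j)) < e"
        by blast
    qed
    then show ?thesis
      using Cauchy_convergent_iff convergent_def by blast
  qed
  have limit_bound: "ennreal \<bar>l\<bar> \<le> ennreal C * (?M * ?H v)" if a: "?A v \<phi>" "(\<lambda>n. T (\<phi> n)) \<longlonglongrightarrow> l" for v \<phi> l
  proof -
    have test: "\<phi> n \<in> test_functions \<Omega>" for n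
      using a by (simp add: H2_approximation_def)
    have lim: "(\<lambda>n. ?H (v - \<phi> n)) \<longlonglongrightarrow> 0"
      using a by (simp add: H2_approximation_def)
    show ?thesis
    proof (rule tendsto_le)
      show "(\<lambda>n. ennreal \<bar>T (\<phi> n)\<bar>) \<longlonglongrightarrow> ennreal \<bar>l\<bar>"
        by (intro tendsto_ennrealI tendsto_rabs a)
      have "(\<lambda>n. ennreal C * (?M * ?H v) + ennreal C * (?M * (?M * ?H (v - \<phi> n)))) \<longlonglongrightarrow> ennreal C * (?M * ?H v) + 0"
        using gap_tendsto[OF lim tendsto_const[of 0]] by (intro tendsto_add tendsto_const) simp
      then show "(\<lambda>n. ennreal C * (?M * ?H v) + ennreal C * (?M * (?M * ?H (v - \<phi> n)))) \<longlonglongrightarrow> ennreal C * (?M * ?H v)"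
        by simp
      have "ennreal \<bar>T (\<phi> n)\<bar> \<le> ennreal C * (?M * ?H v) + ennreal C * (?M * (?M * ?H (v - \<phi> n)))" for n
      proof -
        have "ennreal \<bar>T (\<phi> n)\<bar> \<le> ennreal C * ?H (v + (\<phi> n - v))"
          using bound[OF test] by simp
        also have "\<dots> \<le> ennreal C * (?M * (?H v + ?M * ?H (v - \<phi> n)))"
          by (intro mult_left_mono order_trans[OF Hk_norm_add[OF \<Omega>]] add_left_mono H_rev) auto
        finally show ?thesis
          by (simp add: distrib_left)
      qed
      then show "\<forall>\<^sub>F n in sequentially. ennreal \<bar>T (\<phi> n)\<bar> \<le> ennreal C * (?M * ?H v) + ennreal C * (?M * (?M * ?H (v - \<phi> n)))"
        by simp
    qed simp
  qed
  define \<Lambda> where "\<Lambda> v = (THE l. \<exists>\<phi>. ?A v \<phi> \<and> (\<lambda>n. T (\<phi> n)) \<longlonglongrightarrow> l)" for v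
  have \<Lambda>_eq: "\<Lambda> v = l" if "?A v \<phi>" "(\<lambda>n. T (\<phi> n)) \<longlonglongrightarrow> l" for v \<phi> l
    unfolding \<Lambda>_def using that unique by (intro the_equality) blast+
  have approx: "\<exists>\<phi>. ?A v \<phi> \<and> (\<lambda>n. T (\<phi> n)) \<longlonglongrightarrow> \<Lambda> v" if "Hk0_norm 2 \<Omega> v < \<infinity>" for v
  proof -
    have "\<exists>\<phi>. ?A v \<phi>"
    proof (rule ccontr)
      assume "\<nexists>\<phi>. ?A v \<phi>"
      then have "Hk0_norm 2 \<Omega> v = \<infinity>"
        unfolding Hk0_norm_def H2_approximation_def by (simp only: if_False)
      with that show False
        by simp
    qed
    then obtain \<phi> where \<phi>: "?A v \<phi>"
      by blast
    with exist \<Lambda>_eq show ?thesis by blast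
  qed
  have approx_add: "?A (v + w) (\<lambda>n. \<phi> n + \<psi> n)" if "?A v \<phi>" "?A w \<psi>" for v w \<phi> \<psi>
  proof -
    have "(\<lambda>n. ?H (v - \<phi> n) + ?H (w - \<psi> n)) \<longlonglongrightarrow> 0"
      using tendsto_add[of "\<lambda>n. ?H (v - \<phi> n)" 0 sequentially "\<lambda>n. ?H (w - \<psi> n)" 0] that
      by (simp add: H2_approximation_def)
    then have "(\<lambda>n. ?M * (?H (v - \<phi> n) + ?H (w - \<psi> n))) \<longlonglongrightarrow> 0"
      by (rule tendsto_cmult_zero_ennreal) simp
    then have "(\<lambda>n. ?H (v + w - (\<phi> n + \<psi> n))) \<longlonglongrightarrow> 0"
      by (rule tendsto_zero_le_ennreal) (unfold add_diff_add, rule Hk_norm_add[OF \<Omega>])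
    then show ?thesis
      using that by (simp only: H2_approximation_def test_functions_add simp_thms)
  qed
  have approx_scale: "?A (c *\<^sub>R v) (\<lambda>n. c *\<^sub>R \<phi> n)" if "?A v \<phi>" for c v \<phi>
  proof -
    have "(\<lambda>n. ?M * (ennreal \<bar>c\<bar> * ?H (v - \<phi> n))) \<longlonglongrightarrow> 0"
      using that by (intro tendsto_cmult_zero_ennreal) (simp_all add: H2_approximation_def)
    then have "(\<lambda>n. ?H (c *\<^sub>R v - c *\<^sub>R \<phi> n)) \<longlonglongrightarrow> 0"
      by (rule tendsto_zero_le_ennreal) (unfold scaleR_diff_right[symmetric], rule Hk_norm_scaleR[OF \<Omega>])
    then show ?thesis
      using that by (simp only: H2_approximation_def test_functions_scaleR simp_thms)
  qed
  have \<Lambda>_test: "\<Lambda> \<phi> = T \<phi>" if "\<phi> \<in> test_functions \<Omega>" for \<phi>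
    by (rule \<Lambda>_eq[where \<phi>="\<lambda>_. \<phi>"])
      (use that in \<open>simp_all only: H2_approximation_def diff_self Hk_norm_zero[OF \<Omega>] tendsto_const simp_thms\<close>)
  have "dual_norm (Hk0_norm 2 \<Omega>) \<Lambda> \<le> ennreal (C * Hk_quasi 2 TYPE('a))"
  proof -
    have \<Lambda>_add: "\<Lambda> (x + y) = \<Lambda> x + \<Lambda> y" if fin: "Hk0_norm 2 \<Omega> x < \<infinity>" "Hk0_norm 2 \<Omega> y < \<infinity>" for x y
    proof -
      obtain \<phi> \<psi> where *: "?A x \<phi>" "(\<lambda>n. T (\<phi> n)) \<longlonglongrightarrow> \<Lambda> x" "?A y \<psi>" "(\<lambda>n. T (\<psi> n)) \<longlonglongrightarrow> \<Lambda> y"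
        using approx[OF fin(1)] approx[OF fin(2)] by blast
      have "(\<lambda>n. T (\<phi> n + \<psi> n)) \<longlonglongrightarrow> \<Lambda> x + \<Lambda> y"
        using tendsto_add[OF *(2,4)] *(1,3) by (simp only: add H2_approximation_def)
      then show ?thesis
        by (rule \<Lambda>_eq[OF approx_add[OF *(1,3)]])
    qed
    have \<Lambda>_scale: "\<Lambda> (c *\<^sub>R x) = c * \<Lambda> x" if fin: "Hk0_norm 2 \<Omega> x < \<infinity>" for c x
    proof -
      obtain \<phi> where *: "?A x \<phi>" "(\<lambda>n. T (\<phi> n)) \<longlonglongrightarrow> \<Lambda> x"
        using approx[OF fin] by blast
      have "(\<lambda>n. T (c *\<^sub>R \<phi> n)) \<longlonglongrightarrow> c * \<Lambda> x"
        using tendsto_mult_left[OF *(2)] *(1) by (simp only: scale H2_approximation_def)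
      then show ?thesis
        by (rule \<Lambda>_eq[OF approx_scale[OF *(1)]])
    qed
    have "dual_norm (Hk0_norm 2 \<Omega>) \<Lambda> = (SUP x\<in>{x. Hk0_norm 2 \<Omega> x \<le> 1}. ennreal \<bar>\<Lambda> x\<bar>)"
      unfolding dual_norm_def by (rule if_P) (intro conjI allI impI \<Lambda>_add \<Lambda>_scale)
    also have "\<dots> \<le> ennreal (C * Hk_quasi 2 TYPE('a))"
    proof (rule SUP_least)
      fix x assume "x \<in> {x. Hk0_norm 2 \<Omega> x \<le> 1}"
      then have x: "Hk0_norm 2 \<Omega> x \<le> 1"
        by simp
      then have fin: "Hk0_norm 2 \<Omega> x < \<infinity>"
        by (simp add: order_le_less_trans)
      have "?H x \<le> 1"
        using x unfolding Hk0_norm_def by (auto split: if_splits simp: top_unique)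
      obtain \<phi> where *: "?A x \<phi>" "(\<lambda>n. T (\<phi> n)) \<longlonglongrightarrow> \<Lambda> x"
        using approx[OF fin] by blast
      have "ennreal \<bar>\<Lambda> x\<bar> \<le> ennreal C * (?M * ?H x)"
        by (rule limit_bound[OF *])
      also have "\<dots> \<le> ennreal C * (?M * 1)"
        by (intro mult_left_mono) (use \<open>?H x \<le> 1\<close> in auto)
      also have "\<dots> = ennreal (C * Hk_quasi 2 TYPE('a))"
        using C Hk_quasi_ge_1[of 2, where 'a='a] by (simp add: ennreal_mult)
      finally show "ennreal \<bar>\<Lambda> x\<bar> \<le> ennreal (C * Hk_quasi 2 TYPE('a))" .
    qed
    finally show ?thesis .
  qed
  moreover have "H_minus2_norm \<Omega> T \<le> dual_norm (Hk0_norm 2 \<Omega>) \<Lambda>"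
    unfolding H_minus2_norm_def using \<Lambda>_test by (intro INF_lower) simp
  ultimately show ?thesis
    by (rule order_trans[rotated])
qed

lemma L2_norm_square:
  assumes u: "Lp_norm 2 \<Omega> u < top"
  shows "(Lp_norm 2 \<Omega> u)\<^sup>2 = ennreal (fun_distr \<Omega> u u)"
proof -
  have [measurable]: "u \<in> borel_measurable (lebesgue_on \<Omega>)"
    using u by (simp add: Lp_norm_finite_iff)
  have int: "integrable (lebesgue_on \<Omega>) (\<lambda>x. u x * cnj (u x))"
    by (rule L2_pairing_integrable[OF u u])
  have eq: "u x * cnj (u x) = of_real (cmod (u x) powr 2)" for x
    using complex_norm_square[of "u x"] by simp
  have int': "integrable (lebesgue_on \<Omega>) (\<lambda>x. cmod (u x) powr 2)"
    using integrable_Re[OF int] unfolding eq Re_complex_of_real .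
  have "fun_distr \<Omega> u u = (\<integral>x. cmod (u x) powr 2 \<partial>lebesgue_on \<Omega>)"
    unfolding fun_distr_def using integral_Re[OF int] unfolding eq Re_complex_of_real by simp
  then have "ennreal (fun_distr \<Omega> u u) = Lp_integral 2 \<Omega> u"
    using nn_integral_eq_integral[OF int'] by simp
  moreover have "(epowr y (1 / 2))\<^sup>2 = y" for y
    using epowr_half_le[of y "epowr y (1 / 2)"] le_epowr_half[of "epowr y (1 / 2)" y] by simp
  ultimately show ?thesis
    by (simp add: Lp_norm_def)
qed

text \<open>
  If \<open>g\<close> represents the same distribution as the test function \<open>h\<close>, then
  \<open>\<parallel>h\<parallel>\<^sup>2 = \<langle>h, h\<rangle> = \<langle>g, h\<rangle> \<le> \<parallel>g\<parallel> \<parallel>h\<parallel>\<close>, because \<open>h\<close> itself is an admissible test function.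
\<close>
lemma Lp_norm_le_Lp_distr_norm_test:
  assumes \<Omega>: "\<Omega> \<in> sets lebesgue" and h: "h \<in> test_functions \<Omega>" and T: "\<And>\<phi>. \<phi> \<in> test_functions \<Omega> \<Longrightarrow> fun_distr \<Omega> h \<phi> = T \<phi>"
  shows "Lp_norm 2 \<Omega> h \<le> Lp_distr_norm 2 \<Omega> T"
  unfolding Lp_distr_norm_def
proof (rule INF_greatest)
  fix g assume "g \<in> {g. \<forall>\<phi>\<in>test_functions \<Omega>. fun_distr \<Omega> g \<phi> = T \<phi>}"
  then have g: "fun_distr \<Omega> g h = fun_distr \<Omega> h h"
    using h T by simp
  have fin: "Lp_norm 2 \<Omega> h < top"
    by (rule test_functions_Lp_norm_finite[OF h \<Omega>]) simp
  show "Lp_norm 2 \<Omega> h \<le> Lp_norm 2 \<Omega> g"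
  proof (cases "Lp_norm 2 \<Omega> g = top \<or> Lp_norm 2 \<Omega> h = 0")
    case False
    obtain A B where A: "0 \<le> A" "Lp_norm 2 \<Omega> h = ennreal A" and B: "0 \<le> B" "Lp_norm 2 \<Omega> g = ennreal B"
      using False fin by (metis ennreal_cases less_irrefl)
    have "(Lp_norm 2 \<Omega> h)\<^sup>2 \<le> Lp_norm 2 \<Omega> g * Lp_norm 2 \<Omega> h"
    proof -
      have "(Lp_norm 2 \<Omega> h)\<^sup>2 = ennreal (fun_distr \<Omega> g h)"
        using L2_norm_square[OF fin] g by simp
      also have "\<dots> \<le> ennreal \<bar>fun_distr \<Omega> g h\<bar>"
        by (intro ennreal_leI) simp
      also have "\<dots> \<le> Lp_norm 2 \<Omega> g * Lp_norm 2 \<Omega> h"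
        using False fin by (intro Cauchy_Schwarz_fun_distr) (auto simp: top.not_eq_extremum)
      finally show ?thesis .
    qed
    then have "ennreal (A * A) \<le> ennreal (B * A)"
      unfolding A B power2_eq_square using A B by (simp add: ennreal_mult)
    then have "A * A \<le> B * A"
      using A B by (simp add: ennreal_le_iff)
    moreover have "A \<noteq> 0"
      using False A by auto
    ultimately have "A \<le> B"
      using A by simp
    then show ?thesis
      unfolding A B by (rule ennreal_leI)
  qed auto
qed

lemma laplacian_fun_distr: "laplacian (fun_distr \<Omega> u) \<phi> = (\<Sum>b\<in>Basis. fun_distr \<Omega> u (dir_deriv b (dir_deriv b \<phi>)))"
proof -
  have "(\<Sum>b\<in>A. distr_deriv b (distr_deriv b T)) \<phi> = (\<Sum>b\<in>A. T (dir_deriv b (dir_deriv b \<phi>)))" for A and T :: "('a \<Rightarrow> complex) \<Rightarrow> real"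
    by (induction A rule: infinite_finite_induct) (auto simp: distr_deriv_def)
  then show ?thesis
    by (simp add: laplacian_def)
qed

lemma second_derivative_L2_le_Hk:
  assumes \<Omega>: "\<Omega> \<in> sets lebesgue" and \<phi>: "\<phi> \<in> test_functions \<Omega>" and b: "b \<in> Basis"
  shows "Lp_norm 2 \<Omega> (dir_deriv b (dir_deriv b \<phi>)) \<le> Hk_norm 2 \<Omega> \<phi>"
proof -
  have "Lp_norm 2 \<Omega> (dir_deriv b (dir_deriv b \<phi>)) \<le> Lp_distr_norm 2 \<Omega> (foldr distr_deriv [b, b] (fun_distr \<Omega> \<phi>))"
  proof (rule Lp_norm_le_Lp_distr_norm_test[OF \<Omega>])
    show "dir_deriv b (dir_deriv b \<phi>) \<in> test_functions \<Omega>"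
      by (intro test_functions_dir_deriv \<phi> b)
    fix \<eta> :: "'a \<Rightarrow> complex" assume \<eta>: "\<eta> \<in> test_functions \<Omega>"
    show "fun_distr \<Omega> (dir_deriv b (dir_deriv b \<phi>)) \<eta> = foldr distr_deriv [b, b] (fun_distr \<Omega> \<phi>) \<eta>"
      using fun_distr_integration_by_parts[OF \<Omega> test_functions_dir_deriv[OF \<phi> b] \<eta> b]
        fun_distr_integration_by_parts[OF \<Omega> \<phi> test_functions_dir_deriv[OF \<eta> b] b]
      by (simp add: distr_deriv_def)
  qed
  also have "\<dots> \<le> Hk_norm 2 \<Omega> \<phi>"
    using b by (intro Lp_distr_norm_le_Hk_norm) (simp add: Hk_multi_indices_def)
  finally show ?thesis .
qed

lemma fun_distr_add_right:
  assumes "\<Omega> \<in> sets lebesgue" "1 \<le> p" "Lp_norm p \<Omega> u < top" "\<phi> \<in> test_functions \<Omega>" "\<psi> \<in> test_functions \<Omega>"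
  shows "fun_distr \<Omega> u (\<phi> + \<psi>) = fun_distr \<Omega> u \<phi> + fun_distr \<Omega> u \<psi>"
proof -
  have int: "integrable (lebesgue_on \<Omega>) (\<lambda>x. u x * cnj (\<phi> x))" if "\<phi> \<in> test_functions \<Omega>" for \<phi>
    using test_functions_bounded_supported[OF that assms(1)] integrable_pairing[OF assms(1,2) _ assms(3)] by metis
  show ?thesis
    using Bochner_Integration.integral_add[OF int[OF assms(4)] int[OF assms(5)]]
    by (simp add: fun_distr_def distrib_left)
qed

lemma H_minus2_norm_fun_distr_le:
  fixes \<Omega> :: "'a::euclidean_space set"
  assumes \<Omega>: "\<Omega> \<in> sets lebesgue" and u: "Lp_norm 2 \<Omega> u < top"
  shows "H_minus2_norm \<Omega> (fun_distr \<Omega> u) \<le> ennreal (Hk_quasi 2 TYPE('a)) * Lp_norm 2 \<Omega> u"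
proof -
  obtain A where A: "0 \<le> A" "Lp_norm 2 \<Omega> u = ennreal A"
    using u by (cases "Lp_norm 2 \<Omega> u") auto
  have "H_minus2_norm \<Omega> (fun_distr \<Omega> u) \<le> ennreal (A * Hk_quasi 2 TYPE('a))"
  proof (rule H_minus2_norm_le_of_test_bound[OF \<Omega> _ _ A(1)])
    fix \<phi> :: "'a \<Rightarrow> complex" assume \<phi>: "\<phi> \<in> test_functions \<Omega>"
    show "fun_distr \<Omega> u (\<phi> + \<psi>) = fun_distr \<Omega> u \<phi> + fun_distr \<Omega> u \<psi>" if "\<psi> \<in> test_functions \<Omega>" for \<psi>
      by (rule fun_distr_add_right[OF \<Omega> _ u \<phi> that]) simp
    show "fun_distr \<Omega> u (c *\<^sub>R \<phi>) = c * fun_distr \<Omega> u \<phi>" for c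
      by (rule fun_distr_scaleR_right)
    have "ennreal \<bar>fun_distr \<Omega> u \<phi>\<bar> \<le> ennreal A * Lp_norm 2 \<Omega> \<phi>"
      using Cauchy_Schwarz_fun_distr[OF u test_functions_Lp_norm_finite[OF \<phi> \<Omega>]] A by simp
    also have "\<dots> \<le> ennreal A * Hk_norm 2 \<Omega> \<phi>"
      by (intro mult_left_mono Lp_norm_le_Hk_norm) simp
    finally show "ennreal \<bar>fun_distr \<Omega> u \<phi>\<bar> \<le> ennreal A * Hk_norm 2 \<Omega> \<phi>" .
  qed
  then show ?thesis
    using A Hk_quasi_ge_1[of 2, where 'a='a] by (simp add: ennreal_mult mult.commute)
qed

lemma H_minus2_norm_laplacian_le:
  fixes \<Omega> :: "'a::euclidean_space set"
  assumes \<Omega>: "\<Omega> \<in> sets lebesgue" and u: "Lp_norm 2 \<Omega> u < top"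
  shows "H_minus2_norm \<Omega> (laplacian (fun_distr \<Omega> u)) \<le> ennreal (DIM('a) * Hk_quasi 2 TYPE('a)) * Lp_norm 2 \<Omega> u"
proof -
  obtain A where A: "0 \<le> A" "Lp_norm 2 \<Omega> u = ennreal A"
    using u by (cases "Lp_norm 2 \<Omega> u") auto
  have "H_minus2_norm \<Omega> (laplacian (fun_distr \<Omega> u)) \<le> ennreal (DIM('a) * A * Hk_quasi 2 TYPE('a))"
  proof (rule H_minus2_norm_le_of_test_bound[OF \<Omega>])
    show "0 \<le> DIM('a) * A"
      using A by simp
    fix \<phi> :: "'a \<Rightarrow> complex" assume \<phi>: "\<phi> \<in> test_functions \<Omega>"
    have t: "dir_deriv b (dir_deriv b \<phi>) \<in> test_functions \<Omega>" if "\<phi> \<in> test_functions \<Omega>" "b \<in> Basis" for b \<phi>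
      by (intro test_functions_dir_deriv that)
    note s = test_functions_smooth smooth_dir_deriv
    show "laplacian (fun_distr \<Omega> u) (\<phi> + \<psi>) = laplacian (fun_distr \<Omega> u) \<phi> + laplacian (fun_distr \<Omega> u) \<psi>" if \<psi>: "\<psi> \<in> test_functions \<Omega>" for \<psi>
    proof -
      have "fun_distr \<Omega> u (dir_deriv b (dir_deriv b (\<phi> + \<psi>))) = fun_distr \<Omega> u (dir_deriv b (dir_deriv b \<phi>)) + fun_distr \<Omega> u (dir_deriv b (dir_deriv b \<psi>))"
        if b: "b \<in> Basis" for b
        using fun_distr_add_right[OF \<Omega> _ u t[OF \<phi> b] t[OF \<psi> b]]
        by (simp only: dir_deriv_add[OF s(1)[OF \<phi>] s(1)[OF \<psi>]] dir_deriv_add[OF s(2)[OF s(1)[OF \<phi>] b] s(2)[OF s(1)[OF \<psi>] b]])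
      then show ?thesis
        unfolding laplacian_fun_distr by (simp only: sum.distrib cong: sum.cong)
    qed
    show "laplacian (fun_distr \<Omega> u) (c *\<^sub>R \<phi>) = c * laplacian (fun_distr \<Omega> u) \<phi>" for c
      unfolding laplacian_fun_distr sum_distrib_left
      by (rule sum.cong[OF refl])
        (simp only: dir_deriv_scaleR[OF s(1)[OF \<phi>]] dir_deriv_scaleR[OF s(2)[OF s(1)[OF \<phi>]]] fun_distr_scaleR_right)
    have "ennreal \<bar>laplacian (fun_distr \<Omega> u) \<phi>\<bar> \<le> ennreal (\<Sum>b\<in>Basis. \<bar>fun_distr \<Omega> u (dir_deriv b (dir_deriv b \<phi>))\<bar>)"
      unfolding laplacian_fun_distr by (intro ennreal_leI sum_abs)
    also have "\<dots> = (\<Sum>b\<in>Basis. ennreal \<bar>fun_distr \<Omega> u (dir_deriv b (dir_deriv b \<phi>))\<bar>)"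
      by (simp add: sum_ennreal)
    also have "\<dots> \<le> (\<Sum>b\<in>(Basis :: 'a set). ennreal A * Hk_norm 2 \<Omega> \<phi>)"
    proof (rule sum_mono)
      fix b :: 'a assume b: "b \<in> Basis"
      have "ennreal \<bar>fun_distr \<Omega> u (dir_deriv b (dir_deriv b \<phi>))\<bar> \<le> ennreal A * Lp_norm 2 \<Omega> (dir_deriv b (dir_deriv b \<phi>))"
        using Cauchy_Schwarz_fun_distr[OF u test_functions_Lp_norm_finite[OF t[OF \<phi> b] \<Omega>]] A by simp
      also have "\<dots> \<le> ennreal A * Hk_norm 2 \<Omega> \<phi>"
        by (intro mult_left_mono second_derivative_L2_le_Hk[OF \<Omega> \<phi> b]) simp
      finally show "ennreal \<bar>fun_distr \<Omega> u (dir_deriv b (dir_deriv b \<phi>))\<bar> \<le> ennreal A * Hk_norm 2 \<Omega> \<phi>" .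
    qed
    also have "\<dots> = ennreal (DIM('a) * A) * Hk_norm 2 \<Omega> \<phi>"
      using A by (simp add: ennreal_mult ennreal_of_nat_eq_real_of_nat mult.assoc)
    finally show "ennreal \<bar>laplacian (fun_distr \<Omega> u) \<phi>\<bar> \<le> ennreal (DIM('a) * A) * Hk_norm 2 \<Omega> \<phi>" .
  qed
  then show ?thesis
    using A Hk_quasi_ge_1[of 2, where 'a='a] by (simp add: ennreal_mult mult_ac)
qed

section \<open>The maps from Lebesgue spaces to distributions\<close>

lemma cmult_add_fun: "(\<lambda>x. c * (u + v) x) = (\<lambda>x. c * u x) + (\<lambda>x. c * v x)" for c :: complex
  by (simp add: fun_eq_iff distrib_left)

lemma cmult_scaleR_fun: "(\<lambda>x. c * (r *\<^sub>R u) x) = r *\<^sub>R (\<lambda>x. c * u x)" for c :: complex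
  by (simp add: fun_eq_iff scaleR_fun_def)

lemma fun_distr_zero_fun [simp]: "fun_distr \<Omega> (\<lambda>x. 0) = 0"
  by (simp add: fun_distr_def fun_eq_iff)

lemma laplacian_zero [simp]: "laplacian (0 :: ('a::euclidean_space \<Rightarrow> complex) \<Rightarrow> real) = 0"
proof -
  have "distr_deriv b (0 :: ('a \<Rightarrow> complex) \<Rightarrow> real) = 0" for b :: 'a
    by (simp add: distr_deriv_def fun_eq_iff)
  then show ?thesis
    by (simp add: laplacian_def)
qed

lemma Lp_norm_cmult_finite: "0 < p \<Longrightarrow> Lp_norm p \<Omega> u < top \<Longrightarrow> Lp_norm p \<Omega> (\<lambda>x. c * u x) < top"
  by (simp add: Lp_norm_cmult ennreal_mult_less_top)

lemma bounded_map_fun_distr: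
  fixes \<Omega> :: "'a::euclidean_space set"
  assumes \<Omega>: "\<Omega> \<in> sets lebesgue" and p: "1 \<le> p"  and q: "1 \<le> q"
    and bound: "\<And>u. Lp_norm q \<Omega> u < top \<Longrightarrow> H_minus2_plus_Lp_norm p \<Omega> (fun_distr \<Omega> u) \<le> ennreal C * Lp_norm q \<Omega> u" and C: "0 \<le> C"
  shows "bounded_map (Lp_norm q \<Omega>) (H_minus2_plus_Lp_norm p \<Omega>) (C * cmod c) (\<lambda>u. fun_distr \<Omega> (\<lambda>x. c * u x))"
proof (intro bounded_map.intro bounded_map_axioms.intro ext_seminorm_Lp_norm ext_seminorm_H_minus2_plus_Lp_norm \<Omega> p q)
  show "bounded_linear_upto (Lp_norm q \<Omega>) (H_minus2_plus_Lp_norm p \<Omega>) (C * cmod c) (\<lambda>u. fun_distr \<Omega> (\<lambda>x. c * u x))"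
    unfolding bounded_linear_upto_def
  proof (intro conjI allI impI)
    show "fun_distr \<Omega> (\<lambda>x. c * 0 x) = 0"
      by simp
    show "H_minus2_plus_Lp_norm p \<Omega> (fun_distr \<Omega> (\<lambda>x. c * (u + v) x) - (fun_distr \<Omega> (\<lambda>x. c * u x) + fun_distr \<Omega> (\<lambda>x. c * v x))) = 0"
      if "Lp_norm q \<Omega> u < \<infinity>" "Lp_norm q \<Omega> v < \<infinity>" for u v
      unfolding cmult_add_fun
      by (rule H_minus2_plus_Lp_norm_zero[OF \<Omega> p]) (use that q in \<open>simp add: test_function_fun_distr_add[OF \<Omega> q q] Lp_norm_cmult_finite\<close>)
    show "H_minus2_plus_Lp_norm p \<Omega> (fun_distr \<Omega> (\<lambda>x. c * (r *\<^sub>R u) x) - r *\<^sub>R fun_distr \<Omega> (\<lambda>x. c * u x)) = 0" for r u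
      unfolding cmult_scaleR_fun
      by (rule H_minus2_plus_Lp_norm_zero[OF \<Omega> p]) (simp add: fun_distr_scaleR scaleR_fun_def[of r "fun_distr \<Omega> (\<lambda>x. c * u x)"])
    fix u assume "Lp_norm q \<Omega> u < \<infinity>"
    then have "H_minus2_plus_Lp_norm p \<Omega> (fun_distr \<Omega> (\<lambda>x. c * u x)) \<le> ennreal C * Lp_norm q \<Omega> (\<lambda>x. c * u x)"
      using q by (intro bound Lp_norm_cmult_finite) simp_all
    also have "\<dots> = ennreal (C * cmod c) * Lp_norm q \<Omega> u"
      using q C by (simp add: Lp_norm_cmult ennreal_mult mult.assoc)
    finally show "H_minus2_plus_Lp_norm p \<Omega> (fun_distr \<Omega> (\<lambda>x. c * u x)) \<le> ennreal (C * cmod c) * Lp_norm q \<Omega> u" .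
  qed
qed

lemma bounded_map_fun_distr_L2:
  fixes \<Omega> :: "'a::euclidean_space set"
  assumes \<Omega>: "\<Omega> \<in> sets lebesgue" and p: "1 \<le> p"
  shows "bounded_map (Lp_norm 2 \<Omega>) (H_minus2_plus_Lp_norm p \<Omega>) (Hk_quasi 2 TYPE('a) * cmod c) (\<lambda>u. fun_distr \<Omega> (\<lambda>x. c * u x))"
  by (rule bounded_map_fun_distr[OF \<Omega> p])
    (use Hk_quasi_ge_1[of 2, where 'a='a] order_trans[OF H_minus2_plus_Lp_norm_le_H_minus2[OF \<Omega> p] H_minus2_norm_fun_distr_le[OF \<Omega>]] in simp_all)

lemma bounded_map_fun_distr_Lp:
  assumes \<Omega>: "\<Omega> \<in> sets lebesgue" and p: "1 \<le> p"
  shows "bounded_map (Lp_norm p \<Omega>) (H_minus2_plus_Lp_norm p \<Omega>) (1 * cmod c) (\<lambda>u. fun_distr \<Omega> (\<lambda>x. c * u x))"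
  by (rule bounded_map_fun_distr[OF \<Omega> p p])
    (use order_trans[OF H_minus2_plus_Lp_norm_le_Lp Lp_distr_norm_fun_distr_le] in simp_all)

lemma laplacian_fun_distr_add:
  assumes \<Omega>: "\<Omega> \<in> sets lebesgue" and "Lp_norm 2 \<Omega> u < top" "Lp_norm 2 \<Omega> v < top" and \<phi>: "\<phi> \<in> test_functions \<Omega>"
  shows "laplacian (fun_distr \<Omega> (u + v)) \<phi> = laplacian (fun_distr \<Omega> u) \<phi> + laplacian (fun_distr \<Omega> v) \<phi>"
proof -
  have "fun_distr \<Omega> (u + v) (dir_deriv b (dir_deriv b \<phi>)) = fun_distr \<Omega> u (dir_deriv b (dir_deriv b \<phi>)) + fun_distr \<Omega> v (dir_deriv b (dir_deriv b \<phi>))"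
    if "b \<in> Basis" for b
    by (rule test_function_fun_distr_add[OF \<Omega> _ _ _ assms(2,3)]) (use that \<phi> in \<open>simp_all add: test_functions_dir_deriv\<close>)
  then show ?thesis
    by (simp only: laplacian_fun_distr sum.distrib cong: sum.cong)
qed

lemma bounded_map_laplacian_L2:
  fixes \<Omega> :: "'a::euclidean_space set"
  assumes \<Omega>: "\<Omega> \<in> sets lebesgue" and p: "1 \<le> p"
  shows "bounded_map (Lp_norm 2 \<Omega>) (H_minus2_plus_Lp_norm p \<Omega>) (DIM('a) * Hk_quasi 2 TYPE('a) * cmod c) (\<lambda>u. laplacian (fun_distr \<Omega> (\<lambda>x. c * u x)))"
proof (intro bounded_map.intro bounded_map_axioms.intro ext_seminorm_Lp_norm ext_seminorm_H_minus2_plus_Lp_norm \<Omega> p)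
  let ?C = "DIM('a) * Hk_quasi 2 TYPE('a)"
  have C: "0 \<le> ?C"
    using Hk_quasi_ge_1[of 2, where 'a='a] by simp
  show "bounded_linear_upto (Lp_norm 2 \<Omega>) (H_minus2_plus_Lp_norm p \<Omega>) (?C * cmod c) (\<lambda>u. laplacian (fun_distr \<Omega> (\<lambda>x. c * u x)))"
    unfolding bounded_linear_upto_def
  proof (intro conjI allI impI)
    show "laplacian (fun_distr \<Omega> (\<lambda>x. c * 0 x)) = 0"
      by simp
    show "H_minus2_plus_Lp_norm p \<Omega> (laplacian (fun_distr \<Omega> (\<lambda>x. c * (u + v) x)) - (laplacian (fun_distr \<Omega> (\<lambda>x. c * u x)) + laplacian (fun_distr \<Omega> (\<lambda>x. c * v x)))) = 0"
      if "Lp_norm 2 \<Omega> u < \<infinity>" "Lp_norm 2 \<Omega> v < \<infinity>" for u v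
      unfolding cmult_add_fun
      by (rule H_minus2_plus_Lp_norm_zero[OF \<Omega> p]) (use that in \<open>simp add: laplacian_fun_distr_add[OF \<Omega>] Lp_norm_cmult_finite\<close>)
    show "H_minus2_plus_Lp_norm p \<Omega> (laplacian (fun_distr \<Omega> (\<lambda>x. c * (r *\<^sub>R u) x)) - r *\<^sub>R laplacian (fun_distr \<Omega> (\<lambda>x. c * u x))) = 0" for r u
      unfolding cmult_scaleR_fun
      by (rule H_minus2_plus_Lp_norm_zero[OF \<Omega> p])
        (simp add: laplacian_fun_distr fun_distr_scaleR scaleR_fun_def[of r "laplacian (fun_distr \<Omega> (\<lambda>x. c * u x))"] sum_distrib_left)
    fix u assume "Lp_norm 2 \<Omega> u < \<infinity>"
    then have "H_minus2_norm \<Omega> (laplacian (fun_distr \<Omega> (\<lambda>x. c * u x))) \<le> ennreal ?C * Lp_norm 2 \<Omega> (\<lambda>x. c * u x)"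
      by (intro H_minus2_norm_laplacian_le \<Omega> Lp_norm_cmult_finite) simp_all
    also have "\<dots> = ennreal (?C * cmod c) * Lp_norm 2 \<Omega> u"
      unfolding ennreal_mult[OF C norm_ge_zero] by (simp add: Lp_norm_cmult mult.assoc)
    finally show "H_minus2_plus_Lp_norm p \<Omega> (laplacian (fun_distr \<Omega> (\<lambda>x. c * u x))) \<le> ennreal (?C * cmod c) * Lp_norm 2 \<Omega> u"
      using H_minus2_plus_Lp_norm_le_H_minus2[OF \<Omega> p] order_trans by blast
  qed
qed simp

section \<open>Functions of time\<close>

lemma epowr_1 [simp]: "epowr x 1 = x"
  by (cases x) (simp_all add: epowr_def)

lemma Lr_norm_1: "Lr_norm 1 I N f = (if strongly_measurable (lebesgue_on I) N f then \<integral>\<^sup>+t. N (f t) \<partial>lebesgue_on I else \<infinity>)"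
  by (simp add: Lr_norm_def)

lemma interval_complete_measure: "complete_measure (lebesgue_on {0<..<T::real})" "complete_measure (lebesgue_on {0::real<..})"
  by (intro complete_measure_lebesgue_on; simp)+

context ext_seminorm
begin

lemma C_halfline_tendsto:
  assumes u: "u \<in> C_halfline N" and t: "0 \<le> t" and r: "\<And>n::nat. 0 \<le> r n" "r \<longlonglongrightarrow> t"
  shows "(\<lambda>n. N (u (r n) - u t)) \<longlonglongrightarrow> 0"
proof -
  have "((\<lambda>s. N (u s - u t)) \<longlongrightarrow> 0) (at t within {0..})"
    using u t by (simp add: C_halfline_def)
  then have "continuous (at t within {0..}) (\<lambda>s. N (u s - u t))"
    by (simp add: continuous_within)
  from continuous_within_tendsto_compose[OF this _ r(2)] r(1)
  show ?thesis
    by simp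
qed

text \<open>
  The step functions are \<open>u\<close> evaluated at time rounded down to a multiple of \<open>1 / (n + 1)\<close>.
\<close>
lemma strongly_measurable_C_halfline:
  assumes u: "u \<in> C_halfline N"
  shows "strongly_measurable (lebesgue_on {0<..<T}) N u"
  unfolding strongly_measurable_def
proof (intro exI conjI allI ballI AE_I2)
  define r where "r n t = real_of_int \<lfloor>real (Suc n) * t\<rfloor> / real (Suc n)" for n and t :: real
  fix n t
  show "simple_function (lebesgue_on {0<..<T}) (\<lambda>t. u (r n t))"
  proof (rule simple_function_compose1[where g=u])
    have "(\<lambda>t. real_of_int \<lfloor>real (Suc n) * t\<rfloor> / real (Suc n)) \<in> borel_measurable borel"
      by measurable
    then have meas: "(\<lambda>t. r n t) \<in> borel_measurable (lebesgue_on {0<..<T})"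
      unfolding r_def by (intro measurable_restrict_space1 measurable_completion) simp
    have "r n ` {0<..<T} \<subseteq> (\<lambda>k. real_of_int k / real (Suc n)) ` {0..\<lfloor>real (Suc n) * T\<rfloor>}"
      unfolding r_def by (intro image_subsetI imageI) (auto intro!: floor_mono mult_left_mono simp del: of_nat_Suc)
    then have "finite (r n ` {0<..<T})"
      by (rule finite_subset) simp
    then show "simple_function (lebesgue_on {0<..<T}) (r n)"
      using meas by (intro simple_function_borel_measurable) simp_all
  qed
  assume "t \<in> space (lebesgue_on {0<..<T})"
  then have t: "0 < t"
    by simp
  have r0: "0 \<le> r n t" for n
    using t by (simp add: r_def)
  show "N (u (r n t)) < \<infinity>"
    using u r0[of n] unfolding C_halfline_def by blast
  have "(\<lambda>n. r n t) \<longlonglongrightarrow> t"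
  proof (rule tendsto_sandwich)
    have "(real (Suc n) * t - 1) / real (Suc n) \<le> r n t" "r n t \<le> real (Suc n) * t / real (Suc n)" for n
      unfolding r_def by (intro divide_right_mono; linarith)+
    then have "t - 1 / real (Suc n) \<le> r n t" "r n t \<le> t" for n
      by (simp_all add: diff_divide_distrib del: of_nat_Suc)
    then show "\<forall>\<^sub>F n in sequentially. t - 1 / real (Suc n) \<le> r n t" "\<forall>\<^sub>F n in sequentially. r n t \<le> t"
      by simp_all
    show "(\<lambda>n. t - 1 / real (Suc n)) \<longlonglongrightarrow> t"
      using tendsto_diff[OF tendsto_const LIMSEQ_inverse_real_of_nat, of t] by (simp add: inverse_eq_divide)
  qed simp
  from C_halfline_tendsto[OF u less_imp_le[OF t] r0 this]
  show "(\<lambda>n. N (u t - u (r n t))) \<longlonglongrightarrow> 0"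
    by (simp only: tendsto_commute)
qed

lemma C_halfline_bounded:
  assumes u: "u \<in> C_halfline N" and T: "0 < T"
  obtains B where "B < top" "\<And>t. 0 \<le> t \<Longrightarrow> t \<le> T \<Longrightarrow> N (u t) \<le> B"
proof -
  have "continuous_on {0..T} (\<lambda>t. N (u t))"
    unfolding continuous_on_def
  proof
    fix t assume t: "t \<in> {0..T}"
    then have "((\<lambda>s. N (u s - u t)) \<longlongrightarrow> 0) (at t within {0..})"
      using u by (simp add: C_halfline_def)
    then have "((\<lambda>s. N (u s - u t)) \<longlongrightarrow> 0) (at t within {0..T})"
      by (rule tendsto_within_subset) auto
    then show "((\<lambda>s. N (u s)) \<longlongrightarrow> N (u t)) (at t within {0..T})"
      by (rule tendsto)
  qed
  then obtain t where t: "t \<in> {0..T}" "\<forall>s\<in>{0..T}. N (u s) \<le> N (u t)"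
    using continuous_attains_sup[of "{0..T}" "\<lambda>t. N (u t)"] T by auto
  moreover have "N (u t) < top"
    using u t by (simp add: C_halfline_def)
  ultimately show thesis
    by (intro that) auto
qed

lemma C_halfline_Lr_loc:
  assumes u: "u \<in> C_halfline N"
  shows "u \<in> Lr_loc 1 N"
  unfolding Lr_loc_def
proof (intro CollectI allI impI)
  fix T :: real assume T: "0 < T"
  obtain B where B: "B < top" "\<And>t. 0 \<le> t \<Longrightarrow> t \<le> T \<Longrightarrow> N (u t) \<le> B"
    using C_halfline_bounded[OF u T] by blast
  have "(\<integral>\<^sup>+t. N (u t) \<partial>lebesgue_on {0<..<T}) \<le> (\<integral>\<^sup>+t. B \<partial>lebesgue_on {0<..<T})"
    by (rule nn_integral_mono) (simp add: B(2))
  also have "\<dots> < top"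
    using B(1) T by (simp add: ennreal_mult_less_top emeasure_restrict_space)
  finally show "Lr_norm 1 {0<..<T} N u < \<infinity>"
    by (simp add: Lr_norm_1 strongly_measurable_C_halfline[OF u])
qed

lemma Lr_norm_1_le_SUP:
  assumes "u \<in> C_halfline N" "v \<in> C_halfline N" "0 < T"
  shows "Lr_norm 1 {0<..<T} N (\<lambda>t. u t - v t) \<le> ennreal T * (SUP t\<in>{0..T}. N (u t - v t))"
proof -
  have "(\<integral>\<^sup>+t. N (u t - v t) \<partial>lebesgue_on {0<..<T}) \<le> (\<integral>\<^sup>+t. (SUP t\<in>{0..T}. N (u t - v t)) \<partial>lebesgue_on {0<..<T})"
    by (rule nn_integral_mono) (auto intro!: SUP_upper)
  also have "\<dots> = ennreal T * (SUP t\<in>{0..T}. N (u t - v t))"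
    using assms(3) by (simp add: emeasure_restrict_space mult.commute)
  finally show ?thesis
    by (simp add: Lr_norm_1 strongly_measurable_diff strongly_measurable_C_halfline assms)
qed

end

lemma borel_measurable_lebesgue_on_borel:
  "f \<in> borel_measurable borel \<Longrightarrow> f \<in> borel_measurable (lebesgue_on S)"
  by (intro measurable_restrict_space1 measurable_completion) simp

lemma AE_lebesgue_on_iff:
  "S \<in> sets lebesgue \<Longrightarrow> (AE x in lebesgue_on S. P x) \<longleftrightarrow> (AE x in lebesgue. x \<in> S \<longrightarrow> P x)"
  by (simp add: AE_restrict_space_iff)

text \<open>
  The two kinds of intervals that carry weak derivatives.  A compact subset of either lies in some \<open>(0, R)\<close> inside
  the interval, where local integrability up to time 0 can be used.
\<close>
definition time_interval :: "real set \<Rightarrow> bool"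
  where "time_interval I \<longleftrightarrow> I = {0<..} \<or> (\<exists>T>0. I = {0<..<T})"

lemma time_interval_sets: "time_interval I \<Longrightarrow> I \<in> sets lebesgue"
  by (auto simp: time_interval_def)

lemma time_interval_subset: "time_interval I \<Longrightarrow> I \<subseteq> {0<..}"
  by (auto simp: time_interval_def)

lemma time_interval_cutoff:
  assumes I: "time_interval I" and K: "compact K" "K \<subseteq> I"
  obtains R where "0 < R" "K \<subseteq> {0<..<R}" "{0<..<R} \<subseteq> I"
proof -
  obtain b where b: "\<And>t. t \<in> K \<Longrightarrow> t \<le> b"
    using compact_imp_bounded[OF K(1)] unfolding bounded_real by (meson abs_le_D1)
  show thesis
  proof (cases "I = {0<..}")
    case True
    then show thesis
      using K b by (intro that[of "max 1 (b + 1)"]) (force simp: less_max_iff_disj)+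
  next
    case False
    then obtain T where "0 < T" "I = {0<..<T}"
      using I unfolding time_interval_def by blast
    then show thesis
      using K by (intro that[of T]) auto
  qed
qed

lemma test_function_time_cutoff:
  fixes \<psi> :: "real \<Rightarrow> real"
  assumes I: "time_interval I" and \<psi>: "\<psi> \<in> test_functions I"
  obtains R B where "0 < R" "{0<..<R} \<subseteq> I" "\<forall>t. t \<notin> {0<..<R} \<longrightarrow> \<psi> t = 0" "\<psi> \<in> borel_measurable borel"
    "\<forall>t. \<bar>\<psi> t\<bar> \<le> B"
proof -
  obtain K where K: "smooth \<psi>" "compact K" "K \<subseteq> I" "\<forall>x. x \<notin> K \<longrightarrow> \<psi> x = 0"
    using \<psi> by (rule test_functionsE)
  obtain R where R: "0 < R" "K \<subseteq> {0<..<R}" "{0<..<R} \<subseteq> I"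
    using time_interval_cutoff[OF I K(2,3)] .
  have "bounded (\<psi> ` K)"
    by (intro compact_imp_bounded compact_continuous_image smooth_continuous_on K)
  then obtain B where B: "0 < B" "\<forall>x\<in>K. \<bar>\<psi> x\<bar> \<le> B"
    unfolding bounded_pos by auto
  have "\<bar>\<psi> x\<bar> \<le> B" for x
    using B K(4) by (cases "x \<in> K") auto
  moreover have "\<psi> \<in> borel_measurable borel"
    by (intro borel_measurable_continuous_onI smooth_continuous_on K)
  ultimately show thesis
    using R K(4) by (intro that[of R B]) auto
qed

context ext_seminorm
begin

text \<open>
  Local integrability provides step functions on \<open>(0, R)\<close> only.  Extended by zero and multiplied by step functions that
  approximate \<open>\<psi>\<close> and vanish where \<open>\<psi>\<close> does, they approximate \<open>\<psi> w\<close> on all of \<open>I\<close>.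
\<close>
lemma strongly_measurable_cutoff_scaleR:
  fixes R :: real
  assumes w: "strongly_measurable (lebesgue_on {0<..<R}) N w"
    and \<psi>: "\<psi> \<in> borel_measurable borel" "\<forall>t. t \<notin> {0<..<R} \<longrightarrow> \<psi> t = 0"
    and I: "{0<..<R} \<subseteq> I" "I \<in> sets lebesgue"
  shows "strongly_measurable (lebesgue_on I) N (\<lambda>t. \<psi> t *\<^sub>R w t)"
proof -
  obtain s where s_simple: "\<And>n::nat. simple_function (lebesgue_on {0<..<R}) (s n)"
    and s_fin: "\<And>n t. t \<in> space (lebesgue_on {0<..<R}) \<Longrightarrow> N (s n t) < \<infinity>"
    and lim: "AE t in lebesgue_on {0<..<R}. (\<lambda>n. N (w t - s n t)) \<longlonglongrightarrow> 0"
    using w unfolding strongly_measurable_def by blast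
  have s: "simple_function (lebesgue_on {0<..<R}) (s n)" "t \<in> {0<..<R} \<Longrightarrow> N (s n t) < \<infinity>" for n t
    using s_simple s_fin[of t n] by simp_all
  obtain F where F_simple: "\<forall>n::nat. simple_function (lebesgue_on I) (F n)"
    and F_lim: "\<forall>t\<in>space (lebesgue_on I). (\<lambda>n. F n t) \<longlonglongrightarrow> \<psi> t"
    and F_le: "\<forall>n. \<forall>t\<in>space (lebesgue_on I). dist (F n t) 0 \<le> 2 * dist (\<psi> t) 0"
    using borel_measurable_implies_sequence_metric[OF borel_measurable_lebesgue_on_borel[OF \<psi>(1), of I], of 0]
    by blast
  have F: "simple_function (lebesgue_on I) (F n)" "t \<in> I \<Longrightarrow> (\<lambda>n. F n t) \<longlonglongrightarrow> \<psi> t"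
    "t \<in> I \<Longrightarrow> \<bar>F n t\<bar> \<le> 2 * \<bar>\<psi> t\<bar>" for n t
    using F_simple F_lim F_le by (simp_all add: dist_real_def)
  define r where "r n t = (if t \<in> {0<..<R} then s n t else 0)" for n t
  have r_simple: "simple_function (lebesgue_on I) (r n)" for n
  proof -
    have fin: "finite (s n ` {0<..<R})" and meas: "s n -` {y} \<inter> {0<..<R} \<in> sets (lebesgue_on {0<..<R})" for y
      using s(1)[of n] simple_functionD(2)[OF s(1), of n "{y}"] by (auto simp: simple_function_def)
    have "r n ` I \<subseteq> insert 0 (s n ` {0<..<R})"
      by (auto simp: r_def)
    then have "finite (r n ` I)"
      by (rule finite_subset) (simp add: fin)
    moreover have "r n -` {y} \<inter> I \<in> sets (lebesgue_on I)" for y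
    proof -
      have "s n -` {y} \<inter> {0<..<R} \<in> sets lebesgue"
        using meas[of y] by (simp add: sets_restrict_space_iff)
      moreover have "I - {0<..<R} \<in> sets lebesgue"
        using I by auto
      moreover have "r n -` {y} \<inter> I = (s n -` {y} \<inter> {0<..<R}) \<union> (if y = 0 then I - {0<..<R} else {})"
        using I(1) by (auto simp: r_def split: if_splits)
      ultimately have "r n -` {y} \<inter> I \<in> sets lebesgue"
        by auto
      then show ?thesis
        using I(2) by (auto simp: sets_restrict_space)
    qed
    ultimately show ?thesis
      by (simp add: simple_function_def)
  qed
  have prod: "simple_function (lebesgue_on I) (\<lambda>t. F n t *\<^sub>R r n t)" for n
    by (rule simple_function_compose2[OF F(1) r_simple])
  have rfin: "N (r n t) < top" for n t
    using s(2) by (simp add: r_def)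
  have fin: "AE t in lebesgue_on {0<..<R}. N (w t) < \<infinity>"
    by (rule strongly_measurable_AE_finite[OF w])
  have "AE t in lebesgue_on I. (\<lambda>n. N (\<psi> t *\<^sub>R w t - F n t *\<^sub>R r n t)) \<longlonglongrightarrow> 0"
    unfolding AE_lebesgue_on_iff[OF I(2)]
    using lim fin unfolding AE_lebesgue_on_iff[of "{0<..<R}", simplified]
  proof eventually_elim
    case (elim t)
    show ?case
    proof
      assume t: "t \<in> I"
      show "(\<lambda>n. N (\<psi> t *\<^sub>R w t - F n t *\<^sub>R r n t)) \<longlonglongrightarrow> 0"
      proof (cases "t \<in> {0<..<R}")
        case True
        have 1: "(\<lambda>n. N (w t - s n t)) \<longlonglongrightarrow> 0" and 2: "N (w t) < top"
          using elim True by auto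
        have 3: "(\<lambda>n. N (s n t)) \<longlonglongrightarrow> N (w t)"
          by (rule tendsto[OF tendsto_commute[THEN iffD1, OF 1]])
        have "(\<lambda>n. \<bar>\<psi> t - F n t\<bar>) \<longlonglongrightarrow> 0"
          using tendsto_rabs[OF tendsto_diff[OF tendsto_const F(2)[OF t], of "\<psi> t"]] by simp
        then have 4: "(\<lambda>n. ennreal \<bar>\<psi> t - F n t\<bar>) \<longlonglongrightarrow> 0"
          by (subst ennreal_tendsto_0_iff) auto
        have "(\<lambda>n. ennreal \<bar>\<psi> t\<bar> * N (w t - s n t) + ennreal \<bar>\<psi> t - F n t\<bar> * N (s n t)) \<longlonglongrightarrow> 0 + 0 * N (w t)"
          using 2 by (intro tendsto_add tendsto_cmult_zero_ennreal 1 tendsto_mult_ennreal 3 4) auto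
        then have "(\<lambda>n. ennreal \<bar>\<psi> t\<bar> * N (w t - s n t) + ennreal \<bar>\<psi> t - F n t\<bar> * N (s n t)) \<longlonglongrightarrow> 0"
          by simp
        then show ?thesis
        proof (rule tendsto_zero_le_ennreal)
          fix n
          have "\<psi> t *\<^sub>R w t - F n t *\<^sub>R r n t = \<psi> t *\<^sub>R (w t - s n t) + (\<psi> t - F n t) *\<^sub>R s n t"
            using True by (simp add: r_def scaleR_diff_right scaleR_diff_left)
          then show "N (\<psi> t *\<^sub>R w t - F n t *\<^sub>R r n t) \<le> ennreal \<bar>\<psi> t\<bar> * N (w t - s n t) + ennreal \<bar>\<psi> t - F n t\<bar> * N (s n t)"
            using triangle[of "\<psi> t *\<^sub>R (w t - s n t)" "(\<psi> t - F n t) *\<^sub>R s n t"] by (simp only: scaleR)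
        qed
      next
        case False
        then have "\<psi> t = 0" "F n t = 0" for n
          using \<psi>(2) F(3)[OF t, of n] by auto
        then show ?thesis
          by simp
      qed
    qed
  qed
  then show ?thesis
    unfolding strongly_measurable_def using prod rfin
    by (intro exI[of _ "\<lambda>n t. F n t *\<^sub>R r n t"]) (simp add: scaleR_finite)
qed

lemma nn_integral_cutoff_scaleR_le:
  fixes R :: real
  assumes w: "strongly_measurable (lebesgue_on {0<..<R}) N w"
    and \<psi>: "\<forall>t. t \<notin> {0<..<R} \<longrightarrow> \<psi> t = 0" "\<forall>t. \<bar>\<psi> t\<bar> \<le> B"
    and I: "{0<..<R} \<subseteq> I" "I \<in> sets lebesgue"
  shows "(\<integral>\<^sup>+t. N (\<psi> t *\<^sub>R w t) \<partial>lebesgue_on I) \<le> ennreal B * (\<integral>\<^sup>+t. N (w t) \<partial>lebesgue_on {0<..<R})"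
proof -
  have "(\<integral>\<^sup>+t. N (\<psi> t *\<^sub>R w t) \<partial>lebesgue_on I) = (\<integral>\<^sup>+t. N (\<psi> t *\<^sub>R w t) * indicator I t \<partial>lebesgue)"
    using I by (intro nn_integral_restrict_space) simp
  also have "\<dots> \<le> (\<integral>\<^sup>+t. ennreal B * N (w t) * indicator {0<..<R} t \<partial>lebesgue)"
  proof (rule nn_integral_mono)
    fix t
    have "ennreal \<bar>\<psi> t\<bar> * N (w t) \<le> ennreal B * N (w t)"
      using \<psi>(2) by (intro mult_right_mono ennreal_leI) auto
    then show "N (\<psi> t *\<^sub>R w t) * indicator I t \<le> ennreal B * N (w t) * indicator {0<..<R} t"
      using \<psi>(1) by (auto simp: scaleR indicator_def)
  qed
  also have "\<dots> = (\<integral>\<^sup>+t. ennreal B * N (w t) \<partial>lebesgue_on {0<..<R})"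
    by (rule nn_integral_restrict_space[symmetric]) auto
  also have "\<dots> = ennreal B * (\<integral>\<^sup>+t. N (w t) \<partial>lebesgue_on {0<..<R})"
    by (intro nn_integral_cmult borel_measurable_norm interval_complete_measure w)
  finally show ?thesis .
qed

lemma ex_has_bochner_integral_in_test:
  assumes N: "complete_norm N" and w: "w \<in> Lr_loc 1 N" and I: "time_interval I" and \<psi>: "\<psi> \<in> test_functions I"
  shows "\<exists>x. has_bochner_integral_in (lebesgue_on I) N (\<lambda>t. \<psi> t *\<^sub>R w t) x"
proof -
  obtain R B where R: "0 < R" "{0<..<R} \<subseteq> I" "\<forall>t. t \<notin> {0<..<R} \<longrightarrow> \<psi> t = 0" "\<psi> \<in> borel_measurable borel" "\<forall>t. \<bar>\<psi> t\<bar> \<le> B"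
    using test_function_time_cutoff[OF I \<psi>] by metis
  have "Lr_norm 1 {0<..<R} N w < \<infinity>"
    using w R(1) by (simp add: Lr_loc_def)
  then have sm: "strongly_measurable (lebesgue_on {0<..<R}) N w" and fin: "(\<integral>\<^sup>+t. N (w t) \<partial>lebesgue_on {0<..<R}) < top"
    by (simp_all add: Lr_norm_1 split: if_splits)
  note I' = time_interval_sets[OF I]
  show ?thesis
  proof (rule ex_has_bochner_integral_in[OF complete_measure_lebesgue_on[OF I'] N])
    show "strongly_measurable (lebesgue_on I) N (\<lambda>t. \<psi> t *\<^sub>R w t)"
      by (rule strongly_measurable_cutoff_scaleR[OF sm R(4,3,2) I'])
    show "(\<integral>\<^sup>+t. N (\<psi> t *\<^sub>R w t) \<partial>lebesgue_on I) < \<infinity>"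
      using nn_integral_cutoff_scaleR_le[OF sm R(3,5,2) I'] fin
      by (simp add: ennreal_mult_less_top order_le_less_trans)
  qed
qed

end

lemma (in bounded_map) has_bochner_integral_in_image_scaleR:
  assumes M: "complete_measure M" and f: "has_bochner_integral_in M N (\<lambda>t. \<psi> t *\<^sub>R w t) x"
  shows "has_bochner_integral_in M N' (\<lambda>t. \<psi> t *\<^sub>R L (w t)) (L x)"
proof (rule N'.has_bochner_integral_in_cong[OF has_bochner_integral_in_image[OF M f]])
  have "AE t in M. N (\<psi> t *\<^sub>R w t) < \<infinity>"
    using f by (intro N.strongly_measurable_AE_finite) (simp add: has_bochner_integral_in_def)
  then show "AE t in M. N' (L (\<psi> t *\<^sub>R w t) - \<psi> t *\<^sub>R L (w t)) = 0"
  proof eventually_elim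
    case (elim t)
    show ?case
    proof (cases "\<psi> t = 0")
      case False
      then have "N (w t) = N ((1 / \<psi> t) *\<^sub>R (\<psi> t *\<^sub>R w t))"
        by simp
      also have "\<dots> < top"
        using elim by (intro N.scaleR_finite[of "\<psi> t *\<^sub>R w t"]) simp
      finally show ?thesis
        by (rule scale)
    qed simp
  qed
qed simp

lemma lebesgue_integral_on_support:
  fixes h :: "real \<Rightarrow> real"
  assumes "I \<subseteq> J" "I \<in> sets lebesgue" "J \<in> sets lebesgue" "\<And>t. t \<notin> I \<Longrightarrow> h t = 0"
  shows "(\<integral>t. h t \<partial>lebesgue_on J) = (\<integral>t. h t \<partial>lebesgue_on I)"
proof -
  have "(\<lambda>t. indicator J t *\<^sub>R h t) = (\<lambda>t. indicator I t *\<^sub>R h t)"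
    using assms(1,4) by (auto simp: fun_eq_iff indicator_def)
  then show ?thesis
    using assms(2,3) by (simp add: integral_restrict_space)
qed

text \<open>
  Testing with a product separates the variables: the time integral is taken first, as a Bochner integral.
\<close>
lemma spacetime_distr_tensor:
  assumes \<Omega>: "\<Omega> \<in> sets lebesgue" and q: "1 \<le> q" and I: "time_interval I"
    and \<psi>: "\<psi> \<in> test_functions I" and \<phi>: "\<phi> \<in> test_functions \<Omega>"
    and w: "has_bochner_integral_in (lebesgue_on I) (Lp_norm q \<Omega>) (\<lambda>t. \<psi> t *\<^sub>R w t) X"
  shows "spacetime_distr \<Omega> w (tensor \<psi> \<phi>) = fun_distr \<Omega> X \<phi>"
proof -
  obtain B K where "bounded_supported \<Omega> B K \<phi>"
    using \<phi> \<Omega> by (rule test_functions_bounded_supported)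
  then interpret bounded_map "Lp_norm q \<Omega>" "\<lambda>r::real. ennreal \<bar>r\<bar>" "B * (measure lebesgue K + 1)" "\<lambda>u. fun_distr \<Omega> u \<phi>"
    by (rule bounded_map_fun_distr_apply[OF \<Omega> q])
  have M: "complete_measure (lebesgue_on I)"
    by (rule complete_measure_lebesgue_on[OF time_interval_sets[OF I]])
  have "has_bochner_integral (lebesgue_on I) (\<lambda>t. \<psi> t *\<^sub>R fun_distr \<Omega> (w t) \<phi>) (fun_distr \<Omega> X \<phi>)"
    by (rule has_bochner_integral_in_real[OF M has_bochner_integral_in_image_scaleR[OF M w]])
  then have 1: "(\<integral>t. \<psi> t *\<^sub>R fun_distr \<Omega> (w t) \<phi> \<partial>lebesgue_on I) = fun_distr \<Omega> X \<phi>"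
    by (rule has_bochner_integral_integral_eq)
  have "(\<lambda>x. tensor \<psi> \<phi> (t, x)) = \<psi> t *\<^sub>R \<phi>" for t
    by (simp add: tensor_def scaleR_fun_def)
  then have "spacetime_distr \<Omega> w (tensor \<psi> \<phi>) = (\<integral>t. \<psi> t *\<^sub>R fun_distr \<Omega> (w t) \<phi> \<partial>lebesgue_on {0<..})"
    by (simp add: spacetime_distr_def fun_distr_scaleR_right)
  also have "\<dots> = (\<integral>t. \<psi> t *\<^sub>R fun_distr \<Omega> (w t) \<phi> \<partial>lebesgue_on I)"
  proof (rule lebesgue_integral_on_support[OF time_interval_subset[OF I] time_interval_sets[OF I]])
    obtain K where "\<forall>x. x \<notin> K \<longrightarrow> \<psi> x = 0" "K \<subseteq> I"
      using \<psi> by (rule test_functionsE)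
    then show "\<psi> t *\<^sub>R fun_distr \<Omega> (w t) \<phi> = 0" if "t \<notin> I" for t
      using that by auto
  qed simp
  finally show ?thesis
    using 1 by simp
qed

lemma tensor_cmult: "(\<lambda>z. c * tensor \<psi> \<phi> z) = tensor \<psi> (\<lambda>x. c * \<phi> x)"
  by (simp add: tensor_def fun_eq_iff)

lemma spacetime_laplacian_eq:
  "spacetime_laplacian T \<Phi> = (\<Sum>b\<in>Basis. T (dir_deriv (0, b) (dir_deriv (0, b) \<Phi>)))"
proof -
  have "(\<Sum>b\<in>A. distr_deriv (0, b) (distr_deriv (0, b) T)) \<Phi> = (\<Sum>b\<in>A. T (dir_deriv (0, b) (dir_deriv (0, b) \<Phi>)))" for A
    by (induction A rule: infinite_finite_induct) (auto simp: distr_deriv_def)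
  then show ?thesis
    by (simp add: spacetime_laplacian_def)
qed

lemma solves_in_distributions_iff:
  "solves_in_distributions \<Omega> \<theta> m a \<gamma> g u \<longleftrightarrow> (\<forall>\<Phi>\<in>test_functions ({0<..} \<times> \<Omega>).
    - spacetime_distr \<Omega> u (dir_deriv (1, 0) (\<lambda>z. cnj (exp (- \<i> * of_real \<theta>)) * \<Phi> z))
    - (\<Sum>b\<in>Basis. spacetime_distr \<Omega> u (dir_deriv (0, b) (dir_deriv (0, b) \<Phi>)))
    + spacetime_distr \<Omega> (\<lambda>t x. power_nonlinearity m (u t x)) (\<lambda>z. cnj a * \<Phi> z)
    + spacetime_distr \<Omega> u (\<lambda>z. cnj \<gamma> * \<Phi> z) = spacetime_distr \<Omega> g \<Phi>)"
  unfolding solves_in_distributions_def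
  by (simp add: spacetime_laplacian_eq spacetime_dt_def distr_cmul_def distr_deriv_def)

lemma laplacian_cmult_test:
  assumes "\<phi> \<in> test_functions \<Omega>"
  shows "(\<Sum>b\<in>Basis. fun_distr \<Omega> u (dir_deriv b (dir_deriv b (\<lambda>x. cnj c * \<phi> x)))) = laplacian (fun_distr \<Omega> (\<lambda>x. c * u x)) \<phi>"
  unfolding laplacian_fun_distr
proof (rule sum.cong[OF refl])
  fix b :: 'a assume b: "b \<in> Basis"
  note s = test_functions_smooth[OF assms]
  have "dir_deriv b (dir_deriv b (\<lambda>x. cnj c * \<phi> x)) = (\<lambda>x. cnj c * dir_deriv b (dir_deriv b \<phi>) x)"
    by (simp only: dir_deriv_cmult[OF s] dir_deriv_cmult[OF smooth_dir_deriv[OF s b]])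
  then show "fun_distr \<Omega> u (dir_deriv b (dir_deriv b (\<lambda>x. cnj c * \<phi> x))) = fun_distr \<Omega> (\<lambda>x. c * u x) (dir_deriv b (dir_deriv b \<phi>))"
    by (simp flip: distr_cmul_fun_distr add: distr_cmul_def)
qed

section \<open>The time derivative of a solution\<close>

text \<open>
  The right-hand side of the equation solved for the time derivative, when \<open>c = exp (i \<theta>)\<close>; for \<open>c = 1\<close> it is
  \<open>exp (- i \<theta>)\<close> times that derivative.  The factors are written inside \<open>fun_distr\<close> so that each summand is the image of
  \<open>u t\<close>, \<open>f t\<close> or the nonlinearity under one of the bounded maps above.
\<close>
definition equation_velocity ::
    "'a set \<Rightarrow> real \<Rightarrow> complex \<Rightarrow> complex \<Rightarrow> complex \<Rightarrow> (real \<Rightarrow> 'a::euclidean_space \<Rightarrow> complex) \<Rightarrow>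
     (real \<Rightarrow> 'a \<Rightarrow> complex) \<Rightarrow> real \<Rightarrow> ('a \<Rightarrow> complex) \<Rightarrow> real"
  where "equation_velocity \<Omega> m a \<gamma> c f u t =
    laplacian (fun_distr \<Omega> (\<lambda>x. c * u t x)) + fun_distr \<Omega> (\<lambda>x. c * f t x)
    + (fun_distr \<Omega> (\<lambda>x. - (c * \<gamma>) * u t x) + fun_distr \<Omega> (\<lambda>x. - (c * a) * power_nonlinearity m (u t x)))"

lemma fun_distr_cnj_cmult: "fun_distr \<Omega> u (\<lambda>x. cnj c * \<phi> x) = fun_distr \<Omega> (\<lambda>x. c * u x) \<phi>"
  by (simp flip: distr_cmul_fun_distr add: distr_cmul_def)

lemma fun_distr_uminus: "fun_distr \<Omega> (\<lambda>x. - u x) \<phi> = - fun_distr \<Omega> u \<phi>"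
  by (simp add: fun_distr_def)

lemma test_functions_mono: "I \<subseteq> J \<Longrightarrow> \<psi> \<in> test_functions I \<Longrightarrow> \<psi> \<in> test_functions J"
  by (auto simp: test_functions_def)

text \<open>
  The integrals \<open>U'\<close>, \<open>U\<close>, \<open>F\<close>, \<open>G\<close> of \<open>\<psi>' u\<close>, \<open>\<psi> u\<close>, \<open>\<psi> f\<close>, \<open>\<psi> g(u)\<close> exist in Lebesgue spaces.  The equation tested with
  \<open>\<psi>(t) \<eta>(x)\<close> is a relation between them, which says that the integral \<open>V\<close> of \<open>\<psi>\<close> times the velocity and \<open>- U'\<close> agree on
  test functions, and hence in \<open>H\<^sup>-\<^sup>2 + L\<^sup>2\<^sup>/\<^sup>m\<close>.
\<close>
lemma has_weak_deriv_equation_velocity: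
  fixes \<Omega> :: "'a::euclidean_space set"
  assumes \<Omega>: "\<Omega> \<in> sets lebesgue" and m: "0 < m" "m \<le> 1" and I: "time_interval I"
    and u: "u \<in> Lr_loc 1 (Lp_norm 2 \<Omega>)" and f: "f \<in> Lr_loc 1 (Lp_norm 2 \<Omega>)"
    and g: "(\<lambda>t x. power_nonlinearity m (u t x)) \<in> Lr_loc 1 (Lp_norm (2 / m) \<Omega>)"
    and sol: "solves_in_distributions \<Omega> \<theta> m a \<gamma> f u"
  shows "has_weak_deriv I (H_minus2_plus_Lp_norm (2 / m) \<Omega>) (\<lambda>t. fun_distr \<Omega> (u t))
    (equation_velocity \<Omega> m a \<gamma> (exp (\<i> * of_real \<theta>)) f u)"
  unfolding has_weak_deriv_def
proof (intro allI impI)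
  fix \<psi> :: "real \<Rightarrow> real" assume \<psi>: "\<psi> \<in> test_functions I"
  let ?E = "H_minus2_plus_Lp_norm (2 / m) \<Omega>"
  let ?M = "lebesgue_on I"
  let ?c = "exp (\<i> * of_real \<theta>)"
  let ?g = "\<lambda>t x. power_nonlinearity m (u t x)"
  have p: "1 \<le> 2 / m"
    using m by simp
  interpret L2: ext_seminorm "Lp_norm 2 \<Omega>" by (rule ext_seminorm_Lp_norm) simp
  interpret Lp: ext_seminorm "Lp_norm (2 / m) \<Omega>" by (rule ext_seminorm_Lp_norm[OF p])
  interpret E: ext_seminorm ?E by (rule ext_seminorm_H_minus2_plus_Lp_norm[OF \<Omega> p])
  have M: "complete_measure ?M"
    by (rule complete_measure_lebesgue_on[OF time_interval_sets[OF I]])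
  have complete: "complete_norm (Lp_norm 2 \<Omega>)" "complete_norm (Lp_norm (2 / m) \<Omega>)"
    using p by (auto intro: complete_norm_Lp_norm)
  have \<psi>s: "smooth \<psi>"
    by (rule test_functions_smooth[OF \<psi>])
  have \<psi>': "deriv \<psi> \<in> test_functions I"
    using test_functions_dir_deriv[OF \<psi>, of 1] dir_deriv_real[OF \<psi>s] by simp
  obtain U' where U': "has_bochner_integral_in ?M (Lp_norm 2 \<Omega>) (\<lambda>t. deriv \<psi> t *\<^sub>R u t) U'"
    using L2.ex_has_bochner_integral_in_test[OF complete(1) u I \<psi>'] by blast
  obtain U where U: "has_bochner_integral_in ?M (Lp_norm 2 \<Omega>) (\<lambda>t. \<psi> t *\<^sub>R u t) U"
    using L2.ex_has_bochner_integral_in_test[OF complete(1) u I \<psi>] by blast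
  obtain F where F: "has_bochner_integral_in ?M (Lp_norm 2 \<Omega>) (\<lambda>t. \<psi> t *\<^sub>R f t) F"
    using L2.ex_has_bochner_integral_in_test[OF complete(1) f I \<psi>] by blast
  obtain G where G: "has_bochner_integral_in ?M (Lp_norm (2 / m) \<Omega>) (\<lambda>t. \<psi> t *\<^sub>R ?g t) G"
    using Lp.ex_has_bochner_integral_in_test[OF complete(2) g I \<psi>] by blast
  have 1: "has_bochner_integral_in ?M ?E (\<lambda>t. deriv \<psi> t *\<^sub>R fun_distr \<Omega> (u t)) (fun_distr \<Omega> U')"
    using bounded_map.has_bochner_integral_in_image_scaleR[OF bounded_map_fun_distr_L2[OF \<Omega> p, of 1] M U'] by simp
  define V where "V = (laplacian (fun_distr \<Omega> (\<lambda>x. ?c * U x)) + fun_distr \<Omega> (\<lambda>x. ?c * F x))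
    + (fun_distr \<Omega> (\<lambda>x. - (?c * \<gamma>) * U x) + fun_distr \<Omega> (\<lambda>x. - (?c * a) * G x))"
  have "has_bochner_integral_in ?M ?E (\<lambda>t.
      (\<psi> t *\<^sub>R laplacian (fun_distr \<Omega> (\<lambda>x. ?c * u t x)) + \<psi> t *\<^sub>R fun_distr \<Omega> (\<lambda>x. ?c * f t x))
      + (\<psi> t *\<^sub>R fun_distr \<Omega> (\<lambda>x. - (?c * \<gamma>) * u t x) + \<psi> t *\<^sub>R fun_distr \<Omega> (\<lambda>x. - (?c * a) * ?g t x))) V"
    unfolding V_def
    by (intro E.has_bochner_integral_in_add M
        bounded_map.has_bochner_integral_in_image_scaleR[OF bounded_map_fun_distr_L2[OF \<Omega> p] M U]
        bounded_map.has_bochner_integral_in_image_scaleR[OF bounded_map_fun_distr_L2[OF \<Omega> p] M F]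
        bounded_map.has_bochner_integral_in_image_scaleR[OF bounded_map_laplacian_L2[OF \<Omega> p] M U]
        bounded_map.has_bochner_integral_in_image_scaleR[OF bounded_map_fun_distr_Lp[OF \<Omega> p] M G])
  then have 2: "has_bochner_integral_in ?M ?E (\<lambda>t. \<psi> t *\<^sub>R equation_velocity \<Omega> m a \<gamma> ?c f u t) V"
    by (simp add: equation_velocity_def scaleR_add_right)
  have V_eq: "V \<phi> = (- fun_distr \<Omega> U') \<phi>" if \<phi>: "\<phi> \<in> test_functions \<Omega>" for \<phi>
  proof -
    \<comment> \<open>With this test function the factor \<open>exp (- i \<theta>)\<close> in front of the time derivative cancels.\<close>
    define \<eta> where "\<eta> = (\<lambda>x. cnj ?c * \<phi> x)"
    have \<eta>: "\<eta> \<in> test_functions \<Omega>"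
      unfolding \<eta>_def by (rule test_functions_cmult[OF \<phi>])
    have "cnj (exp (- \<i> * of_real \<theta>)) * cnj ?c = 1"
      by (simp add: exp_cnj flip: exp_add)
    then have \<eta>_inv: "(\<lambda>x. cnj (exp (- \<i> * of_real \<theta>)) * \<eta> x) = \<phi>"
      unfolding \<eta>_def mult.assoc[symmetric] by simp
    have \<phi>s: "smooth \<phi>" "smooth \<eta>"
      using \<phi> \<eta> by (auto intro: test_functions_smooth)
    have t: "tensor \<psi> \<eta> \<in> test_functions ({0<..} \<times> \<Omega>)"
      by (rule test_functions_tensor[OF test_functions_mono[OF time_interval_subset[OF I] \<psi>] \<eta>])
    have dt: "dir_deriv (1, 0) (tensor \<psi> \<phi>) = tensor (deriv \<psi>) \<phi>"
      by (simp add: dir_deriv_tensor_time[OF \<psi>s \<phi>s(1)] dir_deriv_real[OF \<psi>s])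
    have dx: "dir_deriv (0, b) (dir_deriv (0, b) (tensor \<psi> \<eta>)) = tensor \<psi> (dir_deriv b (dir_deriv b \<eta>))" if "b \<in> Basis" for b
      by (simp add: dir_deriv_tensor_space[OF \<psi>s \<phi>s(2)] dir_deriv_tensor_space[OF \<psi>s smooth_dir_deriv[OF \<phi>s(2) that]])
    have T2: "spacetime_distr \<Omega> w (tensor \<psi> \<chi>') = fun_distr \<Omega> X \<chi>'"
      if "has_bochner_integral_in ?M (Lp_norm 2 \<Omega>) (\<lambda>t. \<psi> t *\<^sub>R w t) X" "\<chi>' \<in> test_functions \<Omega>" for w X \<chi>'
      by (rule spacetime_distr_tensor[OF \<Omega> _ I \<psi> that(2,1)]) simp
    have "- spacetime_distr \<Omega> u (tensor (deriv \<psi>) \<phi>)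
        - (\<Sum>b\<in>Basis. spacetime_distr \<Omega> u (tensor \<psi> (dir_deriv b (dir_deriv b \<eta>))))
        + spacetime_distr \<Omega> ?g (tensor \<psi> (\<lambda>x. cnj a * \<eta> x))
        + spacetime_distr \<Omega> u (tensor \<psi> (\<lambda>x. cnj \<gamma> * \<eta> x)) = spacetime_distr \<Omega> f (tensor \<psi> \<eta>)"
      using sol[unfolded solves_in_distributions_iff, rule_format, OF t] unfolding tensor_cmult \<eta>_inv dt
      by (simp only: dx cong: sum.cong)
    moreover have "spacetime_distr \<Omega> u (tensor (deriv \<psi>) \<phi>) = fun_distr \<Omega> U' \<phi>"
      by (rule spacetime_distr_tensor[OF \<Omega> _ I \<psi>' \<phi> U']) simp
    moreover have "(\<Sum>b\<in>Basis. spacetime_distr \<Omega> u (tensor \<psi> (dir_deriv b (dir_deriv b \<eta>)))) = laplacian (fun_distr \<Omega> (\<lambda>x. ?c * U x)) \<phi>"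
      unfolding laplacian_cmult_test[OF \<phi>, symmetric] \<eta>_def[symmetric]
      by (rule sum.cong[OF refl]) (intro T2[OF U] test_functions_dir_deriv \<eta>)
    moreover have "spacetime_distr \<Omega> ?g (tensor \<psi> (\<lambda>x. cnj a * \<eta> x)) = fun_distr \<Omega> (\<lambda>x. (?c * a) * G x) \<phi>"
      by (subst spacetime_distr_tensor[OF \<Omega> p I \<psi> test_functions_cmult[OF \<eta>] G])
        (simp only: fun_distr_cnj_cmult \<eta>_def mult.assoc)
    moreover have "spacetime_distr \<Omega> u (tensor \<psi> (\<lambda>x. cnj \<gamma> * \<eta> x)) = fun_distr \<Omega> (\<lambda>x. (?c * \<gamma>) * U x) \<phi>"
      by (subst T2[OF U test_functions_cmult[OF \<eta>]]) (simp only: fun_distr_cnj_cmult \<eta>_def mult.assoc)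
    moreover have "spacetime_distr \<Omega> f (tensor \<psi> \<eta>) = fun_distr \<Omega> (\<lambda>x. ?c * F x) \<phi>"
      by (subst T2[OF F \<eta>]) (simp only: fun_distr_cnj_cmult \<eta>_def)
    ultimately show ?thesis
      unfolding V_def by (simp add: fun_distr_uminus)
  qed
  have "has_bochner_integral_in ?M ?E (\<lambda>t. \<psi> t *\<^sub>R equation_velocity \<Omega> m a \<gamma> ?c f u t) (- fun_distr \<Omega> U')"
    by (rule E.has_bochner_integral_in_cong[OF 2 _ H_minus2_plus_Lp_norm_zero[OF \<Omega> p V_eq]]) simp_all
  with 1 show "\<exists>z. has_bochner_integral_in ?M ?E (\<lambda>t. deriv \<psi> t *\<^sub>R fun_distr \<Omega> (u t)) z \<and>
      has_bochner_integral_in ?M ?E (\<lambda>t. \<psi> t *\<^sub>R equation_velocity \<Omega> m a \<gamma> ?c f u t) (- z)"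
    by blast
qed

section \<open>The nonlinearity along a continuous function of time\<close>

lemma Lp_norm_power_nonlinearity_diff_le:
  assumes m: "0 < m" "m \<le> 1" and u: "Lp_norm 2 \<Omega> u < top" and v: "Lp_norm 2 \<Omega> v < top"
  shows "Lp_norm (2 / m) \<Omega> ((\<lambda>x. power_nonlinearity m (u x)) - (\<lambda>x. power_nonlinearity m (v x))) \<le> 2 * epowr (Lp_norm 2 \<Omega> (u - v)) m"
proof -
  interpret ext_seminorm "Lp_norm 2 \<Omega>" by (rule ext_seminorm_Lp_norm) simp
  have "Lp_norm 2 \<Omega> (u - v) < top"
    by (rule diff_finite[OF u v])
  then obtain A where A: "0 \<le> A" "Lp_norm 2 \<Omega> (u - v) = ennreal A"
    by (cases "Lp_norm 2 \<Omega> (u - v)") auto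
  have "Lp_norm (2 / m) \<Omega> ((\<lambda>x. power_nonlinearity m (u x)) - (\<lambda>x. power_nonlinearity m (v x))) \<le> ennreal (2 * A powr m)"
    using A by (intro Lp_norm_power_nonlinearity_diff m Lp_norm_measurable[OF u] Lp_norm_measurable[OF v]) simp_all
  also have "\<dots> = 2 * epowr (Lp_norm 2 \<Omega> (u - v)) m"
    using A by (simp add: epowr_def ennreal_mult)
  finally show ?thesis .
qed

lemma tendsto_epowr_zero:
  assumes "(f \<longlongrightarrow> 0) F" "0 < m"
  shows "((\<lambda>x. epowr (f x) m) \<longlongrightarrow> 0) F"
proof -
  have "((\<lambda>x. enn2real (f x)) \<longlongrightarrow> enn2real 0) F"
    using assms(1) by (intro tendsto_enn2real) simp_all
  then have "((\<lambda>x. enn2real (f x) powr m) \<longlongrightarrow> 0) F"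
    using assms(2) by (intro tendsto_zero_powrI[of _ _ "\<lambda>_. m" m]) simp_all
  then have "((\<lambda>x. ennreal (enn2real (f x) powr m)) \<longlongrightarrow> ennreal 0) F"
    by (rule tendsto_ennrealI)
  moreover have "\<forall>\<^sub>F x in F. f x < top"
    using assms(1) by (rule order_tendstoD(2)) simp
  then have "\<forall>\<^sub>F x in F. ennreal (enn2real (f x) powr m) = epowr (f x) m"
    by eventually_elim (simp add: epowr_def)
  ultimately show ?thesis
    by (simp add: filterlim_cong[OF refl refl])
qed

lemma epowr_mono: "0 \<le> m \<Longrightarrow> x \<le> y \<Longrightarrow> epowr x m \<le> epowr y m"
  by (cases x; cases y) (auto simp: epowr_def top_unique intro!: ennreal_leI powr_mono2)

lemma C_halfline_power_nonlinearity:
  assumes m: "0 < m" "m \<le> 1" and u: "u \<in> C_halfline (Lp_norm 2 \<Omega>)"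
  shows "(\<lambda>t x. power_nonlinearity m (u t x)) \<in> C_halfline (Lp_norm (2 / m) \<Omega>)"
  unfolding C_halfline_def
proof (intro CollectI allI impI conjI)
  fix t :: real assume t: "0 \<le> t"
  interpret ext_seminorm "Lp_norm 2 \<Omega>" by (rule ext_seminorm_Lp_norm) simp
  have fin: "Lp_norm 2 \<Omega> (u t) < top" if "0 \<le> t" for t
    using u that by (simp add: C_halfline_def)
  have "(\<lambda>x. power_nonlinearity m (u t x)) - (\<lambda>x. power_nonlinearity m ((0 :: 'a \<Rightarrow> complex) x)) = (\<lambda>x. power_nonlinearity m (u t x))"
    by (simp add: fun_eq_iff power_nonlinearity_def)
  then have "Lp_norm (2 / m) \<Omega> (\<lambda>x. power_nonlinearity m (u t x)) \<le> 2 * epowr (Lp_norm 2 \<Omega> (u t)) m"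
    using Lp_norm_power_nonlinearity_diff_le[OF m fin[OF t], of 0] by simp
  also have "\<dots> < \<infinity>"
    using fin[OF t] by (simp add: epowr_def ennreal_mult_less_top)
  finally show "Lp_norm (2 / m) \<Omega> (\<lambda>x. power_nonlinearity m (u t x)) < \<infinity>" .
  have "((\<lambda>s. Lp_norm 2 \<Omega> (u s - u t)) \<longlongrightarrow> 0) (at t within {0..})"
    using u t by (simp add: C_halfline_def)
  then have lim: "((\<lambda>s. 2 * epowr (Lp_norm 2 \<Omega> (u s - u t)) m) \<longlongrightarrow> 0) (at t within {0..})"
    by (intro tendsto_cmult_zero_ennreal tendsto_epowr_zero m) simp_all
  show "((\<lambda>s. Lp_norm (2 / m) \<Omega> ((\<lambda>x. power_nonlinearity m (u s x)) - (\<lambda>x. power_nonlinearity m (u t x)))) \<longlongrightarrow> 0) (at t within {0..})"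
  proof (rule tendsto_sandwich[OF _ _ tendsto_const lim])
    show "\<forall>\<^sub>F s in at t within {0..}. Lp_norm (2 / m) \<Omega> ((\<lambda>x. power_nonlinearity m (u s x)) - (\<lambda>x. power_nonlinearity m (u t x))) \<le> 2 * epowr (Lp_norm 2 \<Omega> (u s - u t)) m"
      unfolding eventually_at_filter using t
      by (auto intro!: always_eventually Lp_norm_power_nonlinearity_diff_le m fin)
  qed simp
qed

lemma SUP_power_nonlinearity_tendsto:
  assumes m: "0 < m" "m \<le> 1" and u: "u \<in> C_halfline (Lp_norm 2 \<Omega>)" and v: "\<And>n::nat. v n \<in> C_halfline (Lp_norm 2 \<Omega>)"
    and lim: "(\<lambda>n. SUP t\<in>{0..T}. Lp_norm 2 \<Omega> (v n t - u t)) \<longlonglongrightarrow> 0"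
  shows "(\<lambda>n. SUP t\<in>{0..T}. Lp_norm (2 / m) \<Omega> ((\<lambda>x. power_nonlinearity m (v n t x)) - (\<lambda>x. power_nonlinearity m (u t x)))) \<longlonglongrightarrow> 0"
proof (rule tendsto_zero_le_ennreal)
  show "(\<lambda>n. 2 * epowr (SUP t\<in>{0..T}. Lp_norm 2 \<Omega> (v n t - u t)) m) \<longlonglongrightarrow> 0"
    by (intro tendsto_cmult_zero_ennreal tendsto_epowr_zero m lim) simp
  fix n
  show "(SUP t\<in>{0..T}. Lp_norm (2 / m) \<Omega> ((\<lambda>x. power_nonlinearity m (v n t x)) - (\<lambda>x. power_nonlinearity m (u t x))))
      \<le> 2 * epowr (SUP t\<in>{0..T}. Lp_norm 2 \<Omega> (v n t - u t)) m"
  proof (rule SUP_least)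
    fix t assume t: "t \<in> {0..T}"
    have "Lp_norm 2 \<Omega> (v n t) < top" "Lp_norm 2 \<Omega> (u t) < top"
      using u v[of n] t by (simp_all add: C_halfline_def)
    then have "Lp_norm (2 / m) \<Omega> ((\<lambda>x. power_nonlinearity m (v n t x)) - (\<lambda>x. power_nonlinearity m (u t x))) \<le> 2 * epowr (Lp_norm 2 \<Omega> (v n t - u t)) m"
      by (rule Lp_norm_power_nonlinearity_diff_le[OF m])
    also have "\<dots> \<le> 2 * epowr (SUP t\<in>{0..T}. Lp_norm 2 \<Omega> (v n t - u t)) m"
      using m t by (intro mult_left_mono epowr_mono SUP_upper) auto
    finally show "Lp_norm (2 / m) \<Omega> ((\<lambda>x. power_nonlinearity m (v n t x)) - (\<lambda>x. power_nonlinearity m (u t x))) \<le> 2 * epowr (SUP t\<in>{0..T}. Lp_norm 2 \<Omega> (v n t - u t)) m" .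
  qed
qed

section \<open>Passage to the limit in the distributional equation\<close>

lemma spacetime_test_function_bounds:
  fixes \<Omega> :: "'a::euclidean_space set" and \<Phi> :: "real \<times> 'a \<Rightarrow> complex"
  assumes \<Omega>: "\<Omega> \<in> sets lebesgue" and \<Phi>: "\<Phi> \<in> test_functions ({0<..} \<times> \<Omega>)"
  obtains R B K where "0 < R" "\<And>t x. t \<notin> {0<..<R} \<Longrightarrow> \<Phi> (t, x) = 0" "\<And>t. bounded_supported \<Omega> B K (\<lambda>x. \<Phi> (t, x))"
proof -
  obtain S where S: "smooth \<Phi>" "compact S" "S \<subseteq> {0<..} \<times> \<Omega>" "\<forall>z. z \<notin> S \<longrightarrow> \<Phi> z = 0"
    using \<Phi> by (rule test_functionsE)
  have cont: "continuous_on UNIV \<Phi>"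
    by (rule smooth_continuous_on[OF S(1)])
  have fst_S: "compact (fst ` S)" "fst ` S \<subseteq> {0<..}"
    using S by (auto intro!: compact_continuous_image continuous_intros)
  have "time_interval {0<..}"
    by (simp add: time_interval_def)
  from time_interval_cutoff[OF this fst_S]
  obtain R where R: "0 < R" "fst ` S \<subseteq> {0<..<R}" .
  have K: "compact (snd ` S)"
    using S by (auto intro!: compact_continuous_image continuous_intros)
  have "bounded (\<Phi> ` S)"
    by (intro compact_imp_bounded compact_continuous_image smooth_continuous_on S)
  then obtain B where B: "0 < B" "\<forall>z\<in>S. cmod (\<Phi> z) \<le> B"
    unfolding bounded_pos by auto
  have "cmod (\<Phi> z) \<le> B" for z
    using B S(4) by (cases "z \<in> S") (simp_all del: split_paired_All)
  moreover have "(\<lambda>x. \<Phi> (t, x)) \<in> borel_measurable (lebesgue_on \<Omega>)" for t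
    using \<Omega> by (intro continuous_imp_measurable_on_sets_lebesgue continuous_on_compose2[OF cont]) (auto intro!: continuous_intros)
  moreover have "x \<in> snd ` S" if "\<Phi> (t, x) \<noteq> 0" for t x
    using S(4) that by force
  ultimately have "bounded_supported \<Omega> B (snd ` S) (\<lambda>x. \<Phi> (t, x))" for t
    unfolding bounded_supported_def using K B(1) by auto
  moreover have "\<Phi> (t, x) = 0" if "t \<notin> {0<..<R}" for t x
    using R(2) S(4) that by force
  ultimately show thesis
    using R(1) that by blast
qed

lemma continuous_fun_distr_slice:
  fixes \<Omega> :: "'a::euclidean_space set"
  assumes \<Omega>: "\<Omega> \<in> sets lebesgue" and p: "1 \<le> p" and y: "Lp_norm p \<Omega> y < top"
    and \<Phi>: "continuous_on UNIV \<Phi>" and b: "\<And>t. bounded_supported \<Omega> B K (\<lambda>x. \<Phi> (t, x))"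
  shows "continuous_on UNIV (\<lambda>t::real. fun_distr \<Omega> y (\<lambda>x. \<Phi> (t, x)))"
proof (rule continuous_on_sequentiallyI)
  have BK: "0 \<le> B" "compact K"
    using b[of 0] by (auto simp: bounded_supported_def)
  have K: "K \<in> sets lebesgue"
    by (rule fmeasurableD[OF lmeasurable_compact[OF BK(2)]])
  have ind: "bounded_supported \<Omega> B K (\<lambda>x. complex_of_real (B * indicator K x))"
    unfolding bounded_supported_def
  proof (intro conjI allI impI)
    have "(\<lambda>x. complex_of_real (B * indicator K x)) \<in> borel_measurable lebesgue"
      using K by measurable
    then show "(\<lambda>x. complex_of_real (B * indicator K x)) \<in> borel_measurable (lebesgue_on \<Omega>)"
      by (rule measurable_restrict_space1)
  qed (use BK in \<open>auto simp: indicator_def split: if_splits\<close>)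
  have dom: "integrable (lebesgue_on \<Omega>) (\<lambda>x. cmod (y x * cnj (complex_of_real (B * indicator K x))))"
    by (rule integrable_norm[OF integrable_pairing[OF \<Omega> p ind y]])
  fix t :: real and r :: "nat \<Rightarrow> real"
  assume r: "r \<longlonglongrightarrow> t"
  have "(\<lambda>n. \<integral>x. y x * cnj (\<Phi> (r n, x)) \<partial>lebesgue_on \<Omega>) \<longlonglongrightarrow> (\<integral>x. y x * cnj (\<Phi> (t, x)) \<partial>lebesgue_on \<Omega>)"
  proof (rule integral_dominated_convergence[OF _ _ dom])
    show "(\<lambda>x. y x * cnj (\<Phi> (t, x))) \<in> borel_measurable (lebesgue_on \<Omega>)"
      "\<And>n. (\<lambda>x. y x * cnj (\<Phi> (r n, x))) \<in> borel_measurable (lebesgue_on \<Omega>)"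
      using integrable_pairing[OF \<Omega> p b y] by (auto intro: borel_measurable_integrable)
    show "AE x in lebesgue_on \<Omega>. (\<lambda>n. y x * cnj (\<Phi> (r n, x))) \<longlonglongrightarrow> y x * cnj (\<Phi> (t, x))"
    proof (rule AE_I2)
      fix x
      have "(\<lambda>n. \<Phi> (r n, x)) \<longlonglongrightarrow> \<Phi> (t, x)"
        by (rule continuous_on_tendsto_compose[OF \<Phi>]) (auto intro!: tendsto_intros r)
      then show "(\<lambda>n. y x * cnj (\<Phi> (r n, x))) \<longlonglongrightarrow> y x * cnj (\<Phi> (t, x))"
        by (intro tendsto_intros)
    qed
    show "AE x in lebesgue_on \<Omega>. norm (y x * cnj (\<Phi> (r n, x))) \<le> cmod (y x * cnj (complex_of_real (B * indicator K x)))" for n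
    proof (rule AE_I2)
      fix x
      have "cmod (\<Phi> (r n, x)) \<le> B * indicator K x"
        using b[of "r n"] unfolding bounded_supported_def by (auto simp: indicator_def)
      then show "norm (y x * cnj (\<Phi> (r n, x))) \<le> cmod (y x * cnj (complex_of_real (B * indicator K x)))"
        using BK(1) by (simp add: norm_mult mult_left_mono abs_mult)
    qed
  qed
  then show "(\<lambda>n. fun_distr \<Omega> y (\<lambda>x. \<Phi> (r n, x))) \<longlonglongrightarrow> fun_distr \<Omega> y (\<lambda>x. \<Phi> (t, x))"
    unfolding fun_distr_def by (rule tendsto_Re)
qed

text \<open>
  For a fixed function \<open>y\<close> the pairing with the slices of \<open>\<Phi>\<close> is continuous in \<open>t\<close>, so it is measurable along a step
  function, and the pairing along \<open>w\<close> is an almost everywhere limit of such functions.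
\<close>
lemma borel_measurable_fun_distr_slice:
  fixes \<Omega> :: "'a::euclidean_space set" and R :: real
  assumes \<Omega>: "\<Omega> \<in> sets lebesgue" and p: "1 \<le> p" and w: "strongly_measurable (lebesgue_on {0<..<R}) (Lp_norm p \<Omega>) w"
    and \<Phi>: "continuous_on UNIV \<Phi>" and b: "\<And>t. bounded_supported \<Omega> B K (\<lambda>x. \<Phi> (t, x))"
  shows "(\<lambda>t. fun_distr \<Omega> (w t) (\<lambda>x. \<Phi> (t, x))) \<in> borel_measurable (lebesgue_on {0<..<R})"
proof -
  let ?M = "lebesgue_on {0<..<R}"
  let ?h = "\<lambda>y t. fun_distr \<Omega> y (\<lambda>x. \<Phi> (t, x))"
  interpret N: ext_seminorm "Lp_norm p \<Omega>" by (rule ext_seminorm_Lp_norm[OF p])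
  obtain s where s: "\<And>n::nat. simple_function ?M (s n)" and s_fin: "\<And>n t. t \<in> space ?M \<Longrightarrow> Lp_norm p \<Omega> (s n t) < \<infinity>"
    and lim: "AE t in ?M. (\<lambda>n. Lp_norm p \<Omega> (w t - s n t)) \<longlonglongrightarrow> 0"
    using w unfolding strongly_measurable_def by blast
  have meas: "(\<lambda>t. ?h (s n t) t) \<in> borel_measurable ?M" for n
  proof -
    have fin: "finite (s n ` space ?M)"
      using s by (simp add: simple_function_def)
    have "(\<lambda>t. \<Sum>y\<in>s n ` space ?M. indicator (s n -` {y} \<inter> space ?M) t * ?h y t) \<in> borel_measurable ?M"
    proof (intro borel_measurable_sum borel_measurable_times borel_measurable_indicator)
      fix y assume "y \<in> s n ` space ?M"
      then have y: "Lp_norm p \<Omega> y < top"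
        using s_fin by auto
      show "s n -` {y} \<inter> space ?M \<in> sets ?M"
        using s by (rule simple_functionD)
      show "?h y \<in> borel_measurable ?M"
        by (rule borel_measurable_lebesgue_on_borel[OF borel_measurable_continuous_onI[OF continuous_fun_distr_slice[OF \<Omega> p y \<Phi> b]]])
    qed
    moreover have "(\<Sum>y\<in>s n ` space ?M. indicator (s n -` {y} \<inter> space ?M) t * ?h y t) = ?h (s n t) t" if t: "t \<in> space ?M" for t
    proof -
      have "(\<Sum>y\<in>s n ` space ?M. indicator (s n -` {y} \<inter> space ?M) t * ?h y t) = (\<Sum>y\<in>s n ` space ?M. if y = s n t then ?h y t else 0)"
        using t by (intro sum.cong refl) (simp add: indicator_def)
      also have "\<dots> = ?h (s n t) t"
        unfolding sum.delta'[OF fin] using fin t by (simp add: sum.delta)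
      finally show ?thesis .
    qed
    ultimately show ?thesis
      by (subst measurable_cong) simp_all
  qed
  show ?thesis
  proof (rule complete_measure.borel_measurable_AE_eq[OF interval_complete_measure(1)])
    show "(\<lambda>t. lim (\<lambda>n. ?h (s n t) t)) \<in> borel_measurable ?M"
      by (intro borel_measurable_lim_metric meas)
    show "AE t in ?M. ?h (w t) t = lim (\<lambda>n. ?h (s n t) t)"
      using lim N.strongly_measurable_AE_finite[OF w] AE_space
    proof eventually_elim
      case (elim t)
      interpret L: bounded_map "Lp_norm p \<Omega>" "\<lambda>r::real. ennreal \<bar>r\<bar>" "B * (measure lebesgue K + 1)" "\<lambda>u. ?h u t"
        by (rule bounded_map_fun_distr_apply[OF \<Omega> p b])
      have "(\<lambda>n. ?h (w t) t - ?h (s n t) t) \<longlonglongrightarrow> 0"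
      proof (rule real_tendsto_zero_of_ennreal)
        show "(\<lambda>n. ennreal (B * (measure lebesgue K + 1)) * Lp_norm p \<Omega> (w t - s n t)) \<longlonglongrightarrow> 0"
          by (rule tendsto_cmult_zero_ennreal[OF elim(1)]) simp
        show "ennreal \<bar>?h (w t) t - ?h (s n t) t\<bar> \<le> ennreal (B * (measure lebesgue K + 1)) * Lp_norm p \<Omega> (w t - s n t)" for n
          using elim(2) s_fin[OF elim(3)] by (intro L.bound_diff) simp_all
      qed
      from tendsto_diff[OF tendsto_const this, of "?h (w t) t"]
      have "(\<lambda>n. ?h (s n t) t) \<longlonglongrightarrow> ?h (w t) t"
        by simp
      then show ?case
        by (rule limI[symmetric])
    qed
  qed
qed

lemma spacetime_distr_diff_le:
  fixes \<Omega> :: "'a::euclidean_space set"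
  assumes \<Omega>: "\<Omega> \<in> sets lebesgue" and p: "1 \<le> p" and \<Phi>: "\<Phi> \<in> test_functions ({0<..} \<times> \<Omega>)"
  obtains R C where "0 < R" "\<And>w v. w \<in> Lr_loc 1 (Lp_norm p \<Omega>) \<Longrightarrow> v \<in> Lr_loc 1 (Lp_norm p \<Omega>) \<Longrightarrow>
    ennreal \<bar>spacetime_distr \<Omega> w \<Phi> - spacetime_distr \<Omega> v \<Phi>\<bar> \<le> ennreal C * Lr_norm 1 {0<..<R} (Lp_norm p \<Omega>) (\<lambda>t. w t - v t)"
proof -
  obtain R B K where R: "0 < R" "\<And>t x. t \<notin> {0<..<R} \<Longrightarrow> \<Phi> (t, x) = 0" and b: "\<And>t. bounded_supported \<Omega> B K (\<lambda>x. \<Phi> (t, x))"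
    using spacetime_test_function_bounds[OF \<Omega> \<Phi>] by blast
  have cont: "continuous_on UNIV \<Phi>"
    by (intro smooth_continuous_on test_functions_smooth[OF \<Phi>])
  let ?N = "Lp_norm p \<Omega>"
  let ?C = "B * (measure lebesgue K + 1)"
  let ?M = "lebesgue_on {0<..<R}"
  let ?h = "\<lambda>y t. fun_distr \<Omega> y (\<lambda>x. \<Phi> (t, x))"
  interpret N: ext_seminorm ?N by (rule ext_seminorm_Lp_norm[OF p])
  have L: "bounded_map ?N (\<lambda>r::real. ennreal \<bar>r\<bar>) ?C (\<lambda>u. ?h u t)" for t
    by (rule bounded_map_fun_distr_apply[OF \<Omega> p b])
  have sm: "strongly_measurable ?M ?N w" and fin: "(\<integral>\<^sup>+t. ?N (w t) \<partial>?M) < top" if "w \<in> Lr_loc 1 ?N" for w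
  proof -
    have "Lr_norm 1 {0<..<R} ?N w < \<infinity>"
      using that R(1) by (simp add: Lr_loc_def)
    then show "strongly_measurable ?M ?N w" "(\<integral>\<^sup>+t. ?N (w t) \<partial>?M) < top"
      by (simp_all add: Lr_norm_1 split: if_splits)
  qed
  have int: "integrable ?M (\<lambda>t. ?h (w t) t)" if w: "w \<in> Lr_loc 1 ?N" for w
  proof (rule integrableI_bounded)
    show "(\<lambda>t. ?h (w t) t) \<in> borel_measurable ?M"
      by (rule borel_measurable_fun_distr_slice[OF \<Omega> p sm[OF w] cont b])
    have "(\<integral>\<^sup>+t. ennreal (norm (?h (w t) t)) \<partial>?M) \<le> (\<integral>\<^sup>+t. ennreal ?C * ?N (w t) \<partial>?M)"
      using N.strongly_measurable_AE_finite[OF sm[OF w]]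
      by (intro nn_integral_mono_AE, eventually_elim) (simp add: fun_distr_bound[OF \<Omega> p b])
    also have "\<dots> = ennreal ?C * (\<integral>\<^sup>+t. ?N (w t) \<partial>?M)"
      by (intro nn_integral_cmult N.borel_measurable_norm interval_complete_measure sm w)
    also have "\<dots> < \<infinity>"
      using fin[OF w] by (simp add: ennreal_mult_less_top)
    finally show "(\<integral>\<^sup>+t. ennreal (norm (?h (w t) t)) \<partial>?M) < \<infinity>" .
  qed
  have S: "spacetime_distr \<Omega> w \<Phi> = (\<integral>t. ?h (w t) t \<partial>?M)" for w
    unfolding spacetime_distr_def
  proof (rule lebesgue_integral_on_support)
    show "?h (w t) t = 0" if "t \<notin> {0<..<R}" for t
      using R(2)[OF that] by (simp add: fun_distr_def)
  qed auto
  show thesis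
  proof (rule that[OF R(1)])
    fix w v assume w: "w \<in> Lr_loc 1 ?N" and v: "v \<in> Lr_loc 1 ?N"
    have "ennreal \<bar>spacetime_distr \<Omega> w \<Phi> - spacetime_distr \<Omega> v \<Phi>\<bar> = ennreal (norm (\<integral>t. ?h (w t) t - ?h (v t) t \<partial>?M))"
      by (simp add: S Bochner_Integration.integral_diff[OF int[OF w] int[OF v]])
    also have "\<dots> \<le> (\<integral>\<^sup>+t. ennreal (norm (?h (w t) t - ?h (v t) t)) \<partial>?M)"
      by (intro integral_norm_bound_ennreal Bochner_Integration.integrable_diff int w v)
    also have "\<dots> \<le> (\<integral>\<^sup>+t. ennreal ?C * ?N (w t - v t) \<partial>?M)"
      using N.strongly_measurable_AE_finite[OF sm[OF w]] N.strongly_measurable_AE_finite[OF sm[OF v]]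
      by (intro nn_integral_mono_AE, eventually_elim) (use bounded_map.bound_diff[OF L] in simp)
    also have "\<dots> = ennreal ?C * (\<integral>\<^sup>+t. ?N (w t - v t) \<partial>?M)"
      by (intro nn_integral_cmult N.borel_measurable_norm interval_complete_measure N.strongly_measurable_diff sm w v)
    also have "\<dots> = ennreal ?C * Lr_norm 1 {0<..<R} ?N (\<lambda>t. w t - v t)"
      by (simp add: Lr_norm_1 N.strongly_measurable_diff sm w v)
    finally show "ennreal \<bar>spacetime_distr \<Omega> w \<Phi> - spacetime_distr \<Omega> v \<Phi>\<bar> \<le> ennreal ?C * Lr_norm 1 {0<..<R} ?N (\<lambda>t. w t - v t)" .
  qed
qed

lemma spacetime_distr_tendsto:
  assumes \<Omega>: "\<Omega> \<in> sets lebesgue" and p: "1 \<le> p" and \<Phi>: "\<Phi> \<in> test_functions ({0<..} \<times> \<Omega>)"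
    and w: "\<And>n. w n \<in> Lr_loc 1 (Lp_norm p \<Omega>)" and v: "v \<in> Lr_loc 1 (Lp_norm p \<Omega>)"
    and lim: "\<And>T. 0 < T \<Longrightarrow> (\<lambda>n. Lr_norm 1 {0<..<T} (Lp_norm p \<Omega>) (\<lambda>t. w n t - v t)) \<longlonglongrightarrow> 0"
  shows "(\<lambda>n. spacetime_distr \<Omega> (w n) \<Phi>) \<longlonglongrightarrow> spacetime_distr \<Omega> v \<Phi>"
proof -
  obtain R C where R: "0 < R" and le: "\<And>w v. w \<in> Lr_loc 1 (Lp_norm p \<Omega>) \<Longrightarrow> v \<in> Lr_loc 1 (Lp_norm p \<Omega>) \<Longrightarrow>
    ennreal \<bar>spacetime_distr \<Omega> w \<Phi> - spacetime_distr \<Omega> v \<Phi>\<bar> \<le> ennreal C * Lr_norm 1 {0<..<R} (Lp_norm p \<Omega>) (\<lambda>t. w t - v t)"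
    using spacetime_distr_diff_le[OF \<Omega> p \<Phi>] by blast
  have "(\<lambda>n. spacetime_distr \<Omega> (w n) \<Phi> - spacetime_distr \<Omega> v \<Phi>) \<longlonglongrightarrow> 0"
    by (rule real_tendsto_zero_of_ennreal[OF le[OF w v] tendsto_cmult_zero_ennreal[OF lim[OF R]]]) simp
  then show ?thesis
    by (simp only: LIM_zero_iff)
qed

context ext_seminorm
begin

lemma Lr_norm_1_triangle:
  assumes M: "complete_measure (lebesgue_on I)"
  shows "Lr_norm 1 I N (\<lambda>t. f t + g t) \<le> Lr_norm 1 I N f + Lr_norm 1 I N g"
proof (cases "strongly_measurable (lebesgue_on I) N f \<and> strongly_measurable (lebesgue_on I) N g")
  case True
  then have "(\<integral>\<^sup>+t. N (f t + g t) \<partial>lebesgue_on I) \<le> (\<integral>\<^sup>+t. N (f t) + N (g t) \<partial>lebesgue_on I)"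
    by (intro nn_integral_mono triangle)
  also have "\<dots> = (\<integral>\<^sup>+t. N (f t) \<partial>lebesgue_on I) + (\<integral>\<^sup>+t. N (g t) \<partial>lebesgue_on I)"
    using True by (intro nn_integral_add borel_measurable_norm M) auto
  finally show ?thesis
    using True by (simp add: Lr_norm_1 strongly_measurable_add)
qed (auto simp: Lr_norm_1)

lemma Lr_norm_1_cong:
  assumes "AE t in lebesgue_on I. N (f t - g t) = 0"
  shows "Lr_norm 1 I N f = Lr_norm 1 I N g"
proof -
  have "AE t in lebesgue_on I. N (g t - f t) = 0"
    using assms by eventually_elim (subst minus_commute)
  then have "strongly_measurable (lebesgue_on I) N f \<longleftrightarrow> strongly_measurable (lebesgue_on I) N g"
    using strongly_measurable_cong assms by blast
  moreover have "(\<integral>\<^sup>+t. N (f t) \<partial>lebesgue_on I) = (\<integral>\<^sup>+t. N (g t) \<partial>lebesgue_on I)"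
    using assms by (intro nn_integral_cong_AE, eventually_elim) (rule eq_of_diff_zero)
  ultimately show ?thesis
    by (simp add: Lr_norm_1)
qed

lemma Lr_loc_add:
  assumes "f \<in> Lr_loc 1 N" "g \<in> Lr_loc 1 N"
  shows "(\<lambda>t. f t + g t) \<in> Lr_loc 1 N"
  unfolding Lr_loc_def
proof (intro CollectI allI impI)
  fix T :: real assume "0 < T"
  then have "Lr_norm 1 {0<..<T} N f + Lr_norm 1 {0<..<T} N g < \<infinity>"
    using assms by (simp add: Lr_loc_def)
  then show "Lr_norm 1 {0<..<T} N (\<lambda>t. f t + g t) < \<infinity>"
    using Lr_norm_1_triangle[OF interval_complete_measure(1)] by (rule order_le_less_trans[rotated])
qed

lemma bounded_map_uminus: "bounded_map N N 1 uminus"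
  by (intro bounded_map.intro bounded_map_axioms.intro ext_seminorm_axioms) (simp add: bounded_linear_upto_def)

lemma has_weak_deriv_diff:
  assumes I: "I \<in> sets lebesgue" and u: "has_weak_deriv I N u u'" and v: "has_weak_deriv I N v v'"
  shows "has_weak_deriv I N (\<lambda>t. u t - v t) (\<lambda>t. u' t - v' t)"
  unfolding has_weak_deriv_def
proof (intro allI impI)
  fix \<psi> :: "real \<Rightarrow> real" assume \<psi>: "\<psi> \<in> test_functions I"
  let ?M = "lebesgue_on I"
  have M: "complete_measure ?M"
    by (rule complete_measure_lebesgue_on[OF I])
  obtain z where z: "has_bochner_integral_in ?M N (\<lambda>t. deriv \<psi> t *\<^sub>R u t) z" "has_bochner_integral_in ?M N (\<lambda>t. \<psi> t *\<^sub>R u' t) (- z)"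
    using u \<psi> unfolding has_weak_deriv_def by blast
  obtain y where y: "has_bochner_integral_in ?M N (\<lambda>t. deriv \<psi> t *\<^sub>R v t) y" "has_bochner_integral_in ?M N (\<lambda>t. \<psi> t *\<^sub>R v' t) (- y)"
    using v \<psi> unfolding has_weak_deriv_def by blast
  note minus = bounded_map.has_bochner_integral_in_image[OF bounded_map_uminus M]
  have "has_bochner_integral_in ?M N (\<lambda>t. deriv \<psi> t *\<^sub>R (u t - v t)) (z - y)"
    using has_bochner_integral_in_add[OF M z(1) minus[OF y(1)]] by (simp add: scaleR_diff_right)
  moreover have "has_bochner_integral_in ?M N (\<lambda>t. \<psi> t *\<^sub>R (u' t - v' t)) (- (z - y))"
    using has_bochner_integral_in_add[OF M z(2) minus[OF y(2)]] by (simp add: scaleR_diff_right)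
  ultimately show "\<exists>z. has_bochner_integral_in ?M N (\<lambda>t. deriv \<psi> t *\<^sub>R (u t - v t)) z \<and>
      has_bochner_integral_in ?M N (\<lambda>t. \<psi> t *\<^sub>R (u' t - v' t)) (- z)"
    by blast
qed

end

context bounded_map
begin

lemma Lr_norm_1_image_diff_le:
  assumes M: "complete_measure (lebesgue_on I)"
    and w: "strongly_measurable (lebesgue_on I) N w" and v: "strongly_measurable (lebesgue_on I) N v"
  shows "Lr_norm 1 I N' (\<lambda>t. L (w t) - L (v t)) \<le> ennreal C * Lr_norm 1 I N (\<lambda>t. w t - v t)"
proof -
  have "(\<integral>\<^sup>+t. N' (L (w t) - L (v t)) \<partial>lebesgue_on I) \<le> (\<integral>\<^sup>+t. ennreal C * N (w t - v t) \<partial>lebesgue_on I)"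
    using N.strongly_measurable_AE_finite[OF w] N.strongly_measurable_AE_finite[OF v]
    by (intro nn_integral_mono_AE, eventually_elim) (simp add: bound_diff)
  also have "\<dots> = ennreal C * (\<integral>\<^sup>+t. N (w t - v t) \<partial>lebesgue_on I)"
    by (intro nn_integral_cmult N.borel_measurable_norm M N.strongly_measurable_diff w v)
  finally show ?thesis
    using N.strongly_measurable_diff[OF w v] N'.strongly_measurable_diff[OF strongly_measurable_image[OF w] strongly_measurable_image[OF v]]
    by (simp add: Lr_norm_1)
qed

lemma Lr_loc_image:
  assumes w: "w \<in> Lr_loc 1 N"
  shows "(\<lambda>t. L (w t)) \<in> Lr_loc 1 N'"
  unfolding Lr_loc_def
proof (intro CollectI allI impI)
  fix T :: real assume T: "0 < T"
  have fin: "Lr_norm 1 {0<..<T} N w < \<infinity>"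
    using w T by (simp add: Lr_loc_def)
  then have sm: "strongly_measurable (lebesgue_on {0<..<T}) N w"
    by (simp add: Lr_norm_1 split: if_splits)
  have "strongly_measurable (lebesgue_on {0<..<T}) N (\<lambda>t. 0)"
    by (rule N.strongly_measurable_simple) simp_all
  from Lr_norm_1_image_diff_le[OF interval_complete_measure(1) sm this]
  have "Lr_norm 1 {0<..<T} N' (\<lambda>t. L (w t)) \<le> ennreal C * Lr_norm 1 {0<..<T} N w"
    by simp
  also have "\<dots> < \<infinity>"
    using fin by (simp add: ennreal_mult_less_top)
  finally show "Lr_norm 1 {0<..<T} N' (\<lambda>t. L (w t)) < \<infinity>" .
qed

end

section \<open>The equation for weak solutions\<close>

lemma laplacian_distr_cmul_test:
  assumes "\<phi> \<in> test_functions \<Omega>"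
  shows "distr_cmul d (laplacian (fun_distr \<Omega> (\<lambda>x. c * u x))) \<phi> = laplacian (fun_distr \<Omega> (\<lambda>x. d * c * u x)) \<phi>"
  using laplacian_cmult_test[OF assms, of "\<lambda>x. c * u x" d]
  by (simp add: distr_cmul_def laplacian_fun_distr mult.assoc)

lemma distr_cmul_equation_velocity:
  assumes "\<phi> \<in> test_functions \<Omega>"
  shows "distr_cmul d (equation_velocity \<Omega> m a \<gamma> c f u t) \<phi> = equation_velocity \<Omega> m a \<gamma> (d * c) f u t \<phi>"
proof -
  have "distr_cmul d (equation_velocity \<Omega> m a \<gamma> c f u t) \<phi> = distr_cmul d (laplacian (fun_distr \<Omega> (\<lambda>x. c * u t x))) \<phi>
      + distr_cmul d (fun_distr \<Omega> (\<lambda>x. c * f t x)) \<phi>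
      + (distr_cmul d (fun_distr \<Omega> (\<lambda>x. - (c * \<gamma>) * u t x)) \<phi> + distr_cmul d (fun_distr \<Omega> (\<lambda>x. - (c * a) * power_nonlinearity m (u t x))) \<phi>)"
    by (simp add: equation_velocity_def distr_cmul_def)
  then show ?thesis
    unfolding laplacian_distr_cmul_test[OF assms] distr_cmul_fun_distr
    by (simp add: equation_velocity_def mult.assoc)
qed

lemma equation_velocity_Lr_loc:
  fixes \<Omega> :: "'a::euclidean_space set"
  assumes \<Omega>: "\<Omega> \<in> sets lebesgue" and p: "1 \<le> 2 / m"
    and u: "u \<in> Lr_loc 1 (Lp_norm 2 \<Omega>)" and f: "f \<in> Lr_loc 1 (Lp_norm 2 \<Omega>)"
    and g: "(\<lambda>t x. power_nonlinearity m (u t x)) \<in> Lr_loc 1 (Lp_norm (2 / m) \<Omega>)"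
  shows "equation_velocity \<Omega> m a \<gamma> c f u \<in> Lr_loc 1 (H_minus2_plus_Lp_norm (2 / m) \<Omega>)"
proof -
  interpret E: ext_seminorm "H_minus2_plus_Lp_norm (2 / m) \<Omega>"
    by (rule ext_seminorm_H_minus2_plus_Lp_norm[OF \<Omega> p])
  have "(\<lambda>t. (laplacian (fun_distr \<Omega> (\<lambda>x. c * u t x)) + fun_distr \<Omega> (\<lambda>x. c * f t x))
    + (fun_distr \<Omega> (\<lambda>x. - (c * \<gamma>) * u t x) + fun_distr \<Omega> (\<lambda>x. - (c * a) * power_nonlinearity m (u t x))))
    \<in> Lr_loc 1 (H_minus2_plus_Lp_norm (2 / m) \<Omega>)"
    by (intro E.Lr_loc_add bounded_map.Lr_loc_image[OF bounded_map_laplacian_L2[OF \<Omega> p] u]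
        bounded_map.Lr_loc_image[OF bounded_map_fun_distr_L2[OF \<Omega> p] f]
        bounded_map.Lr_loc_image[OF bounded_map_fun_distr_L2[OF \<Omega> p] u]
        bounded_map.Lr_loc_image[OF bounded_map_fun_distr_Lp[OF \<Omega> p] g])
  then show ?thesis
    by (simp add: equation_velocity_def[abs_def])
qed

text \<open>
  The constant depends on the parameters of the equation only, so it also serves the limit of an approximating
  sequence.
\<close>
lemma equation_velocity_diff_le:
  fixes \<Omega> :: "'a::euclidean_space set" and m :: real
  assumes \<Omega>: "\<Omega> \<in> sets lebesgue" and p: "1 \<le> 2 / m"
  obtains C where "C < top" "\<And>T u f v h. 0 < T \<Longrightarrow>
    u \<in> Lr_loc 1 (Lp_norm 2 \<Omega>) \<Longrightarrow> f \<in> Lr_loc 1 (Lp_norm 2 \<Omega>) \<Longrightarrow> (\<lambda>t x. power_nonlinearity m (u t x)) \<in> Lr_loc 1 (Lp_norm (2 / m) \<Omega>) \<Longrightarrow>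
    v \<in> Lr_loc 1 (Lp_norm 2 \<Omega>) \<Longrightarrow> h \<in> Lr_loc 1 (Lp_norm 2 \<Omega>) \<Longrightarrow> (\<lambda>t x. power_nonlinearity m (v t x)) \<in> Lr_loc 1 (Lp_norm (2 / m) \<Omega>) \<Longrightarrow>
    Lr_norm 1 {0<..<T} (H_minus2_plus_Lp_norm (2 / m) \<Omega>) (\<lambda>t. equation_velocity \<Omega> m a \<gamma> c f u t - equation_velocity \<Omega> m a \<gamma> c h v t)
    \<le> C * (Lr_norm 1 {0<..<T} (Lp_norm 2 \<Omega>) (\<lambda>t. u t - v t) + Lr_norm 1 {0<..<T} (Lp_norm 2 \<Omega>) (\<lambda>t. f t - h t)
      + Lr_norm 1 {0<..<T} (Lp_norm (2 / m) \<Omega>) (\<lambda>t. (\<lambda>x. power_nonlinearity m (u t x)) - (\<lambda>x. power_nonlinearity m (v t x))))"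
proof -
  let ?E = "H_minus2_plus_Lp_norm (2 / m) \<Omega>"
  interpret E: ext_seminorm ?E
    by (rule ext_seminorm_H_minus2_plus_Lp_norm[OF \<Omega> p])
  have sm: "strongly_measurable (lebesgue_on {0<..<T}) N w" if "w \<in> Lr_loc 1 N" "0 < T" for T :: real and N :: "('a \<Rightarrow> complex) \<Rightarrow> ennreal" and w
  proof -
    have "Lr_norm 1 {0<..<T} N w < \<infinity>"
      using that by (simp add: Lr_loc_def)
    then show ?thesis
      by (simp add: Lr_norm_1 split: if_splits)
  qed
  note le = bounded_map.Lr_norm_1_image_diff_le[OF _ interval_complete_measure(1) sm sm]
  define C1 where "C1 = ennreal (DIM('a) * Hk_quasi 2 TYPE('a) * cmod c)"
  define C2 where "C2 = ennreal (Hk_quasi 2 TYPE('a) * cmod c)"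
  define C3 where "C3 = ennreal (Hk_quasi 2 TYPE('a) * cmod (- (c * \<gamma>)))"
  define C4 where "C4 = ennreal (1 * cmod (- (c * a)))"
  show thesis
  proof (rule that[of "C1 + C2 + C3 + C4"])
    show "C1 + C2 + C3 + C4 < top"
      by (simp add: C1_def C2_def C3_def C4_def)
    fix T :: real and u f v h
    assume T: "0 < T" and u: "u \<in> Lr_loc 1 (Lp_norm 2 \<Omega>)" and f: "f \<in> Lr_loc 1 (Lp_norm 2 \<Omega>)"
      and gu: "(\<lambda>t x. power_nonlinearity m (u t x)) \<in> Lr_loc 1 (Lp_norm (2 / m) \<Omega>)"
      and v: "v \<in> Lr_loc 1 (Lp_norm 2 \<Omega>)" and h: "h \<in> Lr_loc 1 (Lp_norm 2 \<Omega>)"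
      and gv: "(\<lambda>t x. power_nonlinearity m (v t x)) \<in> Lr_loc 1 (Lp_norm (2 / m) \<Omega>)"
    let ?L = "Lr_norm 1 {0<..<T} ?E"
    define X where "X = Lr_norm 1 {0<..<T} (Lp_norm 2 \<Omega>) (\<lambda>t. u t - v t)"
    define Y where "Y = Lr_norm 1 {0<..<T} (Lp_norm 2 \<Omega>) (\<lambda>t. f t - h t)"
    define Z where "Z = Lr_norm 1 {0<..<T} (Lp_norm (2 / m) \<Omega>) (\<lambda>t. (\<lambda>x. power_nonlinearity m (u t x)) - (\<lambda>x. power_nonlinearity m (v t x)))"
    have 1: "?L (\<lambda>t. laplacian (fun_distr \<Omega> (\<lambda>x. c * u t x)) - laplacian (fun_distr \<Omega> (\<lambda>x. c * v t x))) \<le> C1 * X"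
      unfolding C1_def X_def by (rule le[OF bounded_map_laplacian_L2[OF \<Omega> p] u T v T])
    have 2: "?L (\<lambda>t. fun_distr \<Omega> (\<lambda>x. c * f t x) - fun_distr \<Omega> (\<lambda>x. c * h t x)) \<le> C2 * Y"
      unfolding C2_def Y_def by (rule le[OF bounded_map_fun_distr_L2[OF \<Omega> p] f T h T])
    have 3: "?L (\<lambda>t. fun_distr \<Omega> (\<lambda>x. - (c * \<gamma>) * u t x) - fun_distr \<Omega> (\<lambda>x. - (c * \<gamma>) * v t x)) \<le> C3 * X"
      unfolding C3_def X_def by (rule le[OF bounded_map_fun_distr_L2[OF \<Omega> p] u T v T])
    have 4: "?L (\<lambda>t. fun_distr \<Omega> (\<lambda>x. - (c * a) * power_nonlinearity m (u t x)) - fun_distr \<Omega> (\<lambda>x. - (c * a) * power_nonlinearity m (v t x))) \<le> C4 * Z"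
      unfolding C4_def Z_def by (rule le[OF bounded_map_fun_distr_Lp[OF \<Omega> p] gu T gv T])
    have "(\<lambda>t. equation_velocity \<Omega> m a \<gamma> c f u t - equation_velocity \<Omega> m a \<gamma> c h v t) = (\<lambda>t.
        ((laplacian (fun_distr \<Omega> (\<lambda>x. c * u t x)) - laplacian (fun_distr \<Omega> (\<lambda>x. c * v t x)))
          + (fun_distr \<Omega> (\<lambda>x. c * f t x) - fun_distr \<Omega> (\<lambda>x. c * h t x)))
        + ((fun_distr \<Omega> (\<lambda>x. - (c * \<gamma>) * u t x) - fun_distr \<Omega> (\<lambda>x. - (c * \<gamma>) * v t x))
          + (fun_distr \<Omega> (\<lambda>x. - (c * a) * power_nonlinearity m (u t x)) - fun_distr \<Omega> (\<lambda>x. - (c * a) * power_nonlinearity m (v t x)))))"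
      unfolding equation_velocity_def add_diff_add by (rule refl)
    then have "?L (\<lambda>t. equation_velocity \<Omega> m a \<gamma> c f u t - equation_velocity \<Omega> m a \<gamma> c h v t) \<le> (C1 * X + C2 * Y) + (C3 * X + C4 * Z)"
      by (simp only:) (intro order_trans[OF E.Lr_norm_1_triangle[OF interval_complete_measure(1)]] add_mono 1 2 3 4)
    also have "\<dots> \<le> (C1 + C2 + C3 + C4) * (X + Y + Z)"
    proof -
      have "C1 * X + C2 * Y \<le> (C1 + C2) * (X + Y)" "C3 * X + C4 * Z \<le> (C3 + C4) * (X + Z)"
        by (simp_all add: distrib_left distrib_right add_increasing add_increasing2 add_mono add.assoc)
      then have "(C1 * X + C2 * Y) + (C3 * X + C4 * Z) \<le> (C1 + C2) * (X + Y + Z) + (C3 + C4) * (X + Y + Z)"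
        by (intro add_mono) (erule order_trans; intro mult_left_mono; simp add: add.assoc add_left_mono add_increasing)+
      then show ?thesis
        by (simp add: distrib_right add.assoc)
    qed
    finally show "?L (\<lambda>t. equation_velocity \<Omega> m a \<gamma> c f u t - equation_velocity \<Omega> m a \<gamma> c h v t) \<le> (C1 + C2 + C3 + C4) *
      (Lr_norm 1 {0<..<T} (Lp_norm 2 \<Omega>) (\<lambda>t. u t - v t) + Lr_norm 1 {0<..<T} (Lp_norm 2 \<Omega>) (\<lambda>t. f t - h t)
      + Lr_norm 1 {0<..<T} (Lp_norm (2 / m) \<Omega>) (\<lambda>t. (\<lambda>x. power_nonlinearity m (u t x)) - (\<lambda>x. power_nonlinearity m (v t x))))"
      by (simp only: X_def Y_def Z_def)
  qed
qed

theorem proposition2p5: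
  fixes \<Omega> :: "(real ^ 'n) set"
    and \<theta> m :: real
    and a \<gamma> :: complex
    and f u :: "real \<Rightarrow> real ^ 'n \<Rightarrow> complex"
    and f\<^sub>n u\<^sub>n :: "nat \<Rightarrow> real \<Rightarrow> real ^ 'n \<Rightarrow> complex"
  assumes "open \<Omega>"
    and "\<theta> \<in> {- (pi / 2)..pi / 2}"
    and "0 < m" and "m \<le> 1"
    and "f \<in> Lr_loc 1 (Lp_norm 2 \<Omega>)"
    and "weak_solution \<Omega> \<theta> m a \<gamma> f u"
    and "approximating_sequence \<Omega> \<theta> m a \<gamma> f u f\<^sub>n u\<^sub>n"
  shows "(\<lambda>t. fun_distr \<Omega> (u t)) \<in> W1r_loc 1 (H_minus2_plus_Lp_norm (2 / m) \<Omega>) \<and>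
    solves_in_L1_loc (H_minus2_plus_Lp_norm (2 / m) \<Omega>) \<Omega> \<theta> m a \<gamma> f u \<and>
    solves_in_distributions \<Omega> \<theta> m a \<gamma> f u \<and>
    (\<forall>T>0.
      (\<forall>n. W1r_norm 1 {0<..<T} (H_minus2_plus_Lp_norm (2 / m) \<Omega>)
             (\<lambda>t. fun_distr \<Omega> (u\<^sub>n n t)) < \<infinity>) \<and>
      (\<lambda>n. W1r_norm 1 {0<..<T} (H_minus2_plus_Lp_norm (2 / m) \<Omega>)
             (\<lambda>t. fun_distr \<Omega> (u\<^sub>n n t) - fun_distr \<Omega> (u t))) \<longlonglongrightarrow> 0)"
proof -
  let ?E = "H_minus2_plus_Lp_norm (2 / m) \<Omega>"
  let ?L2 = "Lp_norm 2 \<Omega>" and ?Lp = "Lp_norm (2 / m) \<Omega>"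
  let ?g = "\<lambda>(u :: real \<Rightarrow> real ^ 'n \<Rightarrow> complex) t x. power_nonlinearity m (u t x)"
  let ?c = "exp (\<i> * of_real \<theta>)" and ?d = "exp (- \<i> * of_real \<theta>)"
  note m = \<open>0 < m\<close> \<open>m \<le> 1\<close> and f = \<open>f \<in> Lr_loc 1 (Lp_norm 2 \<Omega>)\<close>
  have \<Omega>: "\<Omega> \<in> sets lebesgue"
    using \<open>open \<Omega>\<close> by auto
  have p: "1 \<le> 2 / m"
    using m by simp
  interpret L2: ext_seminorm ?L2 by (rule ext_seminorm_Lp_norm) simp
  interpret Lp: ext_seminorm ?Lp by (rule ext_seminorm_Lp_norm[OF p])
  interpret E: ext_seminorm ?E by (rule ext_seminorm_H_minus2_plus_Lp_norm[OF \<Omega> p])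
  have uC: "u \<in> C_halfline ?L2"
    using \<open>weak_solution \<Omega> \<theta> m a \<gamma> f u\<close> by (simp add: weak_solution_def)
  note app = \<open>approximating_sequence \<Omega> \<theta> m a \<gamma> f u f\<^sub>n u\<^sub>n\<close>[unfolded approximating_sequence_def]
  have unC: "u\<^sub>n n \<in> C_halfline ?L2" and fn: "f\<^sub>n n \<in> Lr_loc 1 ?L2"
    and sol_n: "solves_in_distributions \<Omega> \<theta> m a \<gamma> (f\<^sub>n n) (u\<^sub>n n)" for n
    using app by (auto simp: H2_solution_def)
  have lim_sup: "(\<lambda>n. SUP t\<in>{0..T}. ?L2 (u\<^sub>n n t - u t)) \<longlonglongrightarrow> 0"
    and lim_f: "(\<lambda>n. Lr_norm 1 {0<..<T} ?L2 (\<lambda>t. f\<^sub>n n t - f t)) \<longlonglongrightarrow> 0" if "0 < T" for T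
    using app that by auto
  have u: "u \<in> Lr_loc 1 ?L2" and un: "u\<^sub>n n \<in> Lr_loc 1 ?L2" for n
    by (intro L2.C_halfline_Lr_loc uC unC)+
  have guC: "?g u \<in> C_halfline ?Lp" and gunC: "?g (u\<^sub>n n) \<in> C_halfline ?Lp" for n
    by (intro C_halfline_power_nonlinearity m uC unC)+
  have gu: "?g u \<in> Lr_loc 1 ?Lp" and gun: "?g (u\<^sub>n n) \<in> Lr_loc 1 ?Lp" for n
    by (intro Lp.C_halfline_Lr_loc guC gunC)+
  have lim_u: "(\<lambda>n. Lr_norm 1 {0<..<T} ?L2 (\<lambda>t. u\<^sub>n n t - u t)) \<longlonglongrightarrow> 0" if T: "0 < T" for T
    by (rule tendsto_zero_le_ennreal[OF tendsto_cmult_zero_ennreal[OF lim_sup[OF T]] L2.Lr_norm_1_le_SUP[OF unC uC T]]) simp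
  have lim_g: "(\<lambda>n. Lr_norm 1 {0<..<T} ?Lp (\<lambda>t. ?g (u\<^sub>n n) t - ?g u t)) \<longlonglongrightarrow> 0" if T: "0 < T" for T
    by (rule tendsto_zero_le_ennreal[OF tendsto_cmult_zero_ennreal[OF SUP_power_nonlinearity_tendsto[OF m uC unC lim_sup[OF T]]] Lp.Lr_norm_1_le_SUP[OF gunC guC T]]) simp
  have sol: "solves_in_distributions \<Omega> \<theta> m a \<gamma> f u"
    unfolding solves_in_distributions_iff
  proof
    fix \<Phi> :: "real \<times> (real ^ 'n) \<Rightarrow> complex" assume \<Phi>: "\<Phi> \<in> test_functions ({0<..} \<times> \<Omega>)"
    have D: "(1, 0) \<in> (Basis :: (real \<times> (real ^ 'n)) set)" "\<And>b. b \<in> Basis \<Longrightarrow> (0, b) \<in> (Basis :: (real \<times> (real ^ 'n)) set)"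
      by (auto simp: Basis_prod_def)
    have S2: "(\<lambda>n. spacetime_distr \<Omega> (u\<^sub>n n) \<Psi>) \<longlonglongrightarrow> spacetime_distr \<Omega> u \<Psi>" if "\<Psi> \<in> test_functions ({0<..} \<times> \<Omega>)" for \<Psi>
      by (rule spacetime_distr_tendsto[OF \<Omega> _ that un u lim_u]) simp_all
    have Sf: "(\<lambda>n. spacetime_distr \<Omega> (f\<^sub>n n) \<Phi>) \<longlonglongrightarrow> spacetime_distr \<Omega> f \<Phi>"
      by (rule spacetime_distr_tendsto[OF \<Omega> _ \<Phi> fn f lim_f]) simp_all
    have Sg: "(\<lambda>n. spacetime_distr \<Omega> (?g (u\<^sub>n n)) (\<lambda>z. cnj a * \<Phi> z)) \<longlonglongrightarrow> spacetime_distr \<Omega> (?g u) (\<lambda>z. cnj a * \<Phi> z)"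
      by (rule spacetime_distr_tendsto[OF \<Omega> p test_functions_cmult[OF \<Phi>] gun gu lim_g])
    have "(\<lambda>n. - spacetime_distr \<Omega> (u\<^sub>n n) (dir_deriv (1, 0) (\<lambda>z. cnj ?d * \<Phi> z))
        - (\<Sum>b\<in>Basis. spacetime_distr \<Omega> (u\<^sub>n n) (dir_deriv (0, b) (dir_deriv (0, b) \<Phi>)))
        + spacetime_distr \<Omega> (?g (u\<^sub>n n)) (\<lambda>z. cnj a * \<Phi> z) + spacetime_distr \<Omega> (u\<^sub>n n) (\<lambda>z. cnj \<gamma> * \<Phi> z))
      \<longlonglongrightarrow> - spacetime_distr \<Omega> u (dir_deriv (1, 0) (\<lambda>z. cnj ?d * \<Phi> z))
        - (\<Sum>b\<in>Basis. spacetime_distr \<Omega> u (dir_deriv (0, b) (dir_deriv (0, b) \<Phi>)))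
        + spacetime_distr \<Omega> (?g u) (\<lambda>z. cnj a * \<Phi> z) + spacetime_distr \<Omega> u (\<lambda>z. cnj \<gamma> * \<Phi> z)"
      by (intro tendsto_add tendsto_diff tendsto_minus tendsto_sum S2 Sg test_functions_dir_deriv test_functions_cmult \<Phi> D)
    moreover have "- spacetime_distr \<Omega> (u\<^sub>n n) (dir_deriv (1, 0) (\<lambda>z. cnj ?d * \<Phi> z))
        - (\<Sum>b\<in>Basis. spacetime_distr \<Omega> (u\<^sub>n n) (dir_deriv (0, b) (dir_deriv (0, b) \<Phi>)))
        + spacetime_distr \<Omega> (?g (u\<^sub>n n)) (\<lambda>z. cnj a * \<Phi> z) + spacetime_distr \<Omega> (u\<^sub>n n) (\<lambda>z. cnj \<gamma> * \<Phi> z)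
        = spacetime_distr \<Omega> (f\<^sub>n n) \<Phi>" for n
      using sol_n[of n] \<Phi> unfolding solves_in_distributions_iff by blast
    ultimately show "- spacetime_distr \<Omega> u (dir_deriv (1, 0) (\<lambda>z. cnj ?d * \<Phi> z))
        - (\<Sum>b\<in>Basis. spacetime_distr \<Omega> u (dir_deriv (0, b) (dir_deriv (0, b) \<Phi>)))
        + spacetime_distr \<Omega> (?g u) (\<lambda>z. cnj a * \<Phi> z) + spacetime_distr \<Omega> u (\<lambda>z. cnj \<gamma> * \<Phi> z) = spacetime_distr \<Omega> f \<Phi>"
      using LIMSEQ_unique[OF _ Sf] by simp
  qed
  define v where "v = equation_velocity \<Omega> m a \<gamma> ?c f u"
  define v\<^sub>n where "v\<^sub>n n = equation_velocity \<Omega> m a \<gamma> ?c (f\<^sub>n n) (u\<^sub>n n)" for n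
  have v: "v \<in> Lr_loc 1 ?E" and vn: "v\<^sub>n n \<in> Lr_loc 1 ?E" for n
    unfolding v_def v\<^sub>n_def by (intro equation_velocity_Lr_loc \<Omega> p u un f fn gu gun)+
  have fd: "(\<lambda>t. fun_distr \<Omega> (w t)) \<in> Lr_loc 1 ?E" if "w \<in> Lr_loc 1 ?L2" for w
    using bounded_map.Lr_loc_image[OF bounded_map_fun_distr_L2[OF \<Omega> p, of 1] that] by simp
  have wd: "has_weak_deriv I ?E (\<lambda>t. fun_distr \<Omega> (u t)) v" and wdn: "has_weak_deriv I ?E (\<lambda>t. fun_distr \<Omega> (u\<^sub>n n t)) (v\<^sub>n n)"
    if "time_interval I" for I n
    unfolding v_def v\<^sub>n_def
    by (intro has_weak_deriv_equation_velocity \<Omega> m that u un f fn gu gun sol sol_n)+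
  have W: "W1r_norm 1 {0<..<T} ?E (\<lambda>t. fun_distr \<Omega> (w t)) < \<infinity>"
    if T: "0 < T" and w: "w \<in> Lr_loc 1 ?L2" and w': "w' \<in> Lr_loc 1 ?E" "has_weak_deriv {0<..<T} ?E (\<lambda>t. fun_distr \<Omega> (w t)) w'" for T w w'
  proof -
    have "W1r_norm 1 {0<..<T} ?E (\<lambda>t. fun_distr \<Omega> (w t)) \<le> Lr_norm 1 {0<..<T} ?E (\<lambda>t. fun_distr \<Omega> (w t)) + Lr_norm 1 {0<..<T} ?E w'"
      unfolding W1r_norm_def using w'(2) by (intro INF_lower) simp
    also have "\<dots> < \<infinity>"
      using fd[OF w] w'(1) T by (simp add: Lr_loc_def)
    finally show ?thesis .
  qed
  have ti: "time_interval {0<..<T}" if "0 < T" for T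
    using that by (auto simp: time_interval_def)
  have W_u: "(\<lambda>t. fun_distr \<Omega> (u t)) \<in> W1r_loc 1 ?E"
    unfolding W1r_loc_def using W[OF _ u v wd[OF ti]] by simp
  have W_un: "W1r_norm 1 {0<..<T} ?E (\<lambda>t. fun_distr \<Omega> (u\<^sub>n n t)) < \<infinity>" if "0 < T" for T n
    by (rule W[OF that un vn wdn[OF ti[OF that]]])
  have W_lim: "(\<lambda>n. W1r_norm 1 {0<..<T} ?E (\<lambda>t. fun_distr \<Omega> (u\<^sub>n n t) - fun_distr \<Omega> (u t))) \<longlonglongrightarrow> 0" if T: "0 < T" for T
  proof -
    obtain C where C: "C < top" and vel: "\<And>T u f v h. 0 < T \<Longrightarrow>
      u \<in> Lr_loc 1 ?L2 \<Longrightarrow> f \<in> Lr_loc 1 ?L2 \<Longrightarrow> ?g u \<in> Lr_loc 1 ?Lp \<Longrightarrow>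
      v \<in> Lr_loc 1 ?L2 \<Longrightarrow> h \<in> Lr_loc 1 ?L2 \<Longrightarrow> ?g v \<in> Lr_loc 1 ?Lp \<Longrightarrow>
      Lr_norm 1 {0<..<T} ?E (\<lambda>t. equation_velocity \<Omega> m a \<gamma> ?c f u t - equation_velocity \<Omega> m a \<gamma> ?c h v t)
      \<le> C * (Lr_norm 1 {0<..<T} ?L2 (\<lambda>t. u t - v t) + Lr_norm 1 {0<..<T} ?L2 (\<lambda>t. f t - h t)
        + Lr_norm 1 {0<..<T} ?Lp (\<lambda>t. ?g u t - ?g v t))"
      using equation_velocity_diff_le[OF \<Omega> p] by blast
    let ?X = "\<lambda>n. Lr_norm 1 {0<..<T} ?L2 (\<lambda>t. u\<^sub>n n t - u t)"
    let ?R = "\<lambda>n. ennreal (Hk_quasi 2 TYPE(real ^ 'n) * cmod 1) * ?X n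
      + C * (?X n + Lr_norm 1 {0<..<T} ?L2 (\<lambda>t. f\<^sub>n n t - f t) + Lr_norm 1 {0<..<T} ?Lp (\<lambda>t. ?g (u\<^sub>n n) t - ?g u t))"
    have "?R \<longlonglongrightarrow> 0 + 0"
      using tendsto_add[OF tendsto_add[OF lim_u[OF T] lim_f[OF T]] lim_g[OF T]] C
      by (intro tendsto_add tendsto_cmult_zero_ennreal lim_u[OF T]) simp_all
    then have "?R \<longlonglongrightarrow> 0"
      by simp
    then show ?thesis
    proof (rule tendsto_zero_le_ennreal)
      fix n
      have sm: "strongly_measurable (lebesgue_on {0<..<T}) ?L2 (u\<^sub>n n)" "strongly_measurable (lebesgue_on {0<..<T}) ?L2 u"
        by (intro L2.strongly_measurable_C_halfline unC uC)+
      have "W1r_norm 1 {0<..<T} ?E (\<lambda>t. fun_distr \<Omega> (u\<^sub>n n t) - fun_distr \<Omega> (u t))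
          \<le> Lr_norm 1 {0<..<T} ?E (\<lambda>t. fun_distr \<Omega> (u\<^sub>n n t) - fun_distr \<Omega> (u t)) + Lr_norm 1 {0<..<T} ?E (\<lambda>t. v\<^sub>n n t - v t)"
        unfolding W1r_norm_def
        using E.has_weak_deriv_diff[OF time_interval_sets[OF ti[OF T]] wdn[OF ti[OF T]] wd[OF ti[OF T]], of n]
        by (intro INF_lower) simp
      also have "\<dots> \<le> ?R n"
      proof (rule add_mono)
        show "Lr_norm 1 {0<..<T} ?E (\<lambda>t. fun_distr \<Omega> (u\<^sub>n n t) - fun_distr \<Omega> (u t)) \<le> ennreal (Hk_quasi 2 TYPE(real ^ 'n) * cmod 1) * ?X n"
          using bounded_map.Lr_norm_1_image_diff_le[OF bounded_map_fun_distr_L2[OF \<Omega> p, of 1] interval_complete_measure(1) sm] by simp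
        show "Lr_norm 1 {0<..<T} ?E (\<lambda>t. v\<^sub>n n t - v t)
          \<le> C * (?X n + Lr_norm 1 {0<..<T} ?L2 (\<lambda>t. f\<^sub>n n t - f t) + Lr_norm 1 {0<..<T} ?Lp (\<lambda>t. ?g (u\<^sub>n n) t - ?g u t))"
          unfolding v_def v\<^sub>n_def by (rule vel[OF T un fn gun u f gu])
      qed
      finally show "W1r_norm 1 {0<..<T} ?E (\<lambda>t. fun_distr \<Omega> (u\<^sub>n n t) - fun_distr \<Omega> (u t)) \<le> ?R n" .
    qed
  qed
  have dc: "?d * ?c = 1"
    by (simp flip: exp_add)
  have d_v: "distr_cmul ?d (v t) \<phi> = equation_velocity \<Omega> m a \<gamma> 1 f u t \<phi>" if "\<phi> \<in> test_functions \<Omega>" for t \<phi>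
    using distr_cmul_equation_velocity[OF that, of ?d m a \<gamma> ?c f u t] unfolding dc v_def .
  have L1: "solves_in_L1_loc ?E \<Omega> \<theta> m a \<gamma> f u"
    unfolding solves_in_L1_loc_def
  proof (intro exI[of _ v] conjI)
    show "has_weak_deriv {0<..} ?E (\<lambda>t. fun_distr \<Omega> (u t)) v"
      by (rule wd) (simp add: time_interval_def)
    show "(\<lambda>t. distr_cmul ?d (v t)) \<in> Lr_loc 1 ?E"
      unfolding Lr_loc_def
    proof (intro CollectI allI impI)
      fix T :: real assume T: "0 < T"
      have "?E (distr_cmul ?d (v t) - equation_velocity \<Omega> m a \<gamma> 1 f u t) = 0" for t
        by (rule H_minus2_plus_Lp_norm_zero[OF \<Omega> p d_v])
      then have "Lr_norm 1 {0<..<T} ?E (\<lambda>t. distr_cmul ?d (v t)) = Lr_norm 1 {0<..<T} ?E (equation_velocity \<Omega> m a \<gamma> 1 f u)"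
        by (intro E.Lr_norm_1_cong AE_I2)
      also have "\<dots> < \<infinity>"
        using equation_velocity_Lr_loc[OF \<Omega> p u f gu, of a \<gamma> 1] T by (simp add: Lr_loc_def)
      finally show "Lr_norm 1 {0<..<T} ?E (\<lambda>t. distr_cmul ?d (v t)) < \<infinity>" .
    qed
    show "(\<lambda>t. laplacian (fun_distr \<Omega> (u t))) \<in> Lr_loc 1 ?E"
      using bounded_map.Lr_loc_image[OF bounded_map_laplacian_L2[OF \<Omega> p, of 1] u] by simp
    show "(\<lambda>t. distr_cmul a (fun_distr \<Omega> (\<lambda>x. power_nonlinearity m (u t x)))) \<in> Lr_loc 1 ?E"
      unfolding distr_cmul_fun_distr by (rule bounded_map.Lr_loc_image[OF bounded_map_fun_distr_Lp[OF \<Omega> p] gu])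
    show "(\<lambda>t. distr_cmul \<gamma> (fun_distr \<Omega> (u t))) \<in> Lr_loc 1 ?E"
      unfolding distr_cmul_fun_distr by (rule bounded_map.Lr_loc_image[OF bounded_map_fun_distr_L2[OF \<Omega> p] u])
    show "(\<lambda>t. fun_distr \<Omega> (f t)) \<in> Lr_loc 1 ?E"
      by (rule fd[OF f])
    show "AE t in lebesgue_on {0<..}. \<forall>\<phi>\<in>test_functions \<Omega>.
        (distr_cmul ?d (v t) - laplacian (fun_distr \<Omega> (u t)) + distr_cmul a (fun_distr \<Omega> (\<lambda>x. power_nonlinearity m (u t x)))
         + distr_cmul \<gamma> (fun_distr \<Omega> (u t))) \<phi> = fun_distr \<Omega> (f t) \<phi>"
      by (intro AE_I2 ballI) (simp add: d_v[simplified] equation_velocity_def distr_cmul_fun_distr fun_distr_uminus)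
  qed
  show ?thesis
    using W_u L1 sol W_un W_lim by blast
qed

end
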